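(* Let $X$ and $Y$ be Banach spaces such that, for some $1\le r<s\le\infty$, $\Pi_r(X';Y')=\Pi_s(X';Y')$ (as sets). Then $\mathcal K_s^{min}(Y;X)=\mathcal K_r^{min}(Y;X)$. Moreover, if $A>0$ is such that $\pi_r(\cdot)\le A\,\pi_s(\cdot)$ on $\Pi_s(X';Y')$, then $\kappa_r(\cdot)\le A\,\kappa_s(\cdot)$ on $\mathcal K_s^{min}(Y;X)$.
   Context: For a Banach space $E$ and $1\le p<\infty$, $\ell_p(E)$ is the space of sequences $(x_n)_n$ in $E$ with $\|(x_n)_n\|_p=(\sum_n\|x_n\|^p)^{1/p}<\infty$. With $\frac1p+\frac1{p'}=1$, for $(x_n)_n\in\ell_p(E)$ put $p\text{-}\mathrm{co}\{x_n\}=\{\sum_{n=1}^\infty\alpha_nx_n:(\alpha_n)_n\in B_{\ell_{p'}}\}$, where $\ell_{p'}$ is replaced by $c_0$ if $p=1$. A bounded operator $T\colon E\to F$ is $p$-compact, $T\in\mathcal K_p(E;F)$, if $T(B_E)\subset p\text{-}\mathrm{co}\{x_n\}$ for some $(x_n)_n\in\ell_p(F)$, and $\kappa_p(T)=\inf\{\|(x_n)_n\|_p: T(B_E)\subset p\text{-}\mathrm{co}\{x_n\}\}$. The minimal kernel $\mathcal K_p^{min}(E;F)$ consists of all $T=ST_0R$ with $R,S$ approximable operators (operator-norm limits of finite rank operators) between Banach spaces and $T_0$ $p$-compact. $\Pi_p$ is the ideal of absolutely $p$-summing operators, with norm $\pi_p$. Conventions for $s=\infty$: $\Pi_\infty(X';Y')$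 means $\mathcal L(X';Y')$ (all bounded operators) with $\pi_\infty=\|\cdot\|$, and $\mathcal K_\infty^{min}(Y;X)$ means $\overline{\mathcal F(Y;X)}$, the operator-norm closure of the finite rank operators, with $\kappa_\infty=\|\cdot\|$. *)

theory Defs
  imports "HOL-Analysis.Analysis" "HOL-Probability.Discrete_Topology"
begin

section \<open>$p$-compact operators\<close>

definition lp :: "real \<Rightarrow> (nat \<Rightarrow> 'a::real_normed_vector) set"
  where "lp p = {x. summable (\<lambda>n. norm (x n) powr p)}"

definition lp_norm :: "real \<Rightarrow> (nat \<Rightarrow> 'a::real_normed_vector) \<Rightarrow> real"
  where "lp_norm p x = (\<Sum>n. norm (x n) powr p) powr (1 / p)"

definition conj_exp :: "real \<Rightarrow> real"
  where "conj_exp p = p / (p - 1)"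

text \<open>The unit ball of the dual sequence space; for \<open>p = 1\<close> this is the unit ball of \<open>c\<^sub>0\<close>.\<close>

definition coeff_ball :: "real \<Rightarrow> (nat \<Rightarrow> real) set"
  where "coeff_ball p =
    (if p = 1 then {a. a \<longlonglongrightarrow> 0 \<and> (\<forall>n. \<bar>a n\<bar> \<le> 1)}
     else {a \<in> lp (conj_exp p). lp_norm (conj_exp p) a \<le> 1})"

definition p_co :: "real \<Rightarrow> (nat \<Rightarrow> 'a::real_normed_vector) \<Rightarrow> 'a set"
  where "p_co p x = {y. \<exists>a\<in>coeff_ball p. (\<lambda>n. a n *\<^sub>R x n) sums y}"

definition compact_ops :: "real \<Rightarrow> ('a::real_normed_vector \<Rightarrow>\<^sub>L 'b::real_normed_vector) set"
  where "compact_ops p = {T. \<exists>x\<in>lp p. blinfun_apply T ` cball 0 1 \<subseteq> p_co p x}"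

text \<open>The infimum is taken over a nonempty set exactly when \<open>T\<close> is \<open>p\<close>-compact; for other
  \<open>T\<close> and finite \<open>p\<close> the value is meaningless.\<close>

definition kappa :: "ereal \<Rightarrow> ('a::real_normed_vector \<Rightarrow>\<^sub>L 'b::real_normed_vector) \<Rightarrow> real"
  where "kappa p T =
    (if p = \<infinity> then norm T
     else Inf {lp_norm (real_of_ereal p) x | x.
       x \<in> lp (real_of_ereal p) \<and> blinfun_apply T ` cball 0 1 \<subseteq> p_co (real_of_ereal p) x})"


section \<open>Absolutely $p$-summing operators\<close>

definition weak_lp_norm :: "real \<Rightarrow> nat \<Rightarrow> (nat \<Rightarrow> 'a::real_normed_vector) \<Rightarrow> real"
  where "weak_lp_norm p n x =
    (SUP \<phi>\<in>cball (0 :: 'a \<Rightarrow>\<^sub>L real) 1. (\<Sum>i<n. \<bar>blinfun_apply \<phi> (x i)\<bar> powr p) powr (1 / p))"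

definition summing_constants ::
    "real \<Rightarrow> ('a::real_normed_vector \<Rightarrow>\<^sub>L 'b::real_normed_vector) \<Rightarrow> real set"
  where "summing_constants p T = {C. 0 \<le> C \<and>
    (\<forall>n x. (\<Sum>i<n. norm (blinfun_apply T (x i)) powr p) powr (1 / p) \<le> C * weak_lp_norm p n x)}"

definition summing_ops :: "ereal \<Rightarrow> ('a::real_normed_vector \<Rightarrow>\<^sub>L 'b::real_normed_vector) set"
  where "summing_ops p =
    (if p = \<infinity> then UNIV else {T. summing_constants (real_of_ereal p) T \<noteq> {}})"

definition pi_norm :: "ereal \<Rightarrow> ('a::real_normed_vector \<Rightarrow>\<^sub>L 'b::real_normed_vector) \<Rightarrow> real"
  where "pi_norm p T =
    (if p = \<infinity> then norm T else Inf (summing_constants (real_of_ereal p) T))"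


section \<open>Approximable operators\<close>

definition finite_rank :: "('a::real_normed_vector \<Rightarrow>\<^sub>L 'b::real_normed_vector) \<Rightarrow> bool"
  where "finite_rank T \<longleftrightarrow> (\<exists>B. finite B \<and> range (blinfun_apply T) \<subseteq> span B)"

definition approximable_ops :: "('a::real_normed_vector \<Rightarrow>\<^sub>L 'b::real_normed_vector) set"
  where "approximable_ops = closure {T. finite_rank T}"


section \<open>The minimal kernel\<close>

text \<open>The definition of the minimal kernel quantifies existentially over the Banach spaces through
  which an operator factors. HOL has no quantifier over types, so we let all factorizations run
  through one fixed Banach space: the \<open>\<ell>\<^sub>\<infinity>\<close>-sum of all closed linear subspaces of
  \<open>\<ell>\<^sub>\<infinity>\<close>, indexed by generating sets. The theorem \<open>min_kernelI\<close> below shows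
  that this loses nothing: every operator that factors in the required way through any two Banach
  spaces \<open>'g\<close> and \<open>'h\<close> also does so through this space. The reason is that only separable
  parts of \<open>'g\<close> and \<open>'h\<close> matter, that separable spaces embed isometrically into
  \<open>\<ell>\<^sub>\<infinity>\<close>, and that each closed subspace of \<open>\<ell>\<^sub>\<infinity>\<close> is a norm-one complemented
  summand of the sum.\<close>

text \<open>\<open>\<ell>\<^sub>\<infinity>\<close> as bounded functions on discrete \<open>\<nat>\<close>; plain \<open>nat\<close> carries no metric, which the
  completeness instance of \<open>bcontfun\<close> requires of the domain.\<close>

type_synonym linf = "nat discrete \<Rightarrow>\<^sub>C real"

typedef factor_space =
  "{f :: linf set discrete \<Rightarrow>\<^sub>C linf. \<forall>A. apply_bcontfun f (discrete A) \<in> closure (span A)}"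
  morphisms rep_fs Abs_fs
proof
  show "0 \<in> {f :: linf set discrete \<Rightarrow>\<^sub>C linf.
      \<forall>A. apply_bcontfun f (discrete A) \<in> closure (span A)}"
    by (auto intro: subsetD[OF closure_subset] span_zero)
qed

setup_lifting type_definition_factor_space

lemma subspace_closure:
  fixes S :: "'a::real_normed_vector set"
  assumes S: "subspace S"
  shows "subspace (closure S)"
proof (rule subspaceI)
  show "0 \<in> closure S"
    using subspace_0[OF S] closure_subset by blast
next
  fix x y assume "x \<in> closure S" "y \<in> closure S"
  then obtain f g where fg: "\<And>n. f n \<in> S" "f \<longlonglongrightarrow> x" "\<And>n. g n \<in> S" "g \<longlonglongrightarrow> y"
    unfolding closure_sequential by auto
  then have "(\<lambda>n. f n + g n) \<longlonglongrightarrow> x + y" "\<And>n. f n + g n \<in> S"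
    by (auto intro: tendsto_add subspace_add[OF S])
  then show "x + y \<in> closure S"
    unfolding closure_sequential by (intro exI[of _ "\<lambda>n. f n + g n"]) auto
next
  fix c x assume "x \<in> closure S"
  then obtain f where f: "\<And>n. f n \<in> S" "f \<longlonglongrightarrow> x"
    unfolding closure_sequential by auto
  then have "(\<lambda>n. c *\<^sub>R f n) \<longlonglongrightarrow> c *\<^sub>R x" "\<And>n. c *\<^sub>R f n \<in> S"
    by (auto intro: tendsto_scaleR subspace_scale[OF S])
  then show "c *\<^sub>R x \<in> closure S"
    unfolding closure_sequential by (intro exI[of _ "\<lambda>n. c *\<^sub>R f n"]) auto
qed

lemma subspace_factor_space:
  "subspace {f :: linf set discrete \<Rightarrow>\<^sub>C linf.
    \<forall>A. apply_bcontfun f (discrete A) \<in> closure (span A)}"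
proof -
  have S: "subspace (closure (span A))" for A :: "linf set"
    by (simp add: subspace_closure)
  show ?thesis
    by (rule subspaceI) (simp_all add: subspace_0[OF S] subspace_add[OF S] subspace_scale[OF S])
qed

lemma closed_factor_space:
  "closed {f :: linf set discrete \<Rightarrow>\<^sub>C linf.
    \<forall>A. apply_bcontfun f (discrete A) \<in> closure (span A)}"
proof -
  have "{f :: linf set discrete \<Rightarrow>\<^sub>C linf. \<forall>A. apply_bcontfun f (discrete A) \<in> closure (span A)}
    = PiC UNIV (\<lambda>a. closure (span (of_discrete a)))"
  proof (rule set_eqI)
    fix f :: "linf set discrete \<Rightarrow>\<^sub>C linf"
    have "(\<forall>A. apply_bcontfun f (discrete A) \<in> closure (span A)) \<longleftrightarrow>
        (\<forall>a. apply_bcontfun f (discrete (of_discrete a)) \<in> closure (span (of_discrete a)))"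
      by (metis UNIV_I discrete_inverse)
    then show "f \<in> {f. \<forall>A. apply_bcontfun f (discrete A) \<in> closure (span A)} \<longleftrightarrow>
        f \<in> PiC UNIV (\<lambda>a. closure (span (of_discrete a)))"
      by (simp add: mem_PiC_iff Pi_iff of_discrete_inverse)
  qed
  then show ?thesis
    by (simp add: closed_PiC)
qed

instantiation factor_space :: real_normed_vector
begin

lift_definition zero_factor_space :: factor_space is 0
  using subspace_0[OF subspace_factor_space] by blast

lift_definition plus_factor_space :: "factor_space \<Rightarrow> factor_space \<Rightarrow> factor_space" is "(+)"
  using subspace_add[OF subspace_factor_space] by blast

lift_definition minus_factor_space :: "factor_space \<Rightarrow> factor_space \<Rightarrow> factor_space" is "(-)"
  using subspace_diff[OF subspace_factor_space] by blast

lift_definition uminus_factor_space :: "factor_space \<Rightarrow> factor_space" is uminus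
  using subspace_neg[OF subspace_factor_space] by blast

lift_definition scaleR_factor_space :: "real \<Rightarrow> factor_space \<Rightarrow> factor_space" is scaleR
  using subspace_scale[OF subspace_factor_space] by blast

lift_definition sgn_factor_space :: "factor_space \<Rightarrow> factor_space" is sgn
  unfolding sgn_div_norm using subspace_scale[OF subspace_factor_space] by blast

lift_definition norm_factor_space :: "factor_space \<Rightarrow> real" is norm .

lift_definition dist_factor_space :: "factor_space \<Rightarrow> factor_space \<Rightarrow> real" is dist .

definition uniformity_factor_space :: "(factor_space \<times> factor_space) filter"
  where "uniformity_factor_space = (INF e\<in>{0 <..}. principal {(x, y). dist x y < e})"

definition open_factor_space :: "factor_space set \<Rightarrow> bool"
  where "open_factor_space S = (\<forall>x\<in>S. \<forall>\<^sub>F (x', y) in uniformity. x' = x \<longrightarrow> y \<in> S)"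

instance
proof
  fix x y z :: factor_space and a b :: real
  show "x + y + z = x + (y + z)" "x + y = y + x" "0 + x = x" "- x + x = 0" "x - y = x + - y"
    "a *\<^sub>R (x + y) = a *\<^sub>R x + a *\<^sub>R y" "(a + b) *\<^sub>R x = a *\<^sub>R x + b *\<^sub>R x"
    "a *\<^sub>R b *\<^sub>R x = (a * b) *\<^sub>R x" "1 *\<^sub>R x = x"
    by (transfer; simp add: algebra_simps)+
  show "norm x = 0 \<longleftrightarrow> x = 0" "norm (x + y) \<le> norm x + norm y"
    "norm (a *\<^sub>R x) = \<bar>a\<bar> * norm x" "dist x y = norm (x - y)" "sgn x = inverse (norm x) *\<^sub>R x"
    by (transfer; simp add: norm_triangle_ineq dist_norm sgn_div_norm)+
  show "(uniformity :: (factor_space \<times> factor_space) filter) =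
      (INF e\<in>{0 <..}. principal {(x, y). dist x y < e})"
    by (rule uniformity_factor_space_def)
  show "open U = (\<forall>x\<in>U. \<forall>\<^sub>F (x', y) in uniformity. x' = x \<longrightarrow> y \<in> U)" for U :: "factor_space set"
    by (rule open_factor_space_def)
qed

end

lemma dist_rep_fs: "dist (rep_fs x) (rep_fs y) = dist x y"
  by transfer simp

instance factor_space :: banach
proof
  fix X :: "nat \<Rightarrow> factor_space"
  let ?F = "{f :: linf set discrete \<Rightarrow>\<^sub>C linf.
    \<forall>A. apply_bcontfun f (discrete A) \<in> closure (span A)}"
  assume "Cauchy X"
  then have "Cauchy (\<lambda>n. rep_fs (X n))"
    by (simp add: Cauchy_def dist_rep_fs)
  moreover have "\<forall>n. rep_fs (X n) \<in> ?F"
    by (intro allI rep_fs)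
  moreover have "complete ?F"
    using closed_factor_space by (simp only: complete_eq_closed)
  ultimately obtain l where "l \<in> ?F" and l: "(\<lambda>n. rep_fs (X n)) \<longlonglongrightarrow> l"
    by - (rule completeE)
  then have "dist (X n) (Abs_fs l) = dist (rep_fs (X n)) l" for n
    by (simp add: dist_rep_fs[symmetric] Abs_fs_inverse)
  with l have "X \<longlonglongrightarrow> Abs_fs l"
    by (simp add: tendsto_dist_iff[of X] tendsto_dist_iff[of "\<lambda>n. rep_fs (X n)"])
  then show "convergent X"
    by (rule convergentI)
qed

definition min_kernel :: "ereal \<Rightarrow> ('a::banach \<Rightarrow>\<^sub>L 'b::banach) set"
  where "min_kernel p =
    (if p = \<infinity> then approximable_ops
     else {S o\<^sub>L T\<^sub>0 o\<^sub>L R | (R :: 'a \<Rightarrow>\<^sub>L factor_space) T\<^sub>0 (S :: factor_space \<Rightarrow>\<^sub>L 'b).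
       R \<in> approximable_ops \<and> T\<^sub>0 \<in> compact_ops (real_of_ereal p) \<and> S \<in> approximable_ops})"


section \<open>Independence of the factorization space\<close>

definition sublinear :: "('a::real_vector \<Rightarrow> real) \<Rightarrow> bool"
  where "sublinear f \<longleftrightarrow> (\<forall>x y. f (x + y) \<le> f x + f y) \<and> (\<forall>c\<ge>0. \<forall>x. f (c *\<^sub>R x) = c * f x)"

lemma sublinearI:
  assumes "\<And>x y. f (x + y) \<le> f x + f y" "f 0 = 0" "\<And>c x. 0 < c \<Longrightarrow> f (c *\<^sub>R x) \<le> c * f x"
  shows "sublinear f"
  unfolding sublinear_def
proof (intro conjI allI impI)
  fix x y show "f (x + y) \<le> f x + f y" by fact
next
  fix c :: real and x
  assume "0 \<le> c"
  show "f (c *\<^sub>R x) = c * f x"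
  proof (cases "c = 0")
    case False
    with \<open>0 \<le> c\<close> have c: "0 < c" by simp
    have "f x \<le> inverse c * f (c *\<^sub>R x)"
      using assms(3)[of "inverse c" "c *\<^sub>R x"] c by simp
    then have "c * f x \<le> f (c *\<^sub>R x)"
      using c by (simp add: field_simps)
    with assms(3)[OF c, of x] show ?thesis by simp
  qed (simp add: assms(2))
qed

lemma sublinear_lower: "sublinear f \<Longrightarrow> - f (- x) \<le> f x"
proof -
  assume f: "sublinear f"
  have "f (x + - x) \<le> f x + f (- x)" "f (0 *\<^sub>R x) = 0 * f x"
    using f unfolding sublinear_def by blast+
  then show ?thesis by simp
qed

lemma sublinear_reduce:
  assumes f: "sublinear f"
  obtains g where "sublinear g" "\<And>x. g x \<le> f x" "g (- a) \<le> - f a"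
proof -
  have add: "f (x + y) \<le> f x + f y" for x y using f unfolding sublinear_def by blast
  have scale: "0 \<le> c \<Longrightarrow> f (c *\<^sub>R x) = c * f x" for c x using f unfolding sublinear_def by blast
  have f0: "f 0 = 0" using scale[of 0 0] by simp
  define h where "h x t = f (x + t *\<^sub>R a) - t * f a" for x t
  define g where "g x = (INF t\<in>{0..}. h x t)" for x
  have lower: "- f (- x) \<le> h x t" if "t \<ge> 0" for x t
    using add[of "x + t *\<^sub>R a" "- x"] scale[OF that, of a] by (simp add: h_def)
  have bdd: "bdd_below (h x ` {0..})" for x
    using lower by (intro bdd_belowI2[of _ "- f (- x)"]) auto
  have gh: "g x \<le> h x t" if "t \<ge> 0" for x t
    unfolding g_def using that by (intro cINF_lower bdd) auto
  have gI: "b \<le> g x" if "\<And>t. t \<ge> 0 \<Longrightarrow> b \<le> h x t" for b x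
    unfolding g_def using that by (intro cINF_greatest) auto
  show ?thesis
  proof
    show "sublinear g"
    proof (rule sublinearI)
      fix x y
      have "g (x + y) \<le> h x t + h y s" if "t \<ge> 0" "s \<ge> 0" for t s
      proof -
        have "g (x + y) \<le> h (x + y) (t + s)" using that by (intro gh) auto
        also have "\<dots> \<le> h x t + h y s"
          using add[of "x + t *\<^sub>R a" "y + s *\<^sub>R a"] by (simp add: h_def algebra_simps)
        finally show ?thesis .
      qed
      then have "g (x + y) - h y s \<le> g x" if "s \<ge> 0" for s
        using that by (intro gI) (simp add: algebra_simps)
      then have "g (x + y) - g x \<le> g y"
        by (intro gI) (simp add: algebra_simps)
      then show "g (x + y) \<le> g x + g y" by simp
    next
      have "0 \<le> g 0" using lower[of _ 0] f0 by (intro gI) auto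
      moreover have "g 0 \<le> 0" using gh[of 0 0] f0 by (simp add: h_def)
      ultimately show "g 0 = 0" by simp
    next
      fix c :: real and x assume c: "0 < c"
      have "g (c *\<^sub>R x) / c \<le> g x"
      proof (rule gI)
        fix t :: real assume t: "0 \<le> t"
        have "g (c *\<^sub>R x) \<le> h (c *\<^sub>R x) (c * t)" using c t by (intro gh) auto
        also have "\<dots> = c * h x t"
          using scale[of c "x + t *\<^sub>R a"] c by (simp add: h_def algebra_simps)
        finally show "g (c *\<^sub>R x) / c \<le> h x t" using c by (simp add: field_simps)
      qed
      then show "g (c *\<^sub>R x) \<le> c * g x" using c by (simp add: field_simps)
    qed
    show "g x \<le> f x" for x using gh[of 0 x] by (simp add: h_def)
    show "g (- a) \<le> - f a" using gh[of 1 "- a"] f0 by (simp add: h_def)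
  qed
qed

lemma minimal_sublinear:
  assumes q: "sublinear q"
  obtains f where "sublinear f" "\<And>x. f x \<le> q x"
    "\<forall>g. sublinear g \<longrightarrow> (\<forall>x. g x \<le> f x) \<longrightarrow> g = f"
proof -
  define A where "A = {f. sublinear f \<and> (\<forall>x. f x \<le> q x)}"
  define P :: "('a \<Rightarrow> real) \<Rightarrow> ('a \<Rightarrow> real) \<Rightarrow> bool" where "P f g \<longleftrightarrow> g \<le> f" for f g
  have "\<exists>m\<in>A. \<forall>a\<in>A. P m a \<longrightarrow> a = m"
  proof (rule predicate_Zorn)
    show "partial_order_on A (relation_of P A)"
      by (rule partial_order_on_relation_ofI) (auto simp: P_def)
  next
    fix C assume C: "C \<in> Chains (relation_of P A)"
    then have CA: "f \<in> A" if "f \<in> C" for f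
      using that by (auto simp: Chains_def relation_of_def)
    have chain: "f \<le> g \<or> g \<le> f" if "f \<in> C" "g \<in> C" for f g
      using C that by (auto simp: Chains_def relation_of_def P_def)
    show "\<exists>u\<in>A. \<forall>a\<in>C. P a u"
    proof (cases "C = {}")
      case True
      then show ?thesis using q by (auto simp: A_def)
    next
      case False
      define u where "u x = (INF f\<in>C. f x)" for x
      have lower: "- q (- x) \<le> f x" if "f \<in> C" for f x
      proof -
        have "- f (- x) \<le> f x" "f (- x) \<le> q (- x)"
          using CA[OF that] sublinear_lower by (auto simp: A_def)
        then show ?thesis by linarith
      qed
      have uf: "u x \<le> f x" if "f \<in> C" for f x
        unfolding u_def using that lower by (intro cINF_lower bdd_belowI2) auto
      have uI: "b \<le> u x" if "\<And>f. f \<in> C \<Longrightarrow> b \<le> f x" for b x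
        unfolding u_def using that False by (intro cINF_greatest) auto
      have subl: "f (x + y) \<le> f x + f y" "0 \<le> c \<Longrightarrow> f (c *\<^sub>R x) = c * f x" if "f \<in> C" for f x y c
        using CA[OF that] by (auto simp: A_def sublinear_def)
      have "sublinear u"
      proof (rule sublinearI)
        fix x y
        have *: "u (x + y) \<le> f x + g y" if fg: "f \<in> C" "g \<in> C" for f g
          using chain[OF fg]
        proof
          assume "f \<le> g"
          then have "f y \<le> g y" by (simp add: le_fun_def)
          then show ?thesis using uf[OF fg(1), of "x + y"] subl(1)[OF fg(1), of x y] by linarith
        next
          assume "g \<le> f"
          then have "g x \<le> f x" by (simp add: le_fun_def)
          then show ?thesis using uf[OF fg(2), of "x + y"] subl(1)[OF fg(2), of x y] by linarith
        qed
        then have "u (x + y) - g y \<le> u x" if "g \<in> C" for g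
          using that by (intro uI) (simp add: algebra_simps)
        then have "u (x + y) - u x \<le> u y"
          by (intro uI) (simp add: algebra_simps)
        then show "u (x + y) \<le> u x + u y" by simp
      next
        have "f 0 = 0" if "f \<in> C" for f using subl(2)[OF that, of 0 0] by simp
        then have "u 0 \<le> 0" "0 \<le> u 0" using False uf[of _ 0] uI[of 0 0] by fastforce+
        then show "u 0 = 0" by simp
      next
        fix c :: real and x assume c: "0 < c"
        have "u (c *\<^sub>R x) / c \<le> u x"
        proof (rule uI)
          fix f assume "f \<in> C"
          then show "u (c *\<^sub>R x) / c \<le> f x"
            using uf[of f "c *\<^sub>R x"] subl(2)[of f c x] c by (simp add: field_simps)
        qed
        then show "u (c *\<^sub>R x) \<le> c * u x" using c by (simp add: field_simps)
      qed
      moreover have "u x \<le> q x" for x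
      proof -
        obtain f where f: "f \<in> C" using False by blast
        with CA have "f x \<le> q x" by (auto simp: A_def)
        with uf[OF f, of x] show ?thesis by linarith
      qed
      ultimately show ?thesis using uf by (intro bexI[of _ u]) (auto simp: A_def P_def le_fun_def)
    qed
  qed
  then obtain m where m: "m \<in> A" "\<And>a. a \<in> A \<Longrightarrow> a \<le> m \<Longrightarrow> a = m"
    by (auto simp: P_def)
  show ?thesis
  proof (rule that)
    show "sublinear m" "m x \<le> q x" for x using m(1) by (auto simp: A_def)
    have "g = m" if g: "sublinear g" "\<forall>x. g x \<le> m x" for g
    proof -
      have "g x \<le> q x" for x using g(2) m(1) by (auto simp: A_def intro: order_trans)
      with g show ?thesis by (intro m(2)) (auto simp: A_def le_fun_def)
    qed
    then show "\<forall>g. sublinear g \<longrightarrow> (\<forall>x. g x \<le> m x) \<longrightarrow> g = m" by blast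
  qed
qed

lemma norming_functional:
  fixes a :: "'a::real_normed_vector"
  obtains \<phi> :: "'a \<Rightarrow>\<^sub>L real" where "norm \<phi> \<le> 1" "\<phi> a = norm a"
proof -
  have "sublinear (norm :: 'a \<Rightarrow> real)"
    by (simp add: sublinear_def norm_triangle_ineq)
  from sublinear_reduce[OF this, where a = a]
  obtain q :: "'a \<Rightarrow> real" where q: "sublinear q" "\<And>x. q x \<le> norm x" "q (- a) \<le> - norm a"
    by blast
  obtain f where f: "sublinear f" "\<And>x. f x \<le> q x"
    "\<forall>g. sublinear g \<longrightarrow> (\<forall>x. g x \<le> f x) \<longrightarrow> g = f"
    using minimal_sublinear[OF q(1)] by blast
  have neg: "f (- b) = - f b" for b
  proof -
    obtain g where g: "sublinear g" "\<And>x. g x \<le> f x" "g (- b) \<le> - f b"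
      using sublinear_reduce[OF f(1), where a = b] by blast
    have "g = f" using f(3) g(1,2) by blast
    with g(3) sublinear_lower[OF f(1), of b] sublinear_lower[OF f(1), of "- b"]
    show ?thesis by simp
  qed
  have add: "f (x + y) \<le> f x + f y" for x y using f(1) unfolding sublinear_def by blast
  have scale: "0 \<le> c \<Longrightarrow> f (c *\<^sub>R x) = c * f x" for c x
    using f(1) unfolding sublinear_def by blast
  have "\<bar>f x\<bar> \<le> norm x" for x
    using f(2)[of x] f(2)[of "- x"] q(2)[of x] q(2)[of "- x"] neg[of x] by simp
  then have bl: "bounded_linear f"
  proof (intro bounded_linear_intro[of _ 1])
    fix x y
    show "f (x + y) = f x + f y"
      using add[of x y] add[of "- x" "- y"] neg[of x] neg[of y] neg[of "x + y"] by simp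
    fix c
    show "f (c *\<^sub>R x) = c *\<^sub>R f x"
      using scale[of c x] scale[of "- c" x] neg[of "c *\<^sub>R x"] by (cases "c \<ge> 0") auto
  qed auto
  show ?thesis
  proof
    show "norm (Blinfun f) \<le> 1"
      using \<open>\<And>x. \<bar>f x\<bar> \<le> norm x\<close>
      by (intro norm_blinfun_bound) (simp_all add: bounded_linear_Blinfun_apply[OF bl])
    show "Blinfun f a = norm a"
      using f(2)[of "- a"] q(3) neg[of a] f(2)[of a] q(2)[of a]
      by (simp add: bounded_linear_Blinfun_apply[OF bl])
  qed
qed

lemma countable_dense_span:
  fixes D :: "'a::real_normed_vector set"
  assumes "countable D"
  obtains q :: "nat \<Rightarrow> 'a" where "closure (span D) \<subseteq> closure (range q)"
proof -
  define E where "E = (\<lambda>l. sum_list (map (\<lambda>(c, d). of_rat c *\<^sub>R d) l)) ` lists (UNIV \<times> D :: (rat \<times> 'a) set)"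
  have "countable E"
    unfolding E_def using assms by (intro countable_image countable_lists) simp
  have "0 \<in> E" unfolding E_def by (rule image_eqI[of _ _ "[]"]) auto
  have E_step: "c *\<^sub>R d + e \<in> E" if "c \<in> \<rat>" "d \<in> D" "e \<in> E" for c d e
  proof -
    obtain c' where "c = of_rat c'" using \<open>c \<in> \<rat>\<close> by (rule Rats_cases)
    moreover
    obtain l where "l \<in> lists (UNIV \<times> D)" "e = sum_list (map (\<lambda>(c, d). of_rat c *\<^sub>R d) l)"
      using \<open>e \<in> E\<close> unfolding E_def by blast
    ultimately show ?thesis
      unfolding E_def using \<open>d \<in> D\<close> by (intro image_eqI[of _ _ "(c', d) # l"]) auto
  qed
  have "x \<in> closure E" if "x \<in> span D" for x
    using that
  proof (induction rule: span_induct_alt)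
    case base
    show ?case using \<open>0 \<in> E\<close> closure_subset by blast
  next
    case (step c d e)
    have "c \<in> closure \<rat>" by (simp add: Rats_closure_real)
    then obtain c' where c': "\<And>n. c' n \<in> \<rat>" "c' \<longlonglongrightarrow> c"
      unfolding closure_sequential by blast
    obtain e' where e': "\<And>n. e' n \<in> E" "e' \<longlonglongrightarrow> e"
      using step unfolding closure_sequential by blast
    have "c' n *\<^sub>R d + e' n \<in> E" for n
      by (intro E_step c'(1) e'(1) step(1))
    moreover have "(\<lambda>n. c' n *\<^sub>R d + e' n) \<longlonglongrightarrow> c *\<^sub>R d + e"
      by (intro tendsto_intros c' e')
    ultimately show ?case
      unfolding closure_sequential by (intro exI[of _ "\<lambda>n. c' n *\<^sub>R d + e' n"] conjI allI)
  qed
  then have "closure (span D) \<subseteq> closure E"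
    by (meson closed_closure closure_minimal subsetI)
  moreover have "range (from_nat_into E) = E"
    using \<open>countable E\<close> \<open>0 \<in> E\<close> by (intro range_from_nat_into) auto
  ultimately show ?thesis using that by metis
qed

lemma isometry_into_linf:
  fixes D :: "'a::real_normed_vector set"
  assumes "countable D"
  obtains J :: "'a \<Rightarrow>\<^sub>L linf" where "\<And>x. x \<in> closure (span D) \<Longrightarrow> norm (J x) = norm x"
proof -
  obtain q :: "nat \<Rightarrow> 'a" where q: "closure (span D) \<subseteq> closure (range q)"
    using countable_dense_span[OF assms] by blast
  have "\<exists>\<phi> :: 'a \<Rightarrow>\<^sub>L real. norm \<phi> \<le> 1 \<and> blinfun_apply \<phi> (q n) = norm (q n)" for n
    using norming_functional[of "q n"] by blast
  then obtain \<phi> :: "nat \<Rightarrow> 'a \<Rightarrow>\<^sub>L real" where \<phi>: "\<And>n. norm (\<phi> n) \<le> 1" "\<And>n. \<phi> n (q n) = norm (q n)"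
    by metis
  have le: "norm (\<phi> n x) \<le> norm x" for n x
    by (rule order_trans[OF norm_blinfun]) (simp add: mult_left_le_one_le \<phi>(1))
  define j :: "'a \<Rightarrow> linf" where "j x = Bcontfun (\<lambda>n. \<phi> (of_discrete n) x)" for x
  have "(\<lambda>n. \<phi> (of_discrete n) x) \<in> bcontfun" for x
    by (rule bcontfun_normI[of _ "norm x"]) (auto intro: le continuous_at_imp_continuous_on
      simp: continuous_on_open_invariant open_discrete le[unfolded real_norm_def])
  then have j: "apply_bcontfun (j x) n = \<phi> (of_discrete n) x" for x n
    by (simp add: j_def Bcontfun_inverse)
  have jle: "norm (j x) \<le> norm x" for x
    using le[of _ x] by (intro norm_bound) (simp add: j)
  have bl: "bounded_linear j"
  proof (rule bounded_linear_intro[of _ 1])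
    show "j (x + y) = j x + j y" "j (c *\<^sub>R x) = c *\<^sub>R j x" for x y c
      by (rule bcontfun_eqI; simp add: j blinfun.bilinear_simps)+
  qed (simp add: jle)
  show ?thesis
  proof
    fix x assume "x \<in> closure (span D)"
    have "norm x \<le> norm (j x)"
    proof (rule field_le_epsilon)
      fix e :: real assume "0 < e"
      have "x \<in> closure (range q)" "0 < e / 2"
        using q \<open>x \<in> closure (span D)\<close> \<open>0 < e\<close> by auto
      then obtain n where n: "dist (q n) x < e / 2"
        unfolding closure_approachable by blast
      have "norm x \<le> norm (q n) + norm (x - q n)"
        by (metis add.commute diff_add_cancel norm_triangle_ineq)
      moreover have "norm (q n) = \<phi> n x - \<phi> n (x - q n)"
        by (simp add: blinfun.bilinear_simps \<phi>(2))
      moreover have "\<phi> n x \<le> norm (j x)"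
        using norm_bounded[of "j x" "discrete n"] by (simp add: j discrete_inverse)
      moreover have "- \<phi> n (x - q n) \<le> norm (x - q n)"
        using le[of n "x - q n"] by simp
      moreover have "norm (x - q n) < e / 2"
        using n by (simp add: dist_norm norm_minus_commute)
      ultimately show "norm x \<le> norm (j x) + e" by linarith
    qed
    with jle show "norm (Blinfun j x) = norm x"
      by (simp add: bounded_linear_Blinfun_apply[OF bl] antisym)
  qed
qed

lemma complemented_copy:
  fixes D :: "'a::banach set"
  assumes "countable D"
  obtains i :: "'a \<Rightarrow> factor_space" and P :: "factor_space \<Rightarrow>\<^sub>L 'a"
  where "\<forall>x\<in>closure (span D). \<forall>y\<in>closure (span D). i (x + y) = i x + i y"
    and "\<forall>x\<in>closure (span D). \<forall>c. i (c *\<^sub>R x) = c *\<^sub>R i x"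
    and "\<forall>x\<in>closure (span D). norm (i x) = norm x \<and> P (i x) = x"
    and "\<forall>u. norm (P u) \<le> norm u"
proof -
  define G where "G = closure (span D)"
  have G: "subspace G" "closed G"
    unfolding G_def by (simp_all add: subspace_closure)
  obtain J :: "'a \<Rightarrow>\<^sub>L linf" where J: "\<And>x. x \<in> G \<Longrightarrow> norm (J x) = norm x"
    using isometry_into_linf[OF assms] unfolding G_def by blast
  have inj: "inj_on J G"
  proof (rule inj_onI)
    fix x y assume "x \<in> G" "y \<in> G" "J x = J y"
    then have "norm (x - y) = 0"
      using J[of "x - y"] subspace_diff[OF G(1)] by (simp add: blinfun.bilinear_simps)
    then show "x = y" by simp
  qed
  define A where "A = J ` G"
  have "subspace A"
    unfolding A_def
    by (rule linear_subspace_image[OF _ G(1)]) (simp add: bounded_linear.linear blinfun.bounded_linear_right)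
  moreover have "complete A"
    unfolding A_def
    using J G by (intro complete_isometric_image[of 1]) (auto simp: blinfun.bounded_linear_right complete_eq_closed)
  ultimately have A: "closure (span A) = A"
    by (simp add: complete_imp_closed span_eq_iff[THEN iffD2])
  define i where "i x = Abs_fs (Bcontfun (\<lambda>B. if of_discrete B = A \<and> x \<in> G then J x else 0))" for x
  have Bc: "(\<lambda>B. if of_discrete B = A \<and> x \<in> G then J x else 0) \<in> bcontfun" for x
    by (rule bcontfun_normI[of _ "norm (J x)"])
      (auto simp: continuous_on_open_invariant open_discrete)
  have i: "apply_bcontfun (rep_fs (i x)) B = (if of_discrete B = A \<and> x \<in> G then J x else 0)" for x B
  proof -
    have "J x \<in> A" if "x \<in> G" using that by (simp add: A_def)
    then have "Bcontfun (\<lambda>B. if of_discrete B = A \<and> x \<in> G then J x else 0)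
        \<in> {f. \<forall>A. apply_bcontfun f (discrete A) \<in> closure (span A)}"
      using A by (auto simp: Bcontfun_inverse[OF Bc] discrete_inverse intro: subsetD[OF closure_subset] span_zero)
    then show ?thesis
      by (simp add: i_def Abs_fs_inverse Bcontfun_inverse[OF Bc])
  qed
  define K where "K = inv_into G J"
  have K: "K y \<in> G" "J (K y) = y" if "y \<in> A" for y
    using that unfolding K_def A_def by (auto intro: inv_into_into f_inv_into_f)
  have KJ: "K (J x) = x" if "x \<in> G" for x
    using that inj by (simp add: K_def)
  define \<pi> where "\<pi> u = apply_bcontfun (rep_fs u) (discrete A)" for u
  have \<pi>: "\<pi> u \<in> A" for u
    using rep_fs[of u] A unfolding \<pi>_def by blast
  have \<pi>_lin: "\<pi> (u + v) = \<pi> u + \<pi> v" "\<pi> (c *\<^sub>R u) = c *\<^sub>R \<pi> u" for u v c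
    by (simp_all add: \<pi>_def plus_factor_space.rep_eq scaleR_factor_space.rep_eq)
  have \<pi>_norm: "norm (\<pi> u) \<le> norm u" for u
    by (simp add: \<pi>_def norm_factor_space.rep_eq norm_bounded)
  define P where "P u = K (\<pi> u)" for u
  have PG: "P u \<in> G" for u by (simp add: P_def K \<pi>)
  have JP: "J (P u) = \<pi> u" for u by (simp add: P_def K \<pi>)
  have Pnorm: "norm (P u) \<le> norm u" for u
    using J[OF PG[of u]] \<pi>_norm[of u] by (simp add: JP)
  have bl: "bounded_linear P"
  proof (rule bounded_linear_intro[of _ 1])
    fix u v c
    show "P (u + v) = P u + P v"
      by (rule inj_onD[OF inj]) (simp_all add: JP PG blinfun.bilinear_simps \<pi>_lin subspace_add[OF G(1)])
    show "P (c *\<^sub>R u) = c *\<^sub>R P u"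
      by (rule inj_onD[OF inj]) (simp_all add: JP PG blinfun.bilinear_simps \<pi>_lin subspace_scale[OF G(1)])
  qed (simp add: Pnorm)
  have fs_eqI: "u = v" if "\<And>B. apply_bcontfun (rep_fs u) B = apply_bcontfun (rep_fs v) B" for u v
    using that by (simp add: bcontfun_eqI rep_fs_inject[symmetric])
  have i_add: "i (x + y) = i x + i y" if "x \<in> G" "y \<in> G" for x y
    by (rule fs_eqI)
      (simp add: plus_factor_space.rep_eq i that subspace_add[OF G(1)] blinfun.bilinear_simps)
  have i_scale: "i (c *\<^sub>R x) = c *\<^sub>R i x" if "x \<in> G" for x c
    by (rule fs_eqI)
      (simp add: scaleR_factor_space.rep_eq i that subspace_scale[OF G(1)] blinfun.bilinear_simps)
  have Pi: "P (i x) = x" if "x \<in> G" for x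
    by (simp add: P_def \<pi>_def i that discrete_inverse KJ)
  have i_norm: "norm (i x) = norm x" if "x \<in> G" for x
  proof (rule antisym)
    show "norm (i x) \<le> norm x"
      unfolding norm_factor_space.rep_eq by (rule norm_bound) (simp add: i J)
    show "norm x \<le> norm (i x)"
      using Pnorm[of "i x"] by (simp add: Pi that)
  qed
  show ?thesis
    by (rule that[of i "Blinfun P", folded G_def])
      (simp_all add: bounded_linear_Blinfun_apply[OF bl] i_add i_scale i_norm Pi Pnorm)
qed

lemma finite_rank_compose:
  fixes S :: "'c::real_normed_vector \<Rightarrow>\<^sub>L 'd::real_normed_vector"
    and T :: "'b::real_normed_vector \<Rightarrow>\<^sub>L 'c" and R :: "'a::real_normed_vector \<Rightarrow>\<^sub>L 'b"
  assumes "finite_rank T"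
  shows "finite_rank (S o\<^sub>L T o\<^sub>L R)"
proof -
  obtain B where B: "finite B" "range T \<subseteq> span B"
    using assms unfolding finite_rank_def by blast
  have "range (S o\<^sub>L T o\<^sub>L R) \<subseteq> S ` span B"
    using B(2) by auto
  also have "\<dots> = span (S ` B)"
    by (simp add: linear_span_image bounded_linear.linear blinfun.bounded_linear_right)
  finally show ?thesis
    unfolding finite_rank_def using B(1) by blast
qed

lemma approximable_compose_right:
  fixes S :: "'b::real_normed_vector \<Rightarrow>\<^sub>L 'c::real_normed_vector"
    and R :: "'a::real_normed_vector \<Rightarrow>\<^sub>L 'b"
  assumes "S \<in> approximable_ops"
  shows "S o\<^sub>L R \<in> approximable_ops"
proof -
  obtain F where F: "\<And>n. finite_rank (F n)" "F \<longlonglongrightarrow> S"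
    using assms unfolding approximable_ops_def closure_sequential by auto
  have "finite_rank (F n o\<^sub>L R)" for n
  proof -
    have "id_blinfun o\<^sub>L F n o\<^sub>L R = F n o\<^sub>L R"
      by (rule blinfun_eqI) simp
    then show ?thesis using finite_rank_compose[OF F(1), of id_blinfun n R] by simp
  qed
  moreover have "(\<lambda>n. F n o\<^sub>L R) \<longlonglongrightarrow> (S o\<^sub>L R)"
    by (intro bounded_bilinear.tendsto[OF bounded_bilinear_blinfun_compose] F(2) tendsto_const)
  ultimately show ?thesis
    unfolding approximable_ops_def closure_sequential
    by (intro exI[of _ "\<lambda>n. F n o\<^sub>L R"]) auto
qed

lemma finite_rank_countable_range:
  assumes "\<And>n :: nat. finite_rank (F n)"
  obtains D where "countable D" "\<forall>n y. blinfun_apply (F n) y \<in> span D"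
proof -
  obtain B where B: "\<And>n. finite (B n)" "\<And>n. range (F n) \<subseteq> span (B n)"
    using assms unfolding finite_rank_def by metis
  show ?thesis
  proof
    show "countable (\<Union>n. B n)" using B(1) by (simp add: countable_finite)
    show "\<forall>n y. F n y \<in> span (\<Union>n. B n)"
      using B(2) span_mono[of "B _" "\<Union>n. B n"] by blast
  qed
qed

theorem min_kernelI:
  fixes R :: "'a::banach \<Rightarrow>\<^sub>L 'g::banach" and T\<^sub>0 :: "'g \<Rightarrow>\<^sub>L 'h::banach" and S :: "'h \<Rightarrow>\<^sub>L 'b::banach"
  assumes R: "R \<in> approximable_ops" and T\<^sub>0: "T\<^sub>0 \<in> compact_ops (real_of_ereal p)"
    and S: "S \<in> approximable_ops" and p: "p \<noteq> \<infinity>"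
  shows "S o\<^sub>L T\<^sub>0 o\<^sub>L R \<in> min_kernel p"
proof -
  let ?p = "real_of_ereal p"
  obtain F where F: "\<And>n. finite_rank (F n)" "F \<longlonglongrightarrow> R"
    using R unfolding approximable_ops_def closure_sequential by auto
  obtain D where D: "countable D" and FD: "\<forall>n y. F n y \<in> span D"
    by (rule finite_rank_countable_range[of F, OF F(1)])
  define G where "G = closure (span D)"
  have G: "subspace G" "closed G"
    unfolding G_def by (simp_all add: subspace_closure)
  have FG: "F n y \<in> G" for n y
    unfolding G_def using FD closure_subset by blast
  have RG: "R y \<in> G" for y
  proof -
    have "(\<lambda>n. F n y) \<longlonglongrightarrow> R y"
      by (intro blinfun.tendsto F(2) tendsto_const)
    then show ?thesis
      by (rule closed_sequentially[OF G(2), rotated]) (rule FG)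
  qed
  obtain x where x: "x \<in> lp ?p" "T\<^sub>0 ` cball 0 1 \<subseteq> p_co ?p x"
    using T\<^sub>0 unfolding compact_ops_def by blast
  define H where "H = closure (span (range x))"
  have H: "subspace H" "closed H"
    unfolding H_def by (simp_all add: subspace_closure)
  have xH: "x n \<in> H" for n
    unfolding H_def by (meson closure_subset rangeI span_base subsetD)
  have p_co_H: "y \<in> H" if y: "y \<in> p_co ?p x" for y
  proof -
    obtain a where "(\<lambda>n. a n *\<^sub>R x n) sums y"
      using y unfolding p_co_def by blast
    then show ?thesis
      unfolding sums_def
      by (rule closed_sequentially[OF H(2), rotated]) (intro subspace_sum[OF H(1)] subspace_scale[OF H(1)] xH)
  qed
  have T\<^sub>0H: "T\<^sub>0 y \<in> H" for y
  proof -
    have "y /\<^sub>R norm y \<in> cball 0 1"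
      by (cases "y = 0") simp_all
    then have "T\<^sub>0 (y /\<^sub>R norm y) \<in> H"
      using x(2) p_co_H by blast
    then have "norm y *\<^sub>R T\<^sub>0 (y /\<^sub>R norm y) \<in> H"
      by (rule subspace_scale[OF H(1)])
    then show ?thesis
      by (cases "y = 0") (simp_all add: blinfun.bilinear_simps subspace_0[OF H(1)])
  qed

  obtain i :: "'g \<Rightarrow> factor_space" and P :: "factor_space \<Rightarrow>\<^sub>L 'g" where *:
    "\<forall>x\<in>G. \<forall>y\<in>G. i (x + y) = i x + i y"
    "\<forall>x\<in>G. \<forall>c. i (c *\<^sub>R x) = c *\<^sub>R i x"
    "\<forall>x\<in>G. norm (i x) = norm x \<and> blinfun_apply P (i x) = x"
    "\<forall>u. norm (blinfun_apply P u) \<le> norm u"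
    by (rule complemented_copy[OF D, folded G_def])
  have i: "\<And>x y. x \<in> G \<Longrightarrow> y \<in> G \<Longrightarrow> i (x + y) = i x + i y"
    "\<And>x c. x \<in> G \<Longrightarrow> i (c *\<^sub>R x) = c *\<^sub>R i x"
    "\<And>x. x \<in> G \<Longrightarrow> norm (i x) = norm x"
    and P: "\<And>x. x \<in> G \<Longrightarrow> P (i x) = x" "\<And>u. norm (P u) \<le> norm u"
    using * by auto
  have countable_x: "countable (range x)" by simp
  obtain j :: "'h \<Rightarrow> factor_space" and Q :: "factor_space \<Rightarrow>\<^sub>L 'h" where *:
    "\<forall>x\<in>H. \<forall>y\<in>H. j (x + y) = j x + j y"
    "\<forall>x\<in>H. \<forall>c. j (c *\<^sub>R x) = c *\<^sub>R j x"
    "\<forall>x\<in>H. norm (j x) = norm x \<and> blinfun_apply Q (j x) = x"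
    "\<forall>u. norm (blinfun_apply Q u) \<le> norm u"
    by (rule complemented_copy[OF countable_x, folded H_def])
  have j: "\<And>x y. x \<in> H \<Longrightarrow> y \<in> H \<Longrightarrow> j (x + y) = j x + j y"
    "\<And>x c. x \<in> H \<Longrightarrow> j (c *\<^sub>R x) = c *\<^sub>R j x"
    "\<And>x. x \<in> H \<Longrightarrow> norm (j x) = norm x"
    and Q: "\<And>x. x \<in> H \<Longrightarrow> Q (j x) = x" "\<And>u. norm (Q u) \<le> norm u"
    using * by auto

  have bl_i: "bounded_linear (\<lambda>y. i (L y))" if "\<And>y. L y \<in> G" for L :: "'a \<Rightarrow>\<^sub>L 'g"
    by (rule bounded_linear_intro[of _ "norm L"])
      (simp_all add: i that blinfun.bilinear_simps norm_blinfun mult.commute[of "norm _" "norm L"])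
  define R' where "R' = Blinfun (\<lambda>y. i (R y))"
  have R': "R' y = i (R y)" for y
    unfolding R'_def by (simp add: bounded_linear_Blinfun_apply bl_i RG)
  define F' where "F' n = Blinfun (\<lambda>y. i (F n y))" for n
  have F': "F' n y = i (F n y)" for n y
    unfolding F'_def by (simp add: bounded_linear_Blinfun_apply bl_i FG)
  have "finite_rank (F' n)" for n
  proof -
    obtain B where B: "finite B" "B \<subseteq> range (F n)" "range (F n) \<subseteq> span B"
    proof -
      obtain B\<^sub>0 where B\<^sub>0: "finite B\<^sub>0" "range (F n) \<subseteq> span B\<^sub>0"
        using F(1) unfolding finite_rank_def by blast
      obtain B where "B \<subseteq> range (F n)" "independent B" "range (F n) \<subseteq> span B"
        using maximal_independent_subset by blast
      moreover from this have "finite B"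
        using independent_span_bound[OF B\<^sub>0(1), of B] B\<^sub>0(2) by blast
      ultimately show ?thesis using that by blast
    qed
    have "v \<in> G \<and> i v \<in> span (i ` B)" if "v \<in> span B" for v
      using that
    proof (induction rule: span_induct_alt)
      case base
      have "i 0 = 0" using i(3)[OF subspace_0[OF G(1)]] by simp
      then show ?case by (simp add: subspace_0[OF G(1)] span_zero)
    next
      case (step c b v)
      then have "b \<in> G" using B(2) FG by blast
      with step show ?case
        by (simp add: i subspace_add[OF G(1)] subspace_scale[OF G(1)] span_add span_scale span_base)
    qed
    then have "range (F' n) \<subseteq> span (i ` B)"
      using B(3) by (auto simp: F')
    then show ?thesis
      unfolding finite_rank_def using B(1) by blast
  qed
  moreover have "F' \<longlonglongrightarrow> R'"
  proof -
    have "norm (F' n - R') \<le> norm (F n - R)" for n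
    proof (rule norm_blinfun_bound)
      fix y
      have "i (F n y + (-1) *\<^sub>R R y) = i (F n y) + (-1) *\<^sub>R i (R y)"
        using FG RG by (simp only: i subspace_scale[OF G(1)])
      then have "(F' n - R') y = i ((F n - R) y)"
        by (simp add: blinfun.bilinear_simps F' R')
      moreover have "(F n - R) y \<in> G"
        by (simp add: blinfun.bilinear_simps subspace_diff[OF G(1)] FG RG)
      ultimately show "norm ((F' n - R') y) \<le> norm (F n - R) * norm y"
        by (simp add: i norm_blinfun)
    qed simp
    moreover have "(\<lambda>n. norm (F n - R)) \<longlonglongrightarrow> 0"
      using F(2) by (simp add: LIM_zero tendsto_norm_zero)
    ultimately have "(\<lambda>n. F' n - R') \<longlonglongrightarrow> 0"
      by (intro Lim_null_comparison[of "\<lambda>n. F' n - R'"]) (simp_all add: always_eventually)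
    then show ?thesis
      by (rule LIM_zero_cancel)
  qed
  ultimately have R'_app: "R' \<in> approximable_ops"
    unfolding approximable_ops_def closure_sequential by (intro exI[of _ F']) auto

  have bl_T: "bounded_linear (\<lambda>u. j (T\<^sub>0 (P u)))"
  proof (rule bounded_linear_intro[of _ "norm T\<^sub>0"])
    fix u
    have "norm (T\<^sub>0 (P u)) \<le> norm T\<^sub>0 * norm (P u)" by (rule norm_blinfun)
    also have "\<dots> \<le> norm T\<^sub>0 * norm u" by (simp add: P(2) mult_left_mono)
    finally show "norm (j (T\<^sub>0 (P u))) \<le> norm u * norm T\<^sub>0" by (simp add: j T\<^sub>0H mult.commute[of _ "norm T\<^sub>0"])
  qed (simp_all add: j T\<^sub>0H blinfun.bilinear_simps)
  define T' where "T' = Blinfun (\<lambda>u. j (T\<^sub>0 (P u)))"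
  have T': "T' u = j (T\<^sub>0 (P u))" for u
    unfolding T'_def by (simp add: bounded_linear_Blinfun_apply bl_T)
  have "T' \<in> compact_ops ?p"
  proof -
    have "(\<lambda>n. j (x n)) \<in> lp ?p"
      using x(1) by (simp add: lp_def j xH)
    moreover have "T' ` cball 0 1 \<subseteq> p_co ?p (\<lambda>n. j (x n))"
    proof
      fix z assume "z \<in> T' ` cball 0 1"
      then obtain u where u: "norm u \<le> 1" "z = j (T\<^sub>0 (P u))" by (auto simp: T')
      then have "P u \<in> cball 0 1" using P(2)[of u] by simp
      then have "T\<^sub>0 (P u) \<in> p_co ?p x" using x(2) by blast
      then obtain a where a: "a \<in> coeff_ball ?p" "(\<lambda>n. a n *\<^sub>R x n) sums T\<^sub>0 (P u)"
        unfolding p_co_def by blast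
      have sumH: "(\<Sum>k<n. a k *\<^sub>R x k) \<in> H" for n
        by (intro subspace_sum[OF H(1)] subspace_scale[OF H(1)] xH)
      have j0: "j 0 = 0" using j(3)[OF subspace_0[OF H(1)]] by simp
      have jsum: "j (\<Sum>k<n. a k *\<^sub>R x k) = (\<Sum>k<n. a k *\<^sub>R j (x k))" for n
        by (induction n) (simp_all add: j0 j sumH xH subspace_scale[OF H(1)])
      have "(\<lambda>n. (\<Sum>k<n. a k *\<^sub>R j (x k)) - z) \<longlonglongrightarrow> 0"
      proof (rule Lim_null_comparison)
        show "\<forall>\<^sub>F n in sequentially. norm ((\<Sum>k<n. a k *\<^sub>R j (x k)) - z)
            \<le> norm ((\<Sum>k<n. a k *\<^sub>R x k) - T\<^sub>0 (P u))"
        proof (rule always_eventually, rule allI)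
          fix n
          have "j ((\<Sum>k<n. a k *\<^sub>R x k) + (-1) *\<^sub>R T\<^sub>0 (P u))
              = j (\<Sum>k<n. a k *\<^sub>R x k) + (-1) *\<^sub>R j (T\<^sub>0 (P u))"
            using sumH T\<^sub>0H by (simp only: j subspace_scale[OF H(1)])
          then have "(\<Sum>k<n. a k *\<^sub>R j (x k)) - z = j ((\<Sum>k<n. a k *\<^sub>R x k) - T\<^sub>0 (P u))"
            by (simp add: jsum u(2))
          then show "norm ((\<Sum>k<n. a k *\<^sub>R j (x k)) - z) \<le> norm ((\<Sum>k<n. a k *\<^sub>R x k) - T\<^sub>0 (P u))"
            by (simp add: j sumH T\<^sub>0H subspace_diff[OF H(1)])
        qed
        show "(\<lambda>n. norm ((\<Sum>k<n. a k *\<^sub>R x k) - T\<^sub>0 (P u))) \<longlonglongrightarrow> 0"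
          using a(2) unfolding sums_def by (simp add: LIM_zero tendsto_norm_zero)
      qed
      then have "(\<lambda>n. a n *\<^sub>R j (x n)) sums z"
        unfolding sums_def by (rule LIM_zero_cancel)
      with a(1) show "z \<in> p_co ?p (\<lambda>n. j (x n))"
        unfolding p_co_def by blast
    qed
    ultimately show ?thesis
      unfolding compact_ops_def by blast
  qed
  moreover have "S o\<^sub>L Q \<in> approximable_ops"
    by (rule approximable_compose_right[OF S])
  moreover have "S o\<^sub>L T\<^sub>0 o\<^sub>L R = (S o\<^sub>L Q) o\<^sub>L T' o\<^sub>L R'"
    by (rule blinfun_eqI) (simp add: R' T' P Q RG T\<^sub>0H)
  ultimately show ?thesis
    unfolding min_kernel_def using p R'_app by auto
qed

end

theory Submission
  imports Defs
begin

text \<open>On finite-rank operators \<open>T : Y \<rightarrow> X\<close> one has \<open>\<kappa>\<^sub>p(T) = \<pi>\<^sub>p(T')\<close>, with finite covering sequences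
  nearly attaining the infimum. The inequality \<open>\<pi>\<^sub>p(T') \<le> \<kappa>\<^sub>p(T)\<close> is Hoelder's. For the other one,
  the tuples of points of \<open>X\<close> that lie together in the \<open>p\<close>-convex hull of one finite sequence form,
  with the budgets for coefficients and sequence as extra coordinates, a convex cone; a functional
  separating it from \<open>(T y\<^sub>k)\<^sub>k\<close> consists of \<open>\<phi>\<^sub>k \<in> X'\<close> and Lagrange multipliers, and rescaling the \<open>\<phi>\<^sub>k\<close> by
  powers of the multipliers contradicts the summing inequality for \<open>T'\<close>.

  The minimal kernel is the closure of the finite-rank operators for \<open>\<kappa>\<^sub>p\<close>: such an operator is a
  rapidly convergent series of finite-rank operators \<open>V\<^sub>n\<close>, each of which factors through
  \<open>Y / ker V\<^sub>n\<close> and the span of its covering sequence, and the factorizations add up through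
  \<open>\<ell>\<^sub>\<infinity>\<close>-sums. An inclusion between the sets of summing operators implies an inequality between their
  norms by uniform boundedness, so Cauchy sequences for \<open>\<kappa>\<^sub>s\<close> and \<open>\<kappa>\<^sub>r\<close> coincide.\<close>

section \<open>Hahn--Banach separation and finite-rank operators\<close>

text \<open>A summing dual does not by itself make an operator approximable or compact, so the
  hypothesis cannot be exploited on a member of the kernel directly; it is applied to differences of
  finite-rank approximants.

  The exact constant A survives because the first term of the resulting series carries almost
  everything: it is given coefficient mass 1 - t, the corrections share mass t and have total size
  of order t^2, and t tends to 0.

  Inside the estimates the conjugate exponent is replaced by weights: a coefficient is at most a
  weight to the power 1 - 1/p, and the weights have mass at most one. This covers p = 1 uniformly.
  It is also what produces a cone: concatenating two sequences adds weight masses and p-th powers of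
  norms, while the norms themselves do not add. Separation reaches only the closure of this cone, so
  every covering statement proved from it starts from a strict inequality and spends the margin on
  small errors.\<close>

lemma dominated_functional:
  fixes q :: "'a::real_normed_vector \<Rightarrow> real"
  assumes q: "sublinear q" and le: "\<And>x. q x \<le> norm x"
  obtains \<phi> :: "'a \<Rightarrow>\<^sub>L real" where "\<And>x. \<phi> x \<le> q x" "\<phi> a = q a" "norm \<phi> \<le> 1"
proof -
  \<comment> \<open>The value at \<open>- a\<close> is pushed down to \<open>- q a\<close>
    beforehand, so that oddness will force equality at \<open>a\<close>.\<close>
  obtain q' where q': "sublinear q'" "\<And>x. q' x \<le> q x" "q' (- a) \<le> - q a"
    using sublinear_reduce[OF q] by blast
  obtain f where f: "sublinear f" "\<And>x. f x \<le> q' x"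
    "\<forall>g. sublinear g \<longrightarrow> (\<forall>x. g x \<le> f x) \<longrightarrow> g = f"
    using minimal_sublinear[OF q'(1)] by blast
  have fq: "f x \<le> q x" for x
    using f(2) q'(2) order_trans by blast
  \<comment> \<open>A minimal sublinear functional cannot be lowered in any direction, so it is odd;
    an odd sublinear functional is linear.\<close>
  have neg: "f (- b) = - f b" for b
  proof -
    obtain g where g: "sublinear g" "\<And>x. g x \<le> f x" "g (- b) \<le> - f b"
      using sublinear_reduce[OF f(1), where a = b] by blast
    have "g = f" using f(3) g(1,2) by blast
    with g(3) sublinear_lower[OF f(1), of b] sublinear_lower[OF f(1), of "- b"]
    show ?thesis by simp
  qed
  have add: "f (x + y) \<le> f x + f y" for x y using f(1) unfolding sublinear_def by blast
  have scale: "0 \<le> c \<Longrightarrow> f (c *\<^sub>R x) = c * f x" for c x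
    using f(1) unfolding sublinear_def by blast
  have abs_le: "\<bar>f x\<bar> \<le> norm x" for x
    using fq[of x] fq[of "- x"] le[of x] le[of "- x"] neg[of x] by simp
  have bl: "bounded_linear f"
  proof (rule bounded_linear_intro[of _ 1])
    fix x y
    show "f (x + y) = f x + f y"
      using add[of x y] add[of "- x" "- y"] neg[of x] neg[of y] neg[of "x + y"] by simp
    fix c
    show "f (c *\<^sub>R x) = c *\<^sub>R f x"
      using scale[of c x] scale[of "- c" x] neg[of "c *\<^sub>R x"] by (cases "c \<ge> 0") auto
  qed (simp add: abs_le)
  note ap = bounded_linear_Blinfun_apply[OF bl]
  have "f a = q a"
    using f(2)[of "- a"] q'(3) neg[of a] fq[of a] by simp
  moreover have "norm (Blinfun f) \<le> 1"
    using abs_le by (intro norm_blinfun_bound) (simp_all add: ap)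
  ultimately show ?thesis
    using fq by (intro that[of "Blinfun f"]) (simp_all add: ap)
qed

lemma infdist_less_obtain:
  assumes "K \<noteq> {}" "infdist x K < e"
  obtains y where "y \<in> K" "dist x y < e"
  using assms unfolding infdist_def by (auto simp: cINF_less_iff bdd_below_image_dist)

lemma sublinear_infdist:
  fixes K :: "'a::real_normed_vector set"
  assumes 0: "0 \<in> K" and add: "\<And>x y. x \<in> K \<Longrightarrow> y \<in> K \<Longrightarrow> x + y \<in> K"
    and scale: "\<And>c x. 0 < c \<Longrightarrow> x \<in> K \<Longrightarrow> c *\<^sub>R x \<in> K"
  shows "sublinear (\<lambda>x. infdist x K)"
proof (rule sublinearI)
  have ne: "K \<noteq> {}" using 0 by blast
  fix x y
  show "infdist (x + y) K \<le> infdist x K + infdist y K"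
  proof (rule field_le_epsilon)
    fix e :: real assume "0 < e"
    then have "infdist x K < infdist x K + e / 2" "infdist y K < infdist y K + e / 2" by auto
    then obtain u v where u: "u \<in> K" "dist x u < infdist x K + e / 2"
      and v: "v \<in> K" "dist y v < infdist y K + e / 2"
      using ne by (metis infdist_less_obtain)
    have "infdist (x + y) K \<le> dist (x + y) (u + v)"
      by (intro infdist_le add u v)
    also have "\<dots> \<le> dist x u + dist y v"
      by (rule dist_triangle_add)
    finally show "infdist (x + y) K \<le> infdist x K + infdist y K + e"
      using u v by linarith
  qed
next
  show "infdist 0 K = 0" using 0 by simp
next
  have ne: "K \<noteq> {}" using 0 by blast
  fix c :: real and x assume c: "0 < c"
  show "infdist (c *\<^sub>R x) K \<le> c * infdist x K"
  proof (rule field_le_epsilon)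
    fix e :: real assume "0 < e"
    then have "infdist x K < infdist x K + e / c" using c by simp
    then obtain u where u: "u \<in> K" "dist x u < infdist x K + e / c"
      using ne by (metis infdist_less_obtain)
    have "infdist (c *\<^sub>R x) K \<le> dist (c *\<^sub>R x) (c *\<^sub>R u)"
      by (intro infdist_le scale u c)
    also have "\<dots> = c * dist x u" using c by (simp add: dist_norm flip: scaleR_diff_right)
    also have "\<dots> \<le> c * (infdist x K + e / c)" using u c by simp
    finally show "infdist (c *\<^sub>R x) K \<le> c * infdist x K + e" using c by (simp add: distrib_left)
  qed
qed

text \<open>With the distance to the cone as dominating function, a point outside the closure of
  \<open>K\<close> gets a positive value while points of \<open>K\<close> get nonpositive
  ones.\<close>

lemma separating_functional:
  fixes K :: "'a::real_normed_vector set"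
  assumes "0 \<in> K" and "\<And>x y. x \<in> K \<Longrightarrow> y \<in> K \<Longrightarrow> x + y \<in> K"
    and "\<And>c x. 0 < c \<Longrightarrow> x \<in> K \<Longrightarrow> c *\<^sub>R x \<in> K"
  obtains \<phi> :: "'a \<Rightarrow>\<^sub>L real"
  where "\<And>x. \<phi> x \<le> infdist x K" "\<phi> a = infdist a K" "\<And>x. x \<in> K \<Longrightarrow> \<phi> x \<le> 0" "norm \<phi> \<le> 1"
proof -
  have "infdist x K \<le> norm x" for x
    using infdist_le[OF assms(1), of x] by simp
  then obtain \<phi> :: "'a \<Rightarrow>\<^sub>L real" where "\<And>x. \<phi> x \<le> infdist x K" "\<phi> a = infdist a K" "norm \<phi> \<le> 1"
    using dominated_functional[OF sublinear_infdist[OF assms]] by blast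
  then show ?thesis using that by (metis infdist_zero)
qed

text \<open>The distance to a subspace is an even function, so the one-sided domination controls the
  absolute value. When \<open>K\<close> is a kernel, these functionals norm the quotient.\<close>

lemma separating_functional_subspace:
  fixes K :: "'a::real_normed_vector set"
  assumes K: "subspace K"
  obtains \<phi> :: "'a \<Rightarrow>\<^sub>L real"
  where "\<And>x. \<bar>\<phi> x\<bar> \<le> infdist x K" "\<phi> a = infdist a K"  "\<And>x. x \<in> K \<Longrightarrow> \<phi> x = 0" "norm \<phi> \<le> 1"
proof -
  obtain \<phi> :: "'a \<Rightarrow>\<^sub>L real"
    where \<phi>: "\<And>x. \<phi> x \<le> infdist x K" "\<phi> a = infdist a K" "norm \<phi> \<le> 1"
    using separating_functional[OF subspace_0[OF K] subspace_add[OF K] subspace_scale[OF K]] by blast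
  have *: "infdist x K \<ge> infdist (- x) K" for x
  proof (rule field_le_epsilon)
    fix e :: real assume "0 < e"
    then have "infdist x K < infdist x K + e" by simp
    then obtain u where u: "u \<in> K" "dist x u < infdist x K + e"
      using subspace_0[OF K] by (metis infdist_less_obtain empty_iff)
    have "infdist (- x) K \<le> dist (- x) (- u)" by (intro infdist_le subspace_neg[OF K] u)
    moreover have "dist (- x) (- u) = dist x u"
      by (simp add: dist_norm norm_minus_commute)
    ultimately show "infdist (- x) K \<le> infdist x K + e" using u by linarith
  qed
  have "\<bar>\<phi> x\<bar> \<le> infdist x K" for x
    using \<phi>(1)[of x] \<phi>(1)[of "- x"] *[of x] by (simp add: blinfun.bilinear_simps)
  moreover from this have "\<phi> x = 0" if "x \<in> K" for x using that by (metis abs_le_zero_iff infdist_zero)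
  ultimately show ?thesis using \<phi> that by blast
qed

section \<open>Bounded coordinate functionals on finite-dimensional subspaces\<close>

lemma finite_span_coordinates:
  fixes B :: "'a::real_normed_vector set"
  assumes "finite B"
  shows "\<exists>g :: 'a \<Rightarrow> 'a \<Rightarrow>\<^sub>L real. \<forall>x\<in>span B. x = (\<Sum>b\<in>B. g b x *\<^sub>R b)"
  using assms
proof (induction B)
  case (insert a B)
  then obtain g :: "'a \<Rightarrow> 'a \<Rightarrow>\<^sub>L real" where g: "\<And>x. x \<in> span B \<Longrightarrow> x = (\<Sum>b\<in>B. g b x *\<^sub>R b)"
    by blast
  \<comment> \<open>The coordinates already found are continuous, so expansions pass to limits.
    Closedness then puts a new independent vector at positive distance from the old span.\<close>
  have closed: "closed (span B)"
  proof -
    have "x \<in> span B" if "\<And>n :: nat. f n \<in> span B" "f \<longlonglongrightarrow> x" for f x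
    proof -
      have "f = (\<lambda>n. \<Sum>b\<in>B. g b (f n) *\<^sub>R b)" using g that(1) by blast
      moreover have "(\<lambda>n. \<Sum>b\<in>B. g b (f n) *\<^sub>R b) \<longlonglongrightarrow> (\<Sum>b\<in>B. g b x *\<^sub>R b)"
        by (intro tendsto_sum tendsto_scaleR blinfun.tendsto tendsto_const that(2))
      ultimately have "x = (\<Sum>b\<in>B. g b x *\<^sub>R b)" using that(2) LIMSEQ_unique by metis
      also have "\<dots> \<in> span B" by (intro span_sum span_scale span_base)
      finally show ?thesis .
    qed
    then show ?thesis unfolding closed_sequential_limits by blast
  qed
  show ?case
  proof (cases "a \<in> span B")
    case True
    then have "span (insert a B) = span B" by (simp add: span_redundant)
    moreover have "(\<Sum>b\<in>insert a B. (g(a := 0)) b x *\<^sub>R b) = (\<Sum>b\<in>B. g b x *\<^sub>R b)" for x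
      using insert(1,2) by (simp, intro sum.cong) auto
    ultimately show ?thesis using g by (intro exI[of _ "g(a := 0)"]) metis
  next
    case False
    have "infdist a (span B) \<noteq> 0"
      using False closed in_closed_iff_infdist_zero[of "span B" a] span_zero by blast
    moreover obtain \<phi> :: "'a \<Rightarrow>\<^sub>L real" where "\<phi> a = infdist a (span B)" "\<And>x. x \<in> span B \<Longrightarrow> \<phi> x = 0"
      using separating_functional_subspace[of "span B"] by (metis subspace_span)
    ultimately have \<phi>: "\<phi> a \<noteq> 0" "\<And>x. x \<in> span B \<Longrightarrow> \<phi> x = 0" by auto
    define h where "h = inverse (\<phi> a) *\<^sub>R \<phi>"
    have h: "h a = 1" "\<And>x. x \<in> span B \<Longrightarrow> h x = 0" using \<phi> by (simp_all add: h_def blinfun.bilinear_simps)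
    \<comment> \<open>Since \<open>h\<close> is 1 at \<open>a\<close> and 0 on the old span,
      subtracting a multiple of it removes the contribution of \<open>a\<close> from each old
      coordinate.\<close>
    define g' where "g' b = (if b = a then h else g b - g b a *\<^sub>R h)" for b
    have "x = (\<Sum>b\<in>insert a B. g' b x *\<^sub>R b)" if x: "x \<in> span (insert a B)" for x
    proof -
      obtain c where c: "x - c *\<^sub>R a \<in> span B" using x unfolding span_breakdown_eq by blast
      have "h (x - c *\<^sub>R a) = 0" using h(2) c by blast
      then have "h x = c" using h(1) by (simp add: blinfun.bilinear_simps)
      have "x - c *\<^sub>R a = (\<Sum>b\<in>B. g b (x - c *\<^sub>R a) *\<^sub>R b)" using g[OF c] .
      also have "\<dots> = (\<Sum>b\<in>B. g' b x *\<^sub>R b)"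
        using insert(2) \<open>h x = c\<close> by (intro sum.cong) (auto simp: g'_def blinfun.bilinear_simps)
      finally show ?thesis using insert(1,2) \<open>h x = c\<close> by (simp add: g'_def algebra_simps)
    qed
    then show ?thesis by blast
  qed
qed simp

lemma closed_span_finite:
  fixes B :: "'a::real_normed_vector set"
  assumes "finite B"
  shows "closed (span B)"
proof -
  obtain g :: "'a \<Rightarrow> 'a \<Rightarrow>\<^sub>L real" where g: "\<And>x. x \<in> span B \<Longrightarrow> x = (\<Sum>b\<in>B. g b x *\<^sub>R b)"
    using finite_span_coordinates[OF assms] by blast
  have "span B = {x. x - (\<Sum>b\<in>B. g b x *\<^sub>R b) = 0}"
  proof (intro set_eqI iffI)
    fix x assume "x \<in> {x. x - (\<Sum>b\<in>B. g b x *\<^sub>R b) = 0}"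
    then have "x = (\<Sum>b\<in>B. g b x *\<^sub>R b)" by simp
    also have "\<dots> \<in> span B" by (intro span_sum span_scale span_base)
    finally show "x \<in> span B" .
  qed (use g in auto)
  moreover have "closed {x. x - (\<Sum>b\<in>B. g b x *\<^sub>R b) = 0}"
    by (intro closed_Collect_eq continuous_intros)
  ultimately show ?thesis by simp
qed

lemma finite_rank_expansion:
  fixes T :: "'a::real_normed_vector \<Rightarrow>\<^sub>L 'b::real_normed_vector"
  assumes "finite_rank T"
  obtains d :: nat and f :: "nat \<Rightarrow> 'a \<Rightarrow>\<^sub>L real" and b where "\<And>y. T y = (\<Sum>i<d. f i y *\<^sub>R b i)"
proof -
  obtain B where B: "finite B" "range T \<subseteq> span B" using assms unfolding finite_rank_def by blast
  obtain g :: "'b \<Rightarrow> 'b \<Rightarrow>\<^sub>L real" where g: "\<And>x. x \<in> span B \<Longrightarrow> x = (\<Sum>b\<in>B. g b x *\<^sub>R b)"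
    using finite_span_coordinates[OF B(1)] by blast
  obtain b where b: "bij_betw b {..<card B} B"
    using ex_bij_betw_nat_finite[OF B(1)] by (auto simp: atLeast0LessThan)
  have "T y = (\<Sum>i<card B. (g (b i) o\<^sub>L T) y *\<^sub>R b i)" for y
    using g[of "T y"] B(2) sum.reindex_bij_betw[OF b, of "\<lambda>x. g x (T y) *\<^sub>R x"] by auto
  then show ?thesis by (rule that)
qed

section \<open>Weak and strong sequence norms, summing constants\<close>

definition ell_norm :: "real \<Rightarrow> nat \<Rightarrow> (nat \<Rightarrow> real) \<Rightarrow> real"
  where "ell_norm p n u = (\<Sum>i<n. u i powr p) powr (1 / p)"

lemma ell_norm_nonneg [simp]: "0 \<le> ell_norm p n u"
  by (simp add: ell_norm_def)

lemma powr_le_cancel_root: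
  fixes a b p :: real
  assumes "1 \<le> p" "0 \<le> a" "0 \<le> b"
  shows "a powr (1 / p) \<le> b \<longleftrightarrow> a \<le> b powr p"
proof
  assume "a powr (1 / p) \<le> b"
  then have "(a powr (1 / p)) powr p \<le> b powr p" using assms by (intro powr_mono2) auto
  then show "a \<le> b powr p" using assms by (simp add: powr_powr)
next
  assume "a \<le> b powr p"
  then have "a powr (1 / p) \<le> (b powr p) powr (1 / p)" using assms by (intro powr_mono2) auto
  then show "a powr (1 / p) \<le> b" using assms by (simp add: powr_powr)
qed

lemma ell_norm_le_iff:
  assumes "1 \<le> p" "0 \<le> c"
  shows "ell_norm p n u \<le> c \<longleftrightarrow> (\<Sum>i<n. u i powr p) \<le> c powr p"
  unfolding ell_norm_def using assms by (intro powr_le_cancel_root) (auto intro: sum_nonneg)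

lemma ell_norm_mono:
  assumes "1 \<le> p" "\<And>i. i < n \<Longrightarrow> 0 \<le> u i" "\<And>i. i < n \<Longrightarrow> u i \<le> v i"
  shows "ell_norm p n u \<le> ell_norm p n v"
  unfolding ell_norm_def using assms by (intro powr_mono2 sum_mono sum_nonneg) auto

lemma ell_norm_scale:
  assumes "1 \<le> p" "0 \<le> c" "\<And>i. i < n \<Longrightarrow> 0 \<le> u i"
  shows "ell_norm p n (\<lambda>i. c * u i) = c * ell_norm p n u"
proof -
  have "(\<Sum>i<n. (c * u i) powr p) = c powr p * (\<Sum>i<n. u i powr p)"
    using assms by (simp add: sum_distrib_left powr_mult)
  then show ?thesis using assms by (simp add: ell_norm_def powr_mult powr_powr sum_nonneg)
qed

text \<open>The first factor carries the exponent \<open>1 - 1 / p\<close>, so that \<open>p = 1\<close> is included.\<close>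

lemma weighted_Hoelder:
  fixes w u :: "'i \<Rightarrow> real"
  assumes p: "1 \<le> p" and fin: "finite I"
    and w: "\<And>i. i \<in> I \<Longrightarrow> 0 \<le> w i" and u: "\<And>i. i \<in> I \<Longrightarrow> 0 \<le> u i"
  shows "(\<Sum>i\<in>I. w i powr (1 - 1 / p) * u i)
    \<le> (\<Sum>i\<in>I. w i) powr (1 - 1 / p) * (\<Sum>i\<in>I. u i powr p) powr (1 / p)"
proof -
  define W U where "W = (\<Sum>i\<in>I. w i)" and "U = (\<Sum>i\<in>I. u i powr p)"
  have WU: "0 \<le> W" "0 \<le> U" unfolding W_def U_def using w by (auto intro: sum_nonneg)
  consider "W = 0" | "U = 0" | "0 < W" "0 < U" using WU by linarith
  then show ?thesis
  proof cases
    case 1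
    then have "\<forall>i\<in>I. w i = 0" unfolding W_def using fin w by (simp add: sum_nonneg_eq_0_iff)
    then show ?thesis by simp
  next
    case 2
    then have "\<forall>i\<in>I. u i = 0" unfolding U_def using fin by (simp add: sum_nonneg_eq_0_iff)
    then show ?thesis by simp
  next
    case 3
    \<comment> \<open>Young's inequality with both sums normalized to one; after summation the
      factors 1 - 1/p and 1/p add up to one.\<close>
    have *: "w i powr (1 - 1 / p) * u i
        \<le> ((1 - 1 / p) * (w i / W) + 1 / p * (u i powr p / U)) * (W powr (1 - 1 / p) * U powr (1 / p))"
      if i: "i \<in> I" for i
    proof (cases "w i = 0 \<or> u i = 0")
      case True
      then show ?thesis using 3 p w[OF i] u[OF i] by auto
    next
      case False
      then have pos: "0 < w i" "0 < u i" using w[OF i] u[OF i] by auto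
      have "(w i / W) powr (1 - 1 / p) * (u i powr p / U) powr (1 / p)
          \<le> (1 - 1 / p) * (w i / W) + 1 / p * (u i powr p / U)"
        using p pos 3 by (intro Youngs_inequality_0) auto
      moreover have "(w i / W) powr (1 - 1 / p) * (u i powr p / U) powr (1 / p)
          = w i powr (1 - 1 / p) * u i / (W powr (1 - 1 / p) * U powr (1 / p))"
        using p pos 3 by (simp add: powr_divide powr_powr)
      ultimately show ?thesis using 3 by (simp add: pos_divide_le_eq)
    qed
    have "(\<Sum>i\<in>I. w i powr (1 - 1 / p) * u i)
        \<le> (\<Sum>i\<in>I. ((1 - 1 / p) * (w i / W) + 1 / p * (u i powr p / U)) * (W powr (1 - 1 / p) * U powr (1 / p)))"
      by (intro sum_mono *)
    also have "\<dots> = ((1 - 1 / p) * (W / W) + 1 / p * (U / U)) * (W powr (1 - 1 / p) * U powr (1 / p))"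
      unfolding sum_distrib_right[symmetric] sum.distrib sum_distrib_left[symmetric] sum_divide_distrib[symmetric]
      by (simp add: W_def U_def)
    finally show ?thesis using 3 by (simp add: W_def U_def)
  qed
qed

text \<open>Exhibits a p-th power as a term of \<open>weighted_Hoelder\<close> with weight
  \<open>t powr p\<close>. This equality case drives Minkowski, the duality of weak norms and the
  separation estimate.\<close>

lemma powr_split:
  fixes t p :: real
  assumes "1 \<le> p" "0 \<le> t"
  shows "t powr p = (t powr p) powr (1 - 1 / p) * t"
proof (cases "t = 0")
  case False
  have "p * (1 - 1 / p) = p - 1" using assms by (simp add: right_diff_distrib)
  then have "(t powr p) powr (1 - 1 / p) * t = t powr (p - 1) * t powr 1"
    using assms False by (simp only: powr_powr powr_one)
  also have "\<dots> = t powr p" by (subst powr_add[symmetric]) simp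
  finally show ?thesis by simp
qed simp

text \<open>Closes arguments in which Hoelder bounds a sum by a power of itself.\<close>

lemma le_powr_cancel:
  fixes W c p :: real
  assumes p: "1 \<le> p" and "0 \<le> W" "0 \<le> c" and le: "W \<le> W powr (1 - 1 / p) * c"
  shows "W powr (1 / p) \<le> c"
proof (cases "W = 0")
  case False
  with assms have W: "0 < W" by simp
  have "W powr (1 - 1 / p) * W powr (1 / p) \<le> W powr (1 - 1 / p) * c"
    using le W by (simp add: powr_add[symmetric])
  then show ?thesis using W by (simp add: mult_le_cancel_left)
qed (use assms in auto)

text \<open>The weight \<open>(u i + v i) powr p\<close> in Hoelder serves both summands at once,
  and the resulting bound of the sum by a power of itself is cancelled.\<close>

lemma ell_norm_triangle:
  assumes p: "1 \<le> p" and u: "\<And>i. i < n \<Longrightarrow> 0 \<le> u i" and v: "\<And>i. i < n \<Longrightarrow> 0 \<le> v i"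
  shows "ell_norm p n (\<lambda>i. u i + v i) \<le> ell_norm p n u + ell_norm p n v"
proof -
  define w where "w i = (u i + v i) powr p" for i
  define W where "W = (\<Sum>i<n. w i)"
  have W0: "0 \<le> W" unfolding W_def w_def by (simp add: sum_nonneg)
  have "W = (\<Sum>i<n. w i powr (1 - 1 / p) * u i) + (\<Sum>i<n. w i powr (1 - 1 / p) * v i)"
    unfolding W_def sum.distrib[symmetric] w_def
    by (intro sum.cong refl, subst powr_split[OF p]) (auto simp: u v algebra_simps)
  also have "\<dots> \<le> W powr (1 - 1 / p) * ell_norm p n u + W powr (1 - 1 / p) * ell_norm p n v"
    unfolding W_def ell_norm_def
    by (intro add_mono weighted_Hoelder p) (auto simp: w_def u v)
  finally have "W powr (1 / p) \<le> ell_norm p n u + ell_norm p n v"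
    using W0 by (intro le_powr_cancel p) (auto simp: distrib_left)
  then show ?thesis by (simp add: ell_norm_def W_def w_def)
qed

section \<open>Weak norms of finite tuples\<close>

lemma ell_norm_le_weak_lp_norm:
  fixes x :: "nat \<Rightarrow> 'a::real_normed_vector" and \<phi> :: "'a \<Rightarrow>\<^sub>L real"
  assumes p: "1 \<le> p" and \<phi>: "norm \<phi> \<le> 1"
  shows "ell_norm p n (\<lambda>i. \<bar>\<phi> (x i)\<bar>) \<le> weak_lp_norm p n x"
proof -
  have "ell_norm p n (\<lambda>i. \<bar>\<psi> (x i)\<bar>) \<le> ell_norm p n (\<lambda>i. norm (x i))"
    if "norm \<psi> \<le> 1" for \<psi> :: "'a \<Rightarrow>\<^sub>L real"
  proof (rule ell_norm_mono[OF p])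
    fix i show "\<bar>\<psi> (x i)\<bar> \<le> norm (x i)"
      using norm_blinfun[of \<psi> "x i"] that mult_right_mono[of "norm \<psi>" 1 "norm (x i)"] by simp
  qed simp
  then have "bdd_above ((\<lambda>\<psi> :: 'a \<Rightarrow>\<^sub>L real. ell_norm p n (\<lambda>i. \<bar>\<psi> (x i)\<bar>)) ` cball 0 1)"
    by (intro bdd_aboveI2) auto
  then show ?thesis
    unfolding weak_lp_norm_def ell_norm_def[symmetric] using \<phi> by (intro cSUP_upper) auto
qed

lemma weak_lp_norm_le:
  fixes x :: "nat \<Rightarrow> 'a::real_normed_vector"
  assumes "\<And>\<phi> :: 'a \<Rightarrow>\<^sub>L real. norm \<phi> \<le> 1 \<Longrightarrow> ell_norm p n (\<lambda>i. \<bar>blinfun_apply \<phi> (x i)\<bar>) \<le> W"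
  shows "weak_lp_norm p n x \<le> W"
  unfolding weak_lp_norm_def ell_norm_def[symmetric] using assms
  by (intro cSUP_least) auto

lemma weak_lp_norm_nonneg:
  assumes "1 \<le> p"
  shows "0 \<le> weak_lp_norm p n (x :: nat \<Rightarrow> 'a::real_normed_vector)"
  by (rule order_trans[OF ell_norm_nonneg ell_norm_le_weak_lp_norm[OF assms, of 0]]) simp

text \<open>On a dual space the weak norm is computed by the unit ball of the predual, by duality
  between \<open>\<ell>\<^sub>p\<close> and its conjugate; no weak-star density of the ball in the bidual is needed.\<close>

lemma weak_lp_norm_dual_le:
  fixes \<psi> :: "nat \<Rightarrow> ('a::real_normed_vector \<Rightarrow>\<^sub>L real)"
  assumes p: "1 \<le> p" and W: "0 \<le> W"
    and le: "\<And>z. norm z \<le> 1 \<Longrightarrow> ell_norm p n (\<lambda>i. \<bar>\<psi> i z\<bar>) \<le> W"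
  shows "weak_lp_norm p n \<psi> \<le> W"
proof (rule weak_lp_norm_le)
  fix \<Phi> :: "('a \<Rightarrow>\<^sub>L real) \<Rightarrow>\<^sub>L real"
  assume \<Phi>: "norm \<Phi> \<le> 1"
  define w where "w i = \<bar>\<Phi> (\<psi> i)\<bar> powr p" for i
  define D where "D = (\<Sum>i<n. w i)"
  \<comment> \<open>Extremal coefficients for the duality of finite sequence spaces: paired with the
    values of \<Phi> they give exactly \<open>D\<close>, while Hoelder bounds their combination at
    any z with the factor \<open>D powr (1 - 1 / p)\<close>.\<close>
  define c where "c i = sgn (\<Phi> (\<psi> i)) * w i powr (1 - 1 / p)" for i
  define \<xi> where "\<xi> = (\<Sum>i<n. c i *\<^sub>R \<psi> i)"
  have D0: "0 \<le> D" unfolding D_def w_def by (simp add: sum_nonneg)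
  have "D = (\<Sum>i<n. c i * \<Phi> (\<psi> i))"
    unfolding D_def w_def c_def
    by (intro sum.cong refl, subst powr_split[OF p]) (auto simp: sgn_if algebra_simps)
  also have "\<dots> = \<Phi> \<xi>"
    by (simp add: \<xi>_def blinfun.bilinear_simps blinfun.sum_right)
  also have "\<dots> \<le> norm \<xi>"
    using norm_blinfun[of \<Phi> \<xi>] \<Phi> mult_right_mono[of "norm \<Phi>" 1 "norm \<xi>"] by simp
  also have "\<dots> \<le> D powr (1 - 1 / p) * W"
  proof (rule norm_blinfun_bound)
    show "0 \<le> D powr (1 - 1 / p) * W" using W by simp
    fix z
    have *: "ell_norm p n (\<lambda>i. \<bar>\<psi> i z\<bar>) \<le> W * norm z"
    proof (cases "z = 0")
      case True
      then show ?thesis by (simp add: ell_norm_def)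
    next
      case False
      have "ell_norm p n (\<lambda>i. \<bar>\<psi> i z\<bar>) = ell_norm p n (\<lambda>i. norm z * \<bar>\<psi> i (z /\<^sub>R norm z)\<bar>)"
        using False by (simp add: blinfun.bilinear_simps abs_mult mult.assoc[symmetric])
      also have "\<dots> = norm z * ell_norm p n (\<lambda>i. \<bar>\<psi> i (z /\<^sub>R norm z)\<bar>)"
        using p by (intro ell_norm_scale) auto
      also have "\<dots> \<le> norm z * W"
        using False by (intro mult_left_mono le) auto
      finally show ?thesis by (simp add: mult.commute)
    qed
    have "\<xi> z = (\<Sum>i<n. c i * \<psi> i z)"
      by (simp add: \<xi>_def blinfun.sum_left blinfun.scaleR_left)
    then have "\<bar>\<xi> z\<bar> \<le> (\<Sum>i<n. \<bar>c i * \<psi> i z\<bar>)"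
      by (simp only: sum_abs)
    also have "\<dots> \<le> (\<Sum>i<n. w i powr (1 - 1 / p) * \<bar>\<psi> i z\<bar>)"
      by (intro sum_mono) (auto simp: c_def abs_mult abs_sgn_eq)
    also have "\<dots> \<le> D powr (1 - 1 / p) * ell_norm p n (\<lambda>i. \<bar>\<psi> i z\<bar>)"
      unfolding D_def ell_norm_def by (intro weighted_Hoelder p) (auto simp: w_def)
    also have "\<dots> \<le> D powr (1 - 1 / p) * (W * norm z)"
      by (intro mult_left_mono *) simp
    finally show "norm (\<xi> z) \<le> D powr (1 - 1 / p) * W * norm z" by (simp add: mult.assoc)
  qed
  finally have "D powr (1 / p) \<le> W"
    using le_powr_cancel[OF p D0 W] by blast
  then show "ell_norm p n (\<lambda>i. \<bar>\<Phi> (\<psi> i)\<bar>) \<le> W"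
    by (simp add: ell_norm_def D_def w_def)
qed

section \<open>Summing constants\<close>

lemma summing_constants_iff:
  "C \<in> summing_constants p T \<longleftrightarrow> 0 \<le> C \<and>
    (\<forall>n x. ell_norm p n (\<lambda>i. norm (T (x i))) \<le> C * weak_lp_norm p n x)"
  unfolding summing_constants_def ell_norm_def by simp

lemma summing_constants_mono:
  assumes "1 \<le> p" "C \<in> summing_constants p T" "C \<le> D"
  shows "D \<in> summing_constants p T"
  unfolding summing_constants_iff
proof (intro conjI allI)
  show "0 \<le> D" using assms(2,3) by (simp add: summing_constants_iff)
  fix n x
  have "ell_norm p n (\<lambda>i. norm (T (x i))) \<le> C * weak_lp_norm p n x"
    using assms(2) unfolding summing_constants_iff by blast
  also have "\<dots> \<le> D * weak_lp_norm p n x"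
    by (intro mult_right_mono assms weak_lp_norm_nonneg)
  finally show "ell_norm p n (\<lambda>i. norm (T (x i))) \<le> D * weak_lp_norm p n x" .
qed

lemma norm_le_summing_constant:
  assumes p: "1 \<le> p" and C: "C \<in> summing_constants p T"
  shows "norm T \<le> C"
proof (rule norm_blinfun_bound)
  show "0 \<le> C" using C by (simp add: summing_constants_iff)
  fix x
  have "norm (T x) = ell_norm p 1 (\<lambda>i. norm (T x))"
    using p by (simp add: ell_norm_def powr_powr)
  also have "\<dots> \<le> C * weak_lp_norm p 1 (\<lambda>_. x)"
    using C unfolding summing_constants_iff by (elim conjE allE[of _ 1] allE[of _ "\<lambda>_. x"])
  also have "\<dots> \<le> C * norm x"
  proof (intro mult_left_mono weak_lp_norm_le \<open>0 \<le> C\<close>)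
    fix \<phi> :: "'a \<Rightarrow>\<^sub>L real" assume "norm \<phi> \<le> 1"
    then have "\<bar>\<phi> x\<bar> \<le> norm x"
      using norm_blinfun[of \<phi> x] mult_right_mono[of "norm \<phi>" 1 "norm x"] by simp
    then show "ell_norm p 1 (\<lambda>i. \<bar>\<phi> x\<bar>) \<le> norm x"
      using p by (simp add: ell_norm_def powr_powr)
  qed
  finally show "norm (T x) \<le> C * norm x" .
qed

text \<open>Each defining inequality is linear in the constant and survives passage to the infimum,
  so the summing norm is itself an admissible constant.\<close>

lemma pi_norm_mem_summing_constants:
  assumes p: "1 \<le> p" and ne: "summing_constants p T \<noteq> {}"
  shows "Inf (summing_constants p T) \<in> summing_constants p T"
  unfolding summing_constants_iff
proof (intro conjI allI)
  have bdd: "bdd_below (summing_constants p T)"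
    by (intro bdd_belowI[of _ 0]) (simp add: summing_constants_iff)
  show "0 \<le> Inf (summing_constants p T)"
    using ne by (intro cInf_greatest) (auto simp: summing_constants_iff)
  fix n x
  let ?l = "ell_norm p n (\<lambda>i. norm (T (x i)))" and ?w = "weak_lp_norm p n x"
  have le: "?l \<le> C * ?w" if "C \<in> summing_constants p T" for C
    using that unfolding summing_constants_iff by blast
  show "?l \<le> Inf (summing_constants p T) * ?w"
  proof (cases "?w = 0")
    case True
    then show ?thesis using ne le by force
  next
    case False
    then have w: "0 < ?w" using weak_lp_norm_nonneg[OF p, of n x] by simp
    have "?l / ?w \<le> Inf (summing_constants p T)"
      using ne le w by (intro cInf_greatest) (auto simp: pos_divide_le_eq)
    then show ?thesis using w by (simp add: pos_divide_le_eq)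
  qed
qed

lemma summing_constants_add:
  assumes p: "1 \<le> p" and "C \<in> summing_constants p T" "D \<in> summing_constants p U"
  shows "C + D \<in> summing_constants p (T + U)"
  unfolding summing_constants_iff
proof (intro conjI allI)
  show "0 \<le> C + D" using assms by (simp add: summing_constants_iff)
  fix n x
  have "ell_norm p n (\<lambda>i. norm ((T + U) (x i))) \<le> ell_norm p n (\<lambda>i. norm (T (x i)) + norm (U (x i)))"
    by (intro ell_norm_mono p) (simp_all add: blinfun.bilinear_simps norm_triangle_ineq)
  also have "\<dots> \<le> ell_norm p n (\<lambda>i. norm (T (x i))) + ell_norm p n (\<lambda>i. norm (U (x i)))"
    by (intro ell_norm_triangle p) simp_all
  also have "\<dots> \<le> C * weak_lp_norm p n x + D * weak_lp_norm p n x"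
    using assms unfolding summing_constants_iff by (intro add_mono) blast+
  finally show "ell_norm p n (\<lambda>i. norm ((T + U) (x i))) \<le> (C + D) * weak_lp_norm p n x"
    by (simp add: distrib_right)
qed

lemma summing_constants_scaleR:
  assumes p: "1 \<le> p" and "C \<in> summing_constants p T"
  shows "\<bar>c\<bar> * C \<in> summing_constants p (c *\<^sub>R T)"
  unfolding summing_constants_iff
proof (intro conjI allI)
  show "0 \<le> \<bar>c\<bar> * C" using assms by (simp add: summing_constants_iff)
  fix n x
  have "ell_norm p n (\<lambda>i. norm ((c *\<^sub>R T) (x i))) = \<bar>c\<bar> * ell_norm p n (\<lambda>i. norm (T (x i)))"
    using p by (simp add: blinfun.bilinear_simps ell_norm_scale)
  also have "\<dots> \<le> \<bar>c\<bar> * (C * weak_lp_norm p n x)"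
    using assms unfolding summing_constants_iff by (intro mult_left_mono) auto
  finally show "ell_norm p n (\<lambda>i. norm ((c *\<^sub>R T) (x i))) \<le> \<bar>c\<bar> * C * weak_lp_norm p n x"
    by (simp add: mult.assoc)
qed

text \<open>Every defining inequality involves finitely many vectors and hence passes to the limit.
  This closedness later supplies completeness of the summing operators in their own norm.\<close>

lemma summing_constants_limit:
  fixes T :: "'a::real_normed_vector \<Rightarrow>\<^sub>L 'b::real_normed_vector"
  assumes p: "1 \<le> p" and C: "\<And>k. C \<in> summing_constants p (F k)" and lim: "F \<longlonglongrightarrow> T"
  shows "C \<in> summing_constants p T"
  unfolding summing_constants_iff
proof (intro conjI allI)
  show "0 \<le> C" using C by (simp add: summing_constants_iff)
  fix n :: nat and x :: "nat \<Rightarrow> 'a"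
  have "(\<lambda>k. \<Sum>i<n. norm (F k (x i)) powr p) \<longlonglongrightarrow> (\<Sum>i<n. norm (T (x i)) powr p)"
    using p by (intro tendsto_sum tendsto_powr2 tendsto_norm blinfun.tendsto lim tendsto_const) auto
  moreover have "(\<Sum>i<n. norm (F k (x i)) powr p) \<le> (C * weak_lp_norm p n x) powr p" for k
    using C[of k] p weak_lp_norm_nonneg[OF p, of n x]
    by (subst ell_norm_le_iff[symmetric]) (auto simp: summing_constants_iff)
  ultimately have "(\<Sum>i<n. norm (T (x i)) powr p) \<le> (C * weak_lp_norm p n x) powr p"
    by (intro LIMSEQ_le_const2) blast+
  then show "ell_norm p n (\<lambda>i. norm (T (x i))) \<le> C * weak_lp_norm p n x"
    using p C[of 0] weak_lp_norm_nonneg[OF p, of n x]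
    by (subst ell_norm_le_iff) (auto simp: summing_constants_iff)
qed

section \<open>Coverings by p-convex hulls\<close>

definition dual_op :: "('a::real_normed_vector \<Rightarrow>\<^sub>L 'b::real_normed_vector) \<Rightarrow> ('b \<Rightarrow>\<^sub>L real) \<Rightarrow>\<^sub>L ('a \<Rightarrow>\<^sub>L real)"
  where "dual_op T = Blinfun (\<lambda>\<phi>. \<phi> o\<^sub>L T)"

lemma dual_op_apply [simp]: "dual_op T \<phi> = \<phi> o\<^sub>L T"
  unfolding dual_op_def
  by (simp add: bounded_linear_Blinfun_apply bounded_bilinear.bounded_linear_left[OF bounded_bilinear_blinfun_compose])

lemma dual_op_diff: "dual_op (T - U) = dual_op T - dual_op U"
  by (rule blinfun_eqI, rule blinfun_eqI) (simp add: blinfun.bilinear_simps)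

lemma dual_op_add: "dual_op (T + U) = dual_op T + dual_op U"
  by (rule blinfun_eqI, rule blinfun_eqI) (simp add: blinfun.bilinear_simps)

lemma norm_dual_op_le: "norm (dual_op T) \<le> norm T"
  by (rule norm_blinfun_bound) (simp_all add: norm_blinfun_compose mult.commute[of "norm T"])

lemma tendsto_dual_op:
  assumes "F \<longlonglongrightarrow> T"
  shows "(\<lambda>n. dual_op (F n)) \<longlonglongrightarrow> dual_op T"
proof (rule LIM_zero_cancel, rule Lim_null_comparison)
  show "\<forall>\<^sub>F n in sequentially. norm (dual_op (F n) - dual_op T) \<le> norm (F n - T)"
    by (simp add: norm_dual_op_le flip: dual_op_diff)
  show "(\<lambda>n. norm (F n - T)) \<longlonglongrightarrow> 0"
    using assms by (simp add: LIM_zero tendsto_norm_zero)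
qed

lemma coeff_ball_Hoelder:
  assumes p: "1 \<le> p" and a: "a \<in> coeff_ball p" and u: "\<And>i. i < n \<Longrightarrow> 0 \<le> u i"
  shows "(\<Sum>i<n. \<bar>a i\<bar> * u i) \<le> ell_norm p n u"
proof (cases "p = 1")
  case True
  then have "\<bar>a i\<bar> \<le> 1" for i using a by (simp add: coeff_ball_def)
  then have "(\<Sum>i<n. \<bar>a i\<bar> * u i) \<le> (\<Sum>i<n. u i powr 1)"
    using u by (intro sum_mono) (auto intro: mult_left_le_one_le)
  then show ?thesis using True by (simp add: ell_norm_def sum_nonneg)
next
  case False
  then have p1: "1 < p" using p by simp
  define q where "q = conj_exp p"
  have q: "0 < q" "q * (1 - 1 / p) = 1"
    using p1 by (simp_all add: q_def conj_exp_def field_simps)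
  \<comment> \<open>With these weights of mass at most one,
    \<open>\<bar>a i\<bar> = w i powr (1 - 1 / p)\<close>, because the conjugate exponent times 1 -
    1/p equals 1.\<close>
  define w where "w = (\<lambda>i. \<bar>a i\<bar> powr q)"
  have "a \<in> lp q" "lp_norm q a \<le> 1"
    using a False by (simp_all add: coeff_ball_def q_def)
  then have summ: "summable w" and "(\<Sum>i. w i) powr (1 / q) \<le> 1"
    by (simp_all add: w_def lp_def lp_norm_def)
  have s0: "0 \<le> (\<Sum>i. w i)" using summ by (intro suminf_nonneg) (auto simp: w_def)
  have s1: "(\<Sum>i. w i) \<le> 1"
  proof (rule ccontr)
    assume "\<not> (\<Sum>i. w i) \<le> 1"
    then have "1 < (\<Sum>i. w i) powr (1 / q)" using q by (intro gr_one_powr) auto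
    then show False using \<open>(\<Sum>i. w i) powr (1 / q) \<le> 1\<close> by simp
  qed
  have wn: "(\<Sum>i<n. w i) \<le> 1"
    using sum_le_suminf[OF summ, of "{..<n}"] s1 by (auto simp: w_def)
  have "\<bar>a i\<bar> = w i powr (1 - 1 / p)" for i
    by (simp add: w_def powr_powr q)
  then have "(\<Sum>i<n. \<bar>a i\<bar> * u i) = (\<Sum>i<n. w i powr (1 - 1 / p) * u i)" by simp
  also have "\<dots> \<le> (\<Sum>i<n. w i) powr (1 - 1 / p) * ell_norm p n u"
    unfolding ell_norm_def by (intro weighted_Hoelder p) (auto simp: w_def u)
  also have "\<dots> \<le> 1 * ell_norm p n u"
    using wn p by (intro mult_right_mono powr_le1) (auto simp: w_def sum_nonneg abs_of_nonneg)
  finally show ?thesis by simp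
qed

text \<open>The way back from weights to coefficient sequences. For p = 1 the exponent is 0, so the
  weights bound the entries by 1 and the null-sequence condition comes from
  \<open>lim\<close>.\<close>

lemma coeff_ballI:
  assumes p: "1 \<le> p" and w: "\<And>i. 0 \<le> w i" and le: "\<And>i. \<bar>b i\<bar> \<le> w i powr (1 - 1 / p)"
    and summ: "summable w" and w1: "(\<Sum>i. w i) \<le> 1" and lim: "b \<longlonglongrightarrow> 0"
  shows "b \<in> coeff_ball p"
proof (cases "p = 1")
  case True
  have "\<bar>b i\<bar> \<le> 1" for i using le[of i] True by (cases "w i = 0") auto
  then show ?thesis using True lim by (simp add: coeff_ball_def)
next
  case False
  then have p1: "1 < p" using p by simp
  define q where "q = conj_exp p"
  have q: "0 < q" "(1 - 1 / p) * q = 1"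
    using p1 by (simp_all add: q_def conj_exp_def field_simps)
  have bw: "\<bar>b i\<bar> powr q \<le> w i" for i
  proof -
    have "\<bar>b i\<bar> powr q \<le> (w i powr (1 - 1 / p)) powr q"
      using le q by (intro powr_mono2) auto
    also have "\<dots> = w i" using w[of i] by (simp add: powr_powr q)
    finally show ?thesis .
  qed
  have sb: "summable (\<lambda>i. \<bar>b i\<bar> powr q)"
    by (rule summable_comparison_test'[OF summ, of 0]) (simp add: bw)
  moreover have "(\<Sum>i. \<bar>b i\<bar> powr q) \<le> 1"
    using suminf_le[OF bw sb summ] w1 by linarith
  then have "(\<Sum>i. \<bar>b i\<bar> powr q) powr (1 / q) \<le> 1"
    using q suminf_nonneg[OF sb] by (intro powr_le1) (auto simp: abs_of_nonneg)
  ultimately show ?thesis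
    using False by (simp add: coeff_ball_def q_def lp_def lp_norm_def)
qed

text \<open>Coefficients in the ball of the conjugate sequence space are encoded by nonnegative
  weights \<open>w\<close> of total mass at most one with \<open>\<bar>a i\<bar> \<le> w i powr (1 - 1 / p)\<close>; for \<open>p = 1\<close> this
  says \<open>\<bar>a i\<bar> \<le> 1\<close> since the finitely many weights may be chosen positive.\<close>

definition fin_co :: "real \<Rightarrow> nat \<Rightarrow> (nat \<Rightarrow> 'a::real_vector) \<Rightarrow> 'a set"
  where "fin_co p n x = {\<Sum>i<n. a i *\<^sub>R x i | a w.
    (\<forall>i<n. 0 \<le> w i \<and> \<bar>a i\<bar> \<le> w i powr (1 - 1 / p)) \<and> (\<Sum>i<n. w i) \<le> (1 :: real)}"

definition fin_covered :: "real \<Rightarrow> real \<Rightarrow> ('a::real_normed_vector \<Rightarrow>\<^sub>L 'b::real_normed_vector) \<Rightarrow> bool"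
  where "fin_covered p c T \<longleftrightarrow>
    (\<exists>n x. ell_norm p n (\<lambda>i. norm (x i)) \<le> c \<and> T ` cball 0 1 \<subseteq> fin_co p n x)"

definition covered :: "real \<Rightarrow> real \<Rightarrow> ('a::real_normed_vector \<Rightarrow>\<^sub>L 'b::real_normed_vector) \<Rightarrow> bool"
  where "covered p c T \<longleftrightarrow> (\<exists>x\<in>lp p. lp_norm p x \<le> c \<and> T ` cball 0 1 \<subseteq> p_co p x)"

lemma covered_imp_compact: "covered p c T \<Longrightarrow> T \<in> compact_ops p"
  unfolding covered_def compact_ops_def by blast

lemma kappa_le:
  assumes "covered p c T"
  shows "kappa (ereal p) T \<le> c"
proof -
  obtain x where x: "x \<in> lp p" "lp_norm p x \<le> c" "T ` cball 0 1 \<subseteq> p_co p x"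
    using assms unfolding covered_def by blast
  have "kappa (ereal p) T \<le> lp_norm p x"
    unfolding kappa_def using x
    by (auto intro!: cInf_lower bdd_belowI[of _ 0] simp: lp_norm_def)
  then show ?thesis using x(2) by simp
qed

text \<open>Hoelder bounds the p-th power of the norm of \<psi> composed with \<open>T\<close> by
  the sum over n of the p-th powers of \<psi> (x n). After summing over the functionals and
  exchanging the sums, the inner sum is a test of the weak norm at the evaluation in x n and
  contributes its p-th power times that of norm (x n).\<close>

lemma lp_norm_summing_constant:
  fixes T :: "'a::real_normed_vector \<Rightarrow>\<^sub>L 'b::real_normed_vector"
  assumes p: "1 \<le> p" and x: "x \<in> lp p" and cov: "T ` cball 0 1 \<subseteq> p_co p x"
  shows "lp_norm p x \<in> summing_constants p (dual_op T)"
  unfolding summing_constants_iff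
proof (intro conjI allI)
  show "0 \<le> lp_norm p x" by (simp add: lp_norm_def)
  fix m and \<phi> :: "nat \<Rightarrow> 'b \<Rightarrow>\<^sub>L real"
  let ?W = "weak_lp_norm p m \<phi>"
  have W0: "0 \<le> ?W" by (rule weak_lp_norm_nonneg[OF p])
  have summ: "summable (\<lambda>n. norm (x n) powr p)" using x by (simp add: lp_def)
  have summ_\<psi>: "summable (\<lambda>n. \<bar>\<psi> (x n)\<bar> powr p)" for \<psi> :: "'b \<Rightarrow>\<^sub>L real"
  proof (rule summable_comparison_test'[of _ 0])
    show "summable (\<lambda>n. norm \<psi> powr p * norm (x n) powr p)" using summ by (rule summable_mult)
    show "norm (\<bar>\<psi> (x n)\<bar> powr p) \<le> norm \<psi> powr p * norm (x n) powr p" for n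
      using powr_mono2[OF _ _ norm_blinfun[of \<psi> "x n"], of p] p by (simp add: powr_mult)
  qed
  have "norm (\<psi> o\<^sub>L T) \<le> (\<Sum>n. \<bar>\<psi> (x n)\<bar> powr p) powr (1 / p)" (is "_ \<le> ?R") for \<psi> :: "'b \<Rightarrow>\<^sub>L real"
  proof (rule norm_blinfun_bound)
    have ball: "\<bar>\<psi> (T z)\<bar> \<le> ?R" if z: "norm z \<le> 1" for z
    proof -
      obtain a where a: "a \<in> coeff_ball p" "(\<lambda>n. a n *\<^sub>R x n) sums T z"
        using cov z unfolding p_co_def image_subset_iff by force
      have "(\<lambda>n. \<psi> (\<Sum>i<n. a i *\<^sub>R x i)) \<longlonglongrightarrow> \<psi> (T z)"
        using a(2) unfolding sums_def by (intro blinfun.tendsto tendsto_const)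
      then have "(\<lambda>n. \<bar>\<psi> (\<Sum>i<n. a i *\<^sub>R x i)\<bar>) \<longlonglongrightarrow> \<bar>\<psi> (T z)\<bar>"
        by (rule tendsto_rabs)
      moreover have "\<bar>\<psi> (\<Sum>i<n. a i *\<^sub>R x i)\<bar> \<le> ?R" for n
      proof -
        have "\<psi> (\<Sum>i<n. a i *\<^sub>R x i) = (\<Sum>i<n. a i * \<psi> (x i))"
          by (simp add: blinfun.sum_right blinfun.scaleR_right)
        also have "\<bar>\<dots>\<bar> \<le> (\<Sum>i<n. \<bar>a i * \<psi> (x i)\<bar>)" by (rule sum_abs)
        also have "\<dots> \<le> ell_norm p n (\<lambda>i. \<bar>\<psi> (x i)\<bar>)"
          using coeff_ball_Hoelder[OF p a(1), of n "\<lambda>i. \<bar>\<psi> (x i)\<bar>"] by (simp add: abs_mult)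
        also have "\<dots> \<le> ?R"
          unfolding ell_norm_def using p
          by (intro powr_mono2 sum_le_suminf summ_\<psi> sum_nonneg) auto
        finally show ?thesis .
      qed
      ultimately show ?thesis by (intro LIMSEQ_le_const2) blast+
    qed
    fix z
    show "norm ((\<psi> o\<^sub>L T) z) \<le> ?R * norm z"
    proof (cases "z = 0")
      case False
      then have "\<bar>\<psi> (T (z /\<^sub>R norm z))\<bar> \<le> ?R" by (intro ball) simp
      then show ?thesis using False by (simp add: blinfun.bilinear_simps abs_mult field_simps)
    qed simp
  qed simp
  then have le: "norm (\<psi> o\<^sub>L T) powr p \<le> (\<Sum>n. \<bar>\<psi> (x n)\<bar> powr p)" for \<psi> :: "'b \<Rightarrow>\<^sub>L real"
    using powr_mono2[of p "norm (\<psi> o\<^sub>L T)" "(\<Sum>n. \<bar>\<psi> (x n)\<bar> powr p) powr (1 / p)"] p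
    by (simp add: powr_powr suminf_nonneg[OF summ_\<psi>])
  have "(\<Sum>i<m. norm (dual_op T (\<phi> i)) powr p) \<le> (\<Sum>i<m. \<Sum>n. \<bar>\<phi> i (x n)\<bar> powr p)"
    by (intro sum_mono) (simp add: le)
  also have "\<dots> = (\<Sum>n. \<Sum>i<m. \<bar>\<phi> i (x n)\<bar> powr p)"
    by (rule suminf_sum[symmetric]) (rule summ_\<psi>)
  also have "\<dots> \<le> (\<Sum>n. ?W powr p * norm (x n) powr p)"
  proof (rule suminf_le)
    show "summable (\<lambda>n. \<Sum>i<m. \<bar>\<phi> i (x n)\<bar> powr p)" by (intro summable_sum summ_\<psi>)
    show "summable (\<lambda>n. ?W powr p * norm (x n) powr p)" by (intro summable_mult summ)
    fix n
    show "(\<Sum>i<m. \<bar>\<phi> i (x n)\<bar> powr p) \<le> ?W powr p * norm (x n) powr p"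
    proof (cases "x n = 0")
      case False
      \<comment> \<open>Evaluation at the unit vector in direction x n lies in the unit ball of the
        bidual, over which the weak norm of \<phi> is a supremum.\<close>
      define E :: "('b \<Rightarrow>\<^sub>L real) \<Rightarrow>\<^sub>L real" where "E = Blinfun (\<lambda>\<psi>. blinfun_apply \<psi> (x n /\<^sub>R norm (x n)))"
      have E: "E \<psi> = \<psi> (x n) / norm (x n)" for \<psi>
        unfolding E_def
        by (simp only: bounded_linear_Blinfun_apply[OF blinfun.bounded_linear_left])
          (simp add: blinfun.bilinear_simps divide_inverse mult.commute)
      have "\<bar>\<psi> (x n)\<bar> \<le> norm \<psi> * norm (x n)" for \<psi> :: "'b \<Rightarrow>\<^sub>L real"
        using norm_blinfun[of \<psi> "x n"] by simp
      then have "norm E \<le> 1"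
        using False by (intro norm_blinfun_bound) (auto simp: E divide_le_eq)
      then have "(\<Sum>i<m. \<bar>E (\<phi> i)\<bar> powr p) \<le> ?W powr p"
        by (intro iffD1[OF ell_norm_le_iff[OF p W0]] ell_norm_le_weak_lp_norm p)
      moreover have "(\<Sum>i<m. \<bar>E (\<phi> i)\<bar> powr p) = (\<Sum>i<m. \<bar>\<phi> i (x n)\<bar> powr p) / norm (x n) powr p"
        by (simp add: E powr_divide sum_divide_distrib)
      ultimately show ?thesis using False by (simp add: divide_le_eq)
    qed simp
  qed
  also have "\<dots> = ?W powr p * (\<Sum>n. norm (x n) powr p)"
    by (rule suminf_mult[OF summ])
  also have "\<dots> = (lp_norm p x * ?W) powr p"
    using p suminf_nonneg[OF summ] by (simp add: lp_norm_def powr_mult powr_powr)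
  finally show "ell_norm p m (\<lambda>i. norm (dual_op T (\<phi> i))) \<le> lp_norm p x * ?W"
    using W0 p by (subst ell_norm_le_iff) (auto simp: lp_norm_def)
qed

lemma kappa_summing_constant:
  assumes p: "1 \<le> p" and T: "T \<in> compact_ops p"
  shows "kappa (ereal p) T \<in> summing_constants p (dual_op T)"
proof -
  let ?S = "{lp_norm p x | x. x \<in> lp p \<and> T ` cball 0 1 \<subseteq> p_co p x}"
  have ne: "?S \<noteq> {}" using T unfolding compact_ops_def by blast
  have S: "c \<in> summing_constants p (dual_op T)" if "c \<in> ?S" for c
    using that lp_norm_summing_constant[OF p] by blast
  have "bdd_below (summing_constants p (dual_op T))"
    by (intro bdd_belowI[of _ 0]) (simp add: summing_constants_iff)
  then have "Inf (summing_constants p (dual_op T)) \<le> Inf ?S"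
    using ne S by (intro cInf_greatest cInf_lower) blast+
  moreover have "summing_constants p (dual_op T) \<noteq> {}" using ne S by blast
  ultimately have "Inf ?S \<in> summing_constants p (dual_op T)"
    using pi_norm_mem_summing_constants[OF p] summing_constants_mono[OF p] by blast
  then show ?thesis by (simp add: kappa_def)
qed

lemma fin_coI:
  assumes "\<And>i. i < n \<Longrightarrow> 0 \<le> w i" "\<And>i. i < n \<Longrightarrow> \<bar>a i\<bar> \<le> w i powr (1 - 1 / p)" "(\<Sum>i<n. w i) \<le> 1"
  shows "(\<Sum>i<n. a i *\<^sub>R x i) \<in> fin_co p n x"
  unfolding fin_co_def using assms by blast

lemma fin_coE:
  assumes "y \<in> fin_co p n x"
  obtains a w where "y = (\<Sum>i<n. a i *\<^sub>R x i)" "\<And>i. i < n \<Longrightarrow> 0 \<le> w i"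
    "\<And>i. i < n \<Longrightarrow> \<bar>a i\<bar> \<le> w i powr (1 - 1 / p)" "(\<Sum>i<n. w i) \<le> 1"
  using assms unfolding fin_co_def by blast

section \<open>Gluing coverings along a series\<close>

lemma le_powr_le_one:
  fixes s p :: real
  assumes "1 \<le> p" "0 \<le> s" "s \<le> 1"
  shows "s \<le> s powr (1 - 1 / p)"
proof (cases "s = 0")
  case False
  then have "s powr 1 \<le> s powr (1 - 1 / p)" using assms by (intro powr_mono') auto
  then show ?thesis using False assms by simp
qed simp

text \<open>When the weight scales by s, the coefficient could keep the larger factor
  \<open>s powr (1 - 1 / p)\<close>. The smaller factor s makes glued coefficients tend to zero
  along with the masses, as the ball of c_0 demands for p = 1.\<close>

lemma scaled_coefficient:
  fixes s p a w :: real
  assumes "1 \<le> p" "0 \<le> s" "s \<le> 1" "0 \<le> w" "\<bar>a\<bar> \<le> w powr (1 - 1 / p)"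
  shows "\<bar>s * a\<bar> \<le> (s * w) powr (1 - 1 / p)"
  using mult_mono[OF le_powr_le_one[OF assms(1-3)] assms(5)] assms
  by (simp add: abs_mult powr_mult)

text \<open>Infinitely many finite blocks are laid out along the pairing bijection and padded with
  zeros, which avoids computing offsets; absolute convergence makes the order of the terms
  immaterial.\<close>

definition block_seq :: "(nat \<Rightarrow> nat) \<Rightarrow> (nat \<Rightarrow> nat \<Rightarrow> 'a::zero) \<Rightarrow> nat \<Rightarrow> 'a"
  where "block_seq N f k = (case prod_decode k of (n, i) \<Rightarrow> if i < N n then f n i else 0)"

lemma block_seq_partial_sum:
  fixes f :: "nat \<Rightarrow> nat \<Rightarrow> real"
  assumes nonneg: "\<And>n i. 0 \<le> f n i" and le: "\<And>M. (\<Sum>n<M. \<Sum>i<N n. f n i) \<le> C"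
  shows "(\<Sum>k<K. block_seq N f k) \<le> C"
proof -
  \<comment> \<open>The first \<open>M\<close> blocks contain every pair decoded from the initial
    segment.\<close>
  define M where "M = Suc (Max (fst ` prod_decode ` {..<K}))"
  define A where "A = {k \<in> {..<K}. snd (prod_decode k) < N (fst (prod_decode k))}"
  have sub: "prod_decode ` A \<subseteq> Sigma {..<M} (\<lambda>n. {..<N n})"
  proof (rule image_subsetI)
    fix k assume "k \<in> A"
    moreover from this have "fst (prod_decode k) \<le> Max (fst ` prod_decode ` {..<K})"
      by (intro Max_ge) (auto simp: A_def)
    ultimately show "prod_decode k \<in> Sigma {..<M} (\<lambda>n. {..<N n})"
      by (cases "prod_decode k") (auto simp: A_def M_def less_Suc_eq_le)
  qed
  have "(\<Sum>k<K. block_seq N f k) = (\<Sum>k\<in>A. (case prod_decode k of (n, i) \<Rightarrow> f n i))"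
    unfolding A_def block_seq_def
    by (rule sum.mono_neutral_cong_right) (auto split: prod.splits)
  also have "\<dots> = (\<Sum>(n, i)\<in>prod_decode ` A. f n i)"
    by (subst sum.reindex) (auto simp: inj_on_def prod_decode_eq)
  also have "\<dots> \<le> (\<Sum>(n, i)\<in>Sigma {..<M} (\<lambda>n. {..<N n}). f n i)"
    using sub nonneg by (intro sum_mono2) auto
  also have "\<dots> = (\<Sum>n<M. \<Sum>i<N n. f n i)"
    by (subst sum.Sigma) auto
  finally show ?thesis using le[of M] by linarith
qed

lemma block_seq_summable:
  fixes f :: "nat \<Rightarrow> nat \<Rightarrow> real"
  assumes nonneg: "\<And>n i. 0 \<le> f n i" and le: "\<And>M. (\<Sum>n<M. \<Sum>i<N n. f n i) \<le> C"
  shows "summable (block_seq N f)" "(\<Sum>k. block_seq N f k) \<le> C"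
proof -
  have 0: "0 \<le> block_seq N f k" for k using nonneg by (auto simp: block_seq_def split: prod.splits)
  show "summable (block_seq N f)"
    by (rule bounded_imp_summable[OF 0, where B = C])
      (use block_seq_partial_sum[OF assms, of "Suc _"] in \<open>simp add: lessThan_Suc_atMost\<close>)
  then show "(\<Sum>k. block_seq N f k) \<le> C"
    by (rule suminf_le_const) (rule block_seq_partial_sum[OF assms])
qed

text \<open>The pairing order scatters the blocks. Absolute convergence yields an unordered sum over
  all pairs, which is then regrouped block by block, so the block sums identify its value.\<close>

lemma block_seq_sums:
  fixes f :: "nat \<Rightarrow> nat \<Rightarrow> 'a::banach"
  assumes summ: "summable (\<lambda>k. norm (block_seq N f k))" and L: "(\<lambda>n. \<Sum>i<N n. f n i) sums L"
  shows "block_seq N f sums L"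
proof -
  define g where "g = (\<lambda>(n, i). if i < N n then f n i else 0)"
  have gb: "block_seq N f k = g (prod_decode k)" for k by (simp add: block_seq_def g_def)
  define S where "S = (\<Sum>k. block_seq N f k)"
  have S: "block_seq N f sums S"
    unfolding S_def by (rule summable_sums[OF summable_norm_cancel[OF summ]])
  have "(block_seq N f has_sum S) UNIV"
    by (rule norm_summable_imp_has_sum[OF summ S])
  then have "(g has_sum S) UNIV"
    unfolding gb using has_sum_reindex_bij_betw[OF bij_prod_decode, of g S] by simp
  then have "(g has_sum S) (Sigma UNIV (\<lambda>_. UNIV))" by simp
  then have "((\<lambda>n. \<Sum>i<N n. f n i) has_sum S) UNIV"
  proof (rule has_sum_SigmaD)
    fix n
    show "((\<lambda>i. g (n, i)) has_sum (\<Sum>i<N n. f n i)) UNIV"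
      by (rule has_sum_finite_neutralI[of "{..<N n}"]) (auto simp: g_def)
  qed
  then have "(\<lambda>n. \<Sum>i<N n. f n i) sums S" by (rule has_sum_imp_sums)
  with S L show ?thesis using sums_unique2 by blast
qed

text \<open>Write a power \<open>a powr p\<close> as \<open>a * a powr (p - 1)\<close>; the second
  factor only grows when a is replaced by a larger sum.\<close>

lemma sum_powr_le_powr_sum:
  fixes d :: "nat \<Rightarrow> real"
  assumes p: "1 \<le> p" and d: "\<And>n. 0 \<le> d n"
  shows "(\<Sum>n<M. d n powr p) \<le> (\<Sum>n<M. d n) powr p"
proof (induction M)
  case (Suc M)
  define a b where "a = (\<Sum>n<M. d n)" and "b = d M"
  have ab: "0 \<le> a" "0 \<le> b" using d by (auto simp: a_def b_def sum_nonneg)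
  have "a powr p + b powr p = a * a powr (p - 1) + b * b powr (p - 1)"
    using ab by (cases "a = 0"; cases "b = 0") (auto simp: powr_mult_base)
  also have "\<dots> \<le> a * (a + b) powr (p - 1) + b * (a + b) powr (p - 1)"
    using ab p by (intro add_mono mult_left_mono powr_mono2) auto
  also have "\<dots> = (a + b) powr p"
    using ab by (cases "a + b = 0") (auto simp: powr_mult_base simp flip: distrib_right)
  finally show ?case using Suc by (simp add: a_def b_def)
qed simp

text \<open>In block n the vectors are divided by \<open>s n\<close> and the coefficients multiplied
  by \<open>s n\<close>. The masses then add up to at most the sum of \<open>s\<close>, and the p-th
  powers of the norms to at most the sum of \<open>d n powr p\<close>, which is below
  \<open>c powr p\<close>. How each bound splits into \<open>s n * d n\<close> is left open:
  membership and the sharp norm estimate use different splittings.\<close>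

lemma covered_suminf:
  fixes U :: "nat \<Rightarrow> 'a::real_normed_vector \<Rightarrow>\<^sub>L 'b::banach"
  assumes p: "1 \<le> p" and s: "\<And>n. 0 < s n" "\<And>M. (\<Sum>n<M. s n) \<le> 1"
    and cov: "\<And>n. fin_covered p (s n * d n) (U n)"
    and d: "\<And>n. 0 \<le> d n" "\<And>M. (\<Sum>n<M. d n) \<le> c"
    and T: "U sums T"
  shows "covered p c T"
proof -
  have "\<exists>n x. ell_norm p n (\<lambda>i. norm (x i)) \<le> s k * d k \<and> U k ` cball 0 1 \<subseteq> fin_co p n x" for k
    using cov[of k] unfolding fin_covered_def .
  then obtain N x where x: "\<And>k. ell_norm p (N k) (\<lambda>i. norm (x k i)) \<le> s k * d k"
    and Ux: "\<And>k. U k ` cball 0 1 \<subseteq> fin_co p (N k) (x k)"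
    by metis
  define z where "z = block_seq N (\<lambda>n i. x n i /\<^sub>R s n)"
  have s1: "s n \<le> 1" for n
    using s(2)[of "Suc n"] sum_nonneg[of "{..<n}" s] less_imp_le[OF s(1)] by simp
  have c0: "0 \<le> c" using d(2)[of 0] by simp
  have z_powr: "norm (z k) powr p = block_seq N (\<lambda>n i. (norm (x n i) / s n) powr p) k" for k
    using s(1) p by (auto simp: z_def block_seq_def divide_inverse mult.commute less_imp_le split: prod.splits)
  have "(\<Sum>n<M. \<Sum>i<N n. (norm (x n i) / s n) powr p) \<le> c powr p" for M
  proof -
    have "(\<Sum>i<N n. (norm (x n i) / s n) powr p) \<le> d n powr p" for n
    proof -
      have "(\<Sum>i<N n. norm (x n i) powr p) \<le> (s n * d n) powr p"
        using x[of n] s(1)[of n] d(1)[of n] by (subst (asm) ell_norm_le_iff[OF p]) auto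
      moreover have "(\<Sum>i<N n. (norm (x n i) / s n) powr p) = (\<Sum>i<N n. norm (x n i) powr p) / s n powr p"
        using s(1)[of n] by (simp add: powr_divide sum_divide_distrib less_imp_le)
      ultimately show ?thesis
        using s(1)[of n] d(1)[of n] by (simp add: divide_le_eq powr_mult mult.commute)
    qed
    then have "(\<Sum>n<M. \<Sum>i<N n. (norm (x n i) / s n) powr p) \<le> (\<Sum>n<M. d n powr p)"
      by (intro sum_mono)
    also have "\<dots> \<le> (\<Sum>n<M. d n) powr p" by (rule sum_powr_le_powr_sum[OF p d(1)])
    also have "\<dots> \<le> c powr p" using d p by (intro powr_mono2 sum_nonneg) auto
    finally show ?thesis .
  qed
  note bs = block_seq_summable[of "\<lambda>n i. (norm (x n i) / s n) powr p" N "c powr p", OF _ this, folded z_powr, simplified z_powr[symmetric], simplified]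
  have zlp: "z \<in> lp p" using bs(1) by (simp add: lp_def z_powr)
  have zn: "(\<Sum>k. norm (z k) powr p) \<le> c powr p" using bs(2) by (simp add: z_powr)
  have summz: "summable (\<lambda>k. norm (z k) powr p)" using zlp by (simp add: lp_def)
  have zc: "lp_norm p z \<le> c"
    unfolding lp_norm_def using zn c0 p summz by (subst powr_le_cancel_root) (auto intro: suminf_nonneg)
  have "T y \<in> p_co p z" if y: "norm y \<le> 1" for y
  proof -
    define Q where "Q n a w \<longleftrightarrow> U n y = (\<Sum>i<N n. a i *\<^sub>R x n i)
        \<and> (\<forall>i<N n. 0 \<le> w i \<and> \<bar>a i\<bar> \<le> w i powr (1 - 1 / p)) \<and> (\<Sum>i<N n. w i) \<le> 1" for n a w
    have "\<exists>a w. Q n a w" for n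
    proof -
      have "U n y \<in> fin_co p (N n) (x n)" using Ux[of n] y by (auto simp: image_subset_iff)
      then show ?thesis unfolding Q_def by (rule fin_coE) blast
    qed
    then obtain a w where Q: "\<And>n. Q n (a n) (w n)" by metis
    then have a: "\<And>n. U n y = (\<Sum>i<N n. a n i *\<^sub>R x n i)"
      and w: "\<And>n i. i < N n \<Longrightarrow> 0 \<le> w n i" "\<And>n i. i < N n \<Longrightarrow> \<bar>a n i\<bar> \<le> w n i powr (1 - 1 / p)"
        "\<And>n. (\<Sum>i<N n. w n i) \<le> 1"
      unfolding Q_def by blast+
    define b where "b = block_seq N (\<lambda>n i. s n * a n i)"
    \<comment> \<open>The weights are cut off outside the blocks, since their nonnegativity is known
      only for \<open>i < N n\<close>.\<close>
    define v where "v n i = (if i < N n then s n * w n i else 0)" for n i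
    have v0: "0 \<le> v n i" for n i using w(1) s(1)[of n] by (simp add: v_def)
    have "(\<Sum>n<M. \<Sum>i<N n. v n i) \<le> 1" for M
    proof -
      have "(\<Sum>n<M. \<Sum>i<N n. v n i) = (\<Sum>n<M. s n * (\<Sum>i<N n. w n i))"
        by (simp add: v_def sum_distrib_left)
      also have "\<dots> \<le> (\<Sum>n<M. s n * 1)"
        using s(1) w(3) by (intro sum_mono mult_left_mono) (auto intro: less_imp_le)
      finally show ?thesis using s(2)[of M] by simp
    qed
    note vs = block_seq_summable[OF v0 this]
    have a1: "\<bar>a n i\<bar> \<le> 1" if "i < N n" for n i
    proof -
      have "w n i \<le> (\<Sum>i<N n. w n i)" using that w(1) by (intro member_le_sum) auto
      then have "w n i powr (1 - 1 / p) \<le> 1" using w(1)[OF that] w(3)[of n] p by (intro powr_le1) auto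
      then show ?thesis using w(2)[OF that] by linarith
    qed
    have "b \<in> coeff_ball p"
    proof (rule coeff_ballI[OF p _ _ vs])
      fix k
      show "0 \<le> block_seq N v k" using v0 by (auto simp: block_seq_def split: prod.splits)
      show "\<bar>b k\<bar> \<le> block_seq N v k powr (1 - 1 / p)"
        using scaled_coefficient[OF p less_imp_le[OF s(1)] s1 w(1,2)]
        by (auto simp: b_def block_seq_def v_def split: prod.splits)
    next
      have "summable s"
        by (rule bounded_imp_summable[where B = 1])
          (use s(1) s(2)[of "Suc _"] in \<open>auto simp: lessThan_Suc_atMost intro: less_imp_le\<close>)
      then have s0: "s \<longlonglongrightarrow> 0" by (rule summable_LIMSEQ_zero)
      show "b \<longlonglongrightarrow> 0"
      proof (rule LIMSEQ_I)
        fix e :: real assume e: "0 < e"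
        obtain n0 where n0: "\<And>n. n \<ge> n0 \<Longrightarrow> s n < e"
          using LIMSEQ_D[OF s0 e] by (auto simp: abs_less_iff)
        \<comment> \<open>Outside these finitely many indices, every nonzero coefficient belongs to
          a block n \<ge> n0 and is at most \<open>s n\<close>.\<close>
        define F where "F = prod_encode ` (Sigma {..<n0} (\<lambda>n. {..<N n}))"
        have "finite F" by (simp add: F_def)
        have small: "\<bar>b k\<bar> < e" if "k \<notin> F" for k
        proof -
          obtain n i where ni: "prod_decode k = (n, i)" by fastforce
          then have k: "k = prod_encode (n, i)" by (metis prod_decode_inverse)
          show ?thesis
          proof (cases "i < N n")
            case True
            then have "n0 \<le> n" using that k by (force simp: F_def)
            have "\<bar>b k\<bar> = s n * \<bar>a n i\<bar>"
              using True s(1)[of n] by (simp add: b_def block_seq_def ni abs_mult)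
            also have "\<dots> \<le> s n * 1" using a1[OF True] s(1)[of n] by (intro mult_left_mono) auto
            finally show ?thesis using n0[OF \<open>n0 \<le> n\<close>] by simp
          qed (use e in \<open>simp add: b_def block_seq_def ni\<close>)
        qed
        have "\<forall>k\<ge>Suc (Max (insert 0 F)). norm (b k - 0) < e"
        proof (intro allI impI)
          fix k assume "Suc (Max (insert 0 F)) \<le> k"
          then have "k \<notin> F" using \<open>finite F\<close> Max_ge[of "insert 0 F" k] by fastforce
          then show "norm (b k - 0) < e" using small by simp
        qed
        then show "\<exists>m. \<forall>k\<ge>m. norm (b k - 0) < e" by blast
      qed
    qed
    moreover have "(\<lambda>k. b k *\<^sub>R z k) sums T y"
    proof -
      have bz: "b k *\<^sub>R z k = block_seq N (\<lambda>n i. a n i *\<^sub>R x n i) k" for k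
        using less_imp_neq[OF s(1), symmetric] by (auto simp: b_def z_def block_seq_def split: prod.splits)
      have "summable (\<lambda>k. norm (b k *\<^sub>R z k))"
      proof (rule bounded_imp_summable[where B = c])
        fix K
        have "(\<Sum>k\<le>K. norm (b k *\<^sub>R z k)) \<le> ell_norm p (Suc K) (\<lambda>k. norm (z k))"
          using coeff_ball_Hoelder[OF p \<open>b \<in> coeff_ball p\<close>, of "Suc K" "\<lambda>k. norm (z k)"]
          by (simp add: lessThan_Suc_atMost)
        also have "\<dots> \<le> c"
          using sum_le_suminf[OF summz, of "{..<Suc K}"] zn by (subst ell_norm_le_iff[OF p c0]) auto
        finally show "(\<Sum>k\<le>K. norm (b k *\<^sub>R z k)) \<le> c" .
      qed simp
      moreover have "(\<lambda>n. \<Sum>i<N n. a n i *\<^sub>R x n i) sums T y"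
        using bounded_linear.sums[OF blinfun.bounded_linear_left T, of y] by (simp add: a)
      ultimately show ?thesis unfolding bz by (rule block_seq_sums)
    qed
    ultimately show ?thesis unfolding p_co_def by blast
  qed
  then show ?thesis unfolding covered_def using zlp zc by auto
qed

lemma fin_covered_mono:
  "fin_covered p c T \<Longrightarrow> c \<le> c' \<Longrightarrow> fin_covered p c' T"
  unfolding fin_covered_def by (meson order_trans)

section \<open>Operators whose dual is absolutely p-summing\<close>

definition inj_at :: "nat \<Rightarrow> 'a::real_normed_vector \<Rightarrow>\<^sub>L (nat discrete \<Rightarrow>\<^sub>C 'a)"
  where "inj_at k = Blinfun (\<lambda>x. Bcontfun (\<lambda>j. if j = discrete k then x else 0))"

definition proj_at :: "nat \<Rightarrow> (nat discrete \<Rightarrow>\<^sub>C 'a::real_normed_vector) \<Rightarrow>\<^sub>L 'a"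
  where "proj_at k = Blinfun (\<lambda>f. apply_bcontfun f (discrete k))"

text \<open>On a discrete domain continuity is automatic, so bounded continuous functions on
  \<open>nat discrete\<close> form the l_infinity-sum. It hosts the tuples of the separation
  argument as well as the spaces that glue factorizations.\<close>

lemma bcontfun_discreteI:
  fixes f :: "'i discrete \<Rightarrow> 'a::real_normed_vector"
  assumes "\<And>j. norm (f j) \<le> b"
  shows "f \<in> bcontfun"
  using assms by (intro bcontfun_normI[of _ b]) (auto simp: continuous_on_open_invariant open_discrete)

lemma proj_at_apply [simp]: "proj_at k f = apply_bcontfun f (discrete k)"
  unfolding proj_at_def
  by (intro bounded_linear_Blinfun_apply[THEN fun_cong] bounded_linear_intro[of _ 1]) (auto simp: norm_bounded)

lemma norm_proj_at: "norm (proj_at k :: (nat discrete \<Rightarrow>\<^sub>C 'a::real_normed_vector) \<Rightarrow>\<^sub>L 'a) \<le> 1"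
  by (rule norm_blinfun_bound) (auto simp: norm_bounded)

lemma norm_proj_at_le: "norm (proj_at k f) \<le> norm f"
  by (simp add: norm_bounded)

lemma inj_at_apply:
  fixes x :: "'a::real_normed_vector"
  shows "apply_bcontfun (inj_at k x) j = (if j = discrete k then x else 0)"
    and "norm (inj_at k x) \<le> norm x"
proof -
  let ?f = "\<lambda>x :: 'a. Bcontfun (\<lambda>j. if j = discrete k then x else 0)"
  have bc: "(\<lambda>j. if j = discrete k then x else 0) \<in> bcontfun" for x :: 'a
    by (rule bcontfun_discreteI[of _ "norm x"]) auto
  have f: "apply_bcontfun (?f x) j = (if j = discrete k then x else 0)" for x j
    by (simp add: Bcontfun_inverse[OF bc])
  have n: "norm (?f x) \<le> norm x" for x
    by (rule norm_bound) (simp add: f)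
  have "bounded_linear ?f"
  proof (rule bounded_linear_intro[of _ 1])
    show "?f (x + y) = ?f x + ?f y" "?f (c *\<^sub>R x) = c *\<^sub>R ?f x" for x y c
      by (rule bcontfun_eqI; simp add: f)+
  qed (simp add: n)
  then have i: "inj_at k x = ?f x" for x
    by (simp add: inj_at_def bounded_linear_Blinfun_apply)
  show "apply_bcontfun (inj_at k x) j = (if j = discrete k then x else 0)" by (simp add: i f)
  show "norm (inj_at k x) \<le> norm x" by (simp add: i n)
qed

lemma norm_inj_at: "norm (inj_at k :: 'a::real_normed_vector \<Rightarrow>\<^sub>L _) \<le> 1"
  by (rule norm_blinfun_bound) (auto simp: inj_at_apply)

lemma proj_inj_at: "proj_at j (inj_at k x) = (if j = k then x else 0)"
  by (simp add: inj_at_apply discrete_inject)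

lemma proj_at_sum_inj_at:
  assumes "j < m"
  shows "proj_at j (\<Sum>k<m. inj_at k (g k)) = g j"
  using assms by (simp only: blinfun.sum_right proj_inj_at) simp

section \<open>The cone of jointly covered tuples\<close>

definition append_at :: "nat \<Rightarrow> (nat \<Rightarrow> 'a) \<Rightarrow> (nat \<Rightarrow> 'a) \<Rightarrow> nat \<Rightarrow> 'a"
  where "append_at n f g i = (if i < n then f i else g (i - n))"

lemma sum_append_at:
  "(\<Sum>i<n + m. h i (append_at n f g i)) = (\<Sum>i<n. h i (f i)) + (\<Sum>i<m. h (n + i) (g i))"
proof (induction m)
  case 0
  show ?case by (simp add: append_at_def)
next
  case (Suc m)
  then show ?case by (simp add: append_at_def add.assoc)
qed

text \<open>The budgets \<open>t\<close> and \<open>c\<close> are measured by weight mass and by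
  p-th powers because these, unlike the norms, add up under concatenation. As upper bounds rather
  than exact values they force the multipliers of a separating functional to be nonnegative.\<close>

definition cone_point ::
    "real \<Rightarrow> nat \<Rightarrow> (nat discrete \<Rightarrow>\<^sub>C ('a::real_normed_vector \<times> real)) \<times> real
      \<Rightarrow> nat \<Rightarrow> (nat \<Rightarrow> 'a) \<Rightarrow> (nat \<Rightarrow> nat \<Rightarrow> real) \<Rightarrow> (nat \<Rightarrow> nat \<Rightarrow> real) \<Rightarrow> (nat \<Rightarrow> real) \<Rightarrow> real \<Rightarrow> bool"
  where "cone_point p m v n x a w t c \<longleftrightarrow>
    v = (\<Sum>k<m. inj_at k (\<Sum>i<n. a k i *\<^sub>R x i, t k), c) \<and>
    (\<forall>k<m. \<forall>i<n. 0 \<le> w k i) \<and> (\<forall>k<m. \<forall>i<n. \<bar>a k i\<bar> \<le> w k i powr (1 - 1 / p)) \<and>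
    (\<forall>k<m. (\<Sum>i<n. w k i) \<le> t k) \<and> (\<Sum>i<n. norm (x i) powr p) \<le> c"

definition operator_cone ::
    "real \<Rightarrow> nat \<Rightarrow> ((nat discrete \<Rightarrow>\<^sub>C ('a::real_normed_vector \<times> real)) \<times> real) set"
  where "operator_cone p m = {v. \<exists>n x a w t c. cone_point p m v n x a w t c}"

lemma operator_coneI:
  fixes n :: nat and x :: "nat \<Rightarrow> 'a::real_normed_vector"
  assumes "\<And>k i. k < m \<Longrightarrow> i < n \<Longrightarrow> 0 \<le> w k i" "\<And>k i. k < m \<Longrightarrow> i < n \<Longrightarrow> \<bar>a k i\<bar> \<le> w k i powr (1 - 1 / p)"
    "\<And>k. k < m \<Longrightarrow> (\<Sum>i<n. w k i) \<le> t k" "(\<Sum>i<n. norm (x i) powr p) \<le> c"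
  shows "(\<Sum>k<m. inj_at k (\<Sum>i<n. a k i *\<^sub>R x i, t k), c) \<in> operator_cone p m"
proof -
  have "cone_point p m (\<Sum>k<m. inj_at k (\<Sum>i<n. a k i *\<^sub>R x i, t k), c) n x a w t c"
    using assms by (simp add: cone_point_def)
  then show ?thesis unfolding operator_cone_def by blast
qed

lemma operator_cone_zero: "0 \<in> operator_cone p m"
  using operator_coneI[of m 0 "\<lambda>_ _. 0" "\<lambda>_ _. 0" p "\<lambda>_. 0" "\<lambda>_. 0" 0]
  by (simp add: blinfun.zero_right zero_prod_def flip: zero_prod_def)

text \<open>Concatenating the two sequences together with their coefficients and weights adds the
  points and both kinds of budget at once.\<close>

lemma operator_cone_add:
  assumes u: "u \<in> operator_cone p m" and v: "v \<in> operator_cone p m"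
  shows "u + v \<in> operator_cone p m"
proof -
  from u obtain n x a w t c where "cone_point p m u n x a w t c"
    unfolding operator_cone_def by blast
  then have u: "u = (\<Sum>k<m. inj_at k (\<Sum>i<n. a k i *\<^sub>R x i, t k), c)"
    "\<And>k i. k < m \<Longrightarrow> i < n \<Longrightarrow> 0 \<le> w k i" "\<And>k i. k < m \<Longrightarrow> i < n \<Longrightarrow> \<bar>a k i\<bar> \<le> w k i powr (1 - 1 / p)"
    "\<And>k. k < m \<Longrightarrow> (\<Sum>i<n. w k i) \<le> t k" "(\<Sum>i<n. norm (x i) powr p) \<le> c"
    by (simp_all add: cone_point_def)
  from v obtain n' x' a' w' t' c' where "cone_point p m v n' x' a' w' t' c'"
    unfolding operator_cone_def by blast
  then have v: "v = (\<Sum>k<m. inj_at k (\<Sum>i<n'. a' k i *\<^sub>R x' i, t' k), c')"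
    "\<And>k i. k < m \<Longrightarrow> i < n' \<Longrightarrow> 0 \<le> w' k i" "\<And>k i. k < m \<Longrightarrow> i < n' \<Longrightarrow> \<bar>a' k i\<bar> \<le> w' k i powr (1 - 1 / p)"
    "\<And>k. k < m \<Longrightarrow> (\<Sum>i<n'. w' k i) \<le> t' k" "(\<Sum>i<n'. norm (x' i) powr p) \<le> c'"
    by (simp_all add: cone_point_def)
  define X where "X = append_at n x x'"
  define A W where "A k = append_at n (a k) (a' k)" and "W k = append_at n (w k) (w' k)" for k
  have AX: "(\<Sum>i<n + n'. A k i *\<^sub>R X i) = (\<Sum>i<n. a k i *\<^sub>R x i) + (\<Sum>i<n'. a' k i *\<^sub>R x' i)" for k
    using sum_append_at[where h = "\<lambda>i r. r *\<^sub>R X i" and n = n and m = n' and f = "a k" and g = "a' k"] by (simp add: A_def X_def append_at_def)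
  have "(\<Sum>k<m. inj_at k (\<Sum>i<n + n'. A k i *\<^sub>R X i, t k + t' k), c + c') \<in> operator_cone p m"
  proof (rule operator_coneI[where w = W])
    show "0 \<le> W k i" "\<bar>A k i\<bar> \<le> W k i powr (1 - 1 / p)" if "k < m" "i < n + n'" for k i
      using u(2,3)[of k i] v(2,3)[of k "i - n"] that by (auto simp: W_def A_def append_at_def)
    show "(\<Sum>i<n + n'. W k i) \<le> t k + t' k" if "k < m" for k
      using u(4)[OF that] v(4)[OF that] sum_append_at[where h = "\<lambda>_ r. r" and n = n and m = n' and f = "w k" and g = "w' k"] by (simp add: W_def)
    show "(\<Sum>i<n + n'. norm (X i) powr p) \<le> c + c'"
      using u(5) v(5) sum_append_at[where h = "\<lambda>_ r. norm r powr p" and n = n and m = n' and f = x and g = x'] by (simp add: X_def)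
  qed
  also have "(\<Sum>k<m. inj_at k (\<Sum>i<n + n'. A k i *\<^sub>R X i, t k + t' k), c + c') = u + v"
  proof -
    have "inj_at k (\<Sum>i<n + n'. A k i *\<^sub>R X i, t k + t' k)
        = inj_at k (\<Sum>i<n. a k i *\<^sub>R x i, t k) + inj_at k (\<Sum>i<n'. a' k i *\<^sub>R x' i, t' k)" for k
      by (simp add: AX flip: blinfun.add_right)
    then show ?thesis by (simp add: u(1) v(1) sum.distrib)
  qed
  finally show ?thesis .
qed

text \<open>The factor splits as \<open>\<gamma> powr (1 - 1 / p)\<close> for the coefficients and
  \<open>\<gamma> powr (1 / p)\<close> for the vectors; weights and p-th powers then both scale by
  exactly \<gamma>.\<close>

lemma operator_cone_scaleR:
  assumes p: "1 \<le> p" and \<gamma>: "0 < \<gamma>" and u: "u \<in> operator_cone p m"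
  shows "\<gamma> *\<^sub>R u \<in> operator_cone p m"
proof -
  from u obtain n x a w t c where "cone_point p m u n x a w t c"
    unfolding operator_cone_def by blast
  then have u: "u = (\<Sum>k<m. inj_at k (\<Sum>i<n. a k i *\<^sub>R x i, t k), c)"
    "\<And>k i. k < m \<Longrightarrow> i < n \<Longrightarrow> 0 \<le> w k i" "\<And>k i. k < m \<Longrightarrow> i < n \<Longrightarrow> \<bar>a k i\<bar> \<le> w k i powr (1 - 1 / p)"
    "\<And>k. k < m \<Longrightarrow> (\<Sum>i<n. w k i) \<le> t k" "(\<Sum>i<n. norm (x i) powr p) \<le> c"
    by (simp_all add: cone_point_def)
  let ?a = "\<lambda>k i. \<gamma> powr (1 - 1 / p) * a k i" and ?x = "\<lambda>i. \<gamma> powr (1 / p) *\<^sub>R x i"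
  have "(\<Sum>k<m. inj_at k (\<Sum>i<n. ?a k i *\<^sub>R ?x i, \<gamma> * t k), \<gamma> * c) \<in> operator_cone p m"
  proof (rule operator_coneI[where w = "\<lambda>k i. \<gamma> * w k i"])
    show "0 \<le> \<gamma> * w k i" if "k < m" "i < n" for k i using u(2)[OF that] \<gamma> by simp
    show "\<bar>?a k i\<bar> \<le> (\<gamma> * w k i) powr (1 - 1 / p)" if "k < m" "i < n" for k i
      using u(2,3)[OF that] \<gamma> by (simp add: abs_mult powr_mult mult_left_mono)
    show "(\<Sum>i<n. \<gamma> * w k i) \<le> \<gamma> * t k" if "k < m" for k
      using u(4)[OF that] \<gamma> by (simp flip: sum_distrib_left)
    show "(\<Sum>i<n. norm (?x i) powr p) \<le> \<gamma> * c"
      using u(5) \<gamma> p by (simp add: powr_mult powr_powr flip: sum_distrib_left)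
  qed
  also have "(\<Sum>k<m. inj_at k (\<Sum>i<n. ?a k i *\<^sub>R ?x i, \<gamma> * t k), \<gamma> * c) = \<gamma> *\<^sub>R u"
  proof -
    have "\<gamma> powr (1 - 1 / p) * \<gamma> powr (1 / p) = \<gamma>"
      using \<gamma> by (simp flip: powr_add)
    then have "?a k i *\<^sub>R ?x i = \<gamma> *\<^sub>R (a k i *\<^sub>R x i)" for k i
      by (simp add: mult.commute mult.left_commute)
    then have "inj_at k (\<Sum>i<n. ?a k i *\<^sub>R ?x i, \<gamma> * t k) = \<gamma> *\<^sub>R inj_at k (\<Sum>i<n. a k i *\<^sub>R x i, t k)" for k
      by (simp only: flip: blinfun.scaleR_right) (simp add: scaleR_sum_right)
    then show ?thesis by (simp only: u(1) scaleR_Pair scaleR_sum_right real_scaleR_def)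
  qed
  finally show ?thesis .
qed

text \<open>The signs on the budget coordinates are reversed so that nonpositivity on the cone will
  read as nonnegativity of the multipliers \<mu> and \<nu>.\<close>

lemma operator_cone_functional:
  fixes f :: "((nat discrete \<Rightarrow>\<^sub>C ('a::real_normed_vector \<times> real)) \<times> real) \<Rightarrow>\<^sub>L real"
  obtains \<phi> :: "nat \<Rightarrow> 'a \<Rightarrow>\<^sub>L real" and \<mu> \<nu>
  where "\<forall>u t c. f (\<Sum>k<m. inj_at k (u k, t k), c) = (\<Sum>k<m. \<phi> k (u k) - \<mu> k * t k) - \<nu> * c"
proof -
  define \<phi> where "\<phi> k = Blinfun (\<lambda>x. f (inj_at k (x, 0), 0))" for k
  define \<mu> \<nu> where "\<mu> k = - f (inj_at k (0, 1), 0)" and "\<nu> = - f (0, 1)" for k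
  have bl: "bounded_linear (\<lambda>x. f (inj_at k (x, 0), 0))" for k
    by (intro bounded_linear_compose[OF blinfun.bounded_linear_right] bounded_linear_Pair
        bounded_linear_ident bounded_linear_zero)
  have "f (inj_at k (x, t), 0) = \<phi> k x - \<mu> k * t" for k x t
  proof -
    have e: "(inj_at k (x, t), 0) = (inj_at k (x, 0), 0) + t *\<^sub>R (inj_at k (0, 1), 0 :: real)"
      by (simp flip: blinfun.add_right blinfun.scaleR_right)
    show ?thesis
      unfolding e blinfun.add_right blinfun.scaleR_right
      by (simp add: \<phi>_def \<mu>_def bounded_linear_Blinfun_apply[OF bl])
  qed
  moreover have "f (\<Sum>k<m. inj_at k (u k, t k), c)
      = (\<Sum>k<m. f (inj_at k (u k, t k), 0)) + c * f (0, 1)" for u t c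
  proof -
    have e: "(\<Sum>k<m. inj_at k (u k, t k), c) = (\<Sum>k<m. (inj_at k (u k, t k), 0)) + c *\<^sub>R (0, 1 :: real)"
      by (simp add: sum_prod)
    show ?thesis unfolding e blinfun.add_right blinfun.scaleR_right blinfun.sum_right by simp
  qed
  ultimately show ?thesis by (intro that[of \<phi> \<mu> \<nu>]) (simp add: \<nu>_def)
qed

text \<open>Two estimates meet in \<open>Us\<close>, the supremum over the unit ball of the p-th
  power sums of the rescaled functionals. The summing inequality for the dual bounds the left side
  in terms of \<open>Us\<close>, and the cone inequality at multiples of ball vectors bounds
  \<open>Us\<close> in terms of \<nu>; the parameter \<gamma> balances the two.\<close>

lemma operator_cone_functional_bound:
  fixes T :: "'b::real_normed_vector \<Rightarrow>\<^sub>L 'a::real_normed_vector" and \<phi> :: "nat \<Rightarrow> 'a \<Rightarrow>\<^sub>L real"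
  assumes p: "1 \<le> p" and C0: "C0 \<in> summing_constants p (dual_op T)"
    and y: "\<And>k. k < m \<Longrightarrow> norm (y k) \<le> 1"
    and \<rho>: "0 < \<rho>" "\<rho> \<le> 1" "0 < C" "C0 \<le> \<rho> * C"
    and \<mu>: "\<And>k. k < m \<Longrightarrow> 0 < \<mu> k" and \<nu>: "0 \<le> \<nu>"
    and cone: "\<And>x w. (\<And>k. k < m \<Longrightarrow> 0 \<le> w k) \<Longrightarrow>
      (\<Sum>k<m. w k powr (1 - 1 / p) * \<bar>blinfun_apply (\<phi> k) x\<bar> - \<mu> k * w k) \<le> \<nu> * norm x powr p"
  shows "(\<Sum>k<m. \<phi> k (T (y k))) \<le> \<rho> * (\<Sum>k<m. \<mu> k) + \<nu> * C powr p"
proof (cases "m = 0")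
  case True
  then show ?thesis using \<nu> by simp
next
  case False
  define \<Lambda> where "\<Lambda> = (\<Sum>k<m. \<mu> k)"
  have \<Lambda>: "0 < \<Lambda>" unfolding \<Lambda>_def using False \<mu> by (intro sum_pos) auto
  \<comment> \<open>The exponent is chosen for Hoelder with weights \<open>\<mu> k\<close>:
    recovering \<phi> from \<psi> produces the factor \<open>\<mu> k powr (1 - 1 / p)\<close>, so
    the mass becomes the sum of the multipliers.\<close>
  define \<psi> where "\<psi> k = \<mu> k powr (1 / p - 1) *\<^sub>R \<phi> k" for k
  have \<phi>\<psi>: "\<phi> k = \<mu> k powr (1 - 1 / p) *\<^sub>R \<psi> k" if "k < m" for k
    using \<mu>[OF that] by (simp add: \<psi>_def flip: powr_add)
  define U where "U z = (\<Sum>k<m. \<bar>\<psi> k z\<bar> powr p)" for z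
  have U_le: "U z \<le> (\<Sum>k<m. norm (\<psi> k) powr p)" if "norm z \<le> 1" for z
    unfolding U_def
  proof (intro sum_mono powr_mono2)
    fix k
    show "\<bar>\<psi> k z\<bar> \<le> norm (\<psi> k)"
      using norm_blinfun[of "\<psi> k" z] mult_left_mono[OF that, of "norm (\<psi> k)"] by simp
  qed (use p in auto)
  then have bdd: "bdd_above (U ` cball 0 1)" by (intro bdd_aboveI2) auto
  define Us where "Us = (SUP z\<in>cball 0 1. U z)"
  have U_Us: "U z \<le> Us" if "norm z \<le> 1" for z
    unfolding Us_def using bdd that by (intro cSUP_upper) auto
  have "0 \<le> U 0" by (simp add: U_def sum_nonneg)
  then have Us0: "0 \<le> Us" using U_Us[of 0] by simp
  have "weak_lp_norm p m \<psi> \<le> Us powr (1 / p)"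
  proof (rule weak_lp_norm_dual_le[OF p])
    fix z :: 'a assume "norm z \<le> 1"
    then show "ell_norm p m (\<lambda>i. \<bar>\<psi> i z\<bar>) \<le> Us powr (1 / p)"
      using U_Us[of z] p Us0 by (subst ell_norm_le_iff) (auto simp: U_def powr_powr)
  qed simp
  then have "C0 * weak_lp_norm p m \<psi> \<le> C0 * Us powr (1 / p)"
    using C0 by (intro mult_left_mono) (auto simp: summing_constants_iff)
  then have T\<psi>: "ell_norm p m (\<lambda>k. norm (\<psi> k o\<^sub>L T)) \<le> C0 * Us powr (1 / p)"
    using C0 unfolding summing_constants_iff dual_op_apply by (blast intro: order_trans)
  have "(\<Sum>k<m. \<phi> k (T (y k))) \<le> (\<Sum>k<m. \<mu> k powr (1 - 1 / p) * norm (\<psi> k o\<^sub>L T))"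
  proof (rule sum_mono)
    fix k assume "k \<in> {..<m}"
    then have k: "k < m" by simp
    have "\<psi> k (T (y k)) \<le> norm (\<psi> k o\<^sub>L T)"
      using norm_blinfun[of "\<psi> k o\<^sub>L T" "y k"] mult_left_mono[OF y[OF k], of "norm (\<psi> k o\<^sub>L T)"] by simp
    then show "\<phi> k (T (y k)) \<le> \<mu> k powr (1 - 1 / p) * norm (\<psi> k o\<^sub>L T)"
      by (subst \<phi>\<psi>[OF k]) (simp add: blinfun.scaleR_left mult_left_mono)
  qed
  also have "\<dots> \<le> \<Lambda> powr (1 - 1 / p) * ell_norm p m (\<lambda>k. norm (\<psi> k o\<^sub>L T))"
    unfolding \<Lambda>_def ell_norm_def using \<mu> by (intro weighted_Hoelder p) (auto intro: less_imp_le)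
  also have "\<dots> \<le> \<Lambda> powr (1 - 1 / p) * (C0 * Us powr (1 / p))"
    by (intro mult_left_mono T\<psi>) simp
  finally have L: "(\<Sum>k<m. \<phi> k (T (y k))) \<le> \<Lambda> powr (1 - 1 / p) * (C0 * Us powr (1 / p))" .
  show ?thesis
  proof (cases "Us = 0")
    case True
    then show ?thesis using L \<nu> \<rho> \<Lambda> by (simp add: \<Lambda>_def add_nonneg_nonneg order_trans)
  next
    case False
    then have Us: "0 < Us" using Us0 by simp
    \<comment> \<open>Now \<open>\<gamma> * Us\<close> is the term \<open>\<rho> * \<Lambda>\<close>
      of the claim, and \<open>C * \<gamma> powr (1 - 1 / p) * Us\<close> dominates the Hoelder
      bound, because \<open>C0\<close> is at most \<open>C * \<rho>\<close> and hence at most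
      \<open>C * \<rho> powr (1 - 1 / p)\<close>.\<close>
    define \<gamma> where "\<gamma> = \<rho> * \<Lambda> / Us"
    have \<gamma>: "0 < \<gamma>" using Us \<Lambda> \<rho> by (simp add: \<gamma>_def)
    have key: "(C * \<gamma> powr (1 - 1 / p) - \<gamma>) * U z \<le> \<nu> * C powr p" if z: "norm z \<le> 1" for z
    proof -
      \<comment> \<open>With these weights gain and cost for each k are both multiples of
        \<open>\<bar>\<psi> k z\<bar> powr p\<close>, with factors independent of k.\<close>
      define w where "w k = \<gamma> * \<bar>\<psi> k z\<bar> powr p / \<mu> k" for k
      have "(C * \<gamma> powr (1 - 1 / p) - \<gamma>) * U z
          = (\<Sum>k<m. w k powr (1 - 1 / p) * \<bar>\<phi> k (C *\<^sub>R z)\<bar> - \<mu> k * w k)"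
        unfolding U_def sum_distrib_left
      proof (rule sum.cong[OF refl])
        fix k assume "k \<in> {..<m}"
        then have k: "k < m" by simp
        have "w k powr (1 - 1 / p) * \<bar>\<phi> k (C *\<^sub>R z)\<bar>
            = C * \<gamma> powr (1 - 1 / p) * ((\<bar>\<psi> k z\<bar> powr p) powr (1 - 1 / p) * \<bar>\<psi> k z\<bar>)"
          using \<mu>[OF k] \<gamma> \<rho> by (subst \<phi>\<psi>[OF k])
            (simp add: w_def blinfun.scaleR_left blinfun.scaleR_right abs_mult powr_divide powr_mult)
        also have "(\<bar>\<psi> k z\<bar> powr p) powr (1 - 1 / p) * \<bar>\<psi> k z\<bar> = \<bar>\<psi> k z\<bar> powr p"
          using powr_split[OF p, of "\<bar>\<psi> k z\<bar>"] by simp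
        finally show "(C * \<gamma> powr (1 - 1 / p) - \<gamma>) * \<bar>\<psi> k z\<bar> powr p
            = w k powr (1 - 1 / p) * \<bar>\<phi> k (C *\<^sub>R z)\<bar> - \<mu> k * w k"
          using \<mu>[OF k] by (simp add: w_def left_diff_distrib)
      qed
      also have "\<dots> \<le> \<nu> * norm (C *\<^sub>R z) powr p"
        by (intro cone) (simp add: w_def less_imp_le[OF \<gamma>] less_imp_le[OF \<mu>])
      also have "\<dots> \<le> \<nu> * C powr p"
        using z \<rho> p \<nu> by (intro mult_left_mono powr_mono2) (auto simp: mult_left_le)
      finally show ?thesis .
    qed
    have "(C * \<gamma> powr (1 - 1 / p) - \<gamma>) * Us \<le> \<nu> * C powr p"
    \<comment> \<open>Dividing by a positive factor permits the supremum over z; for a nonpositive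
      factor the inequality is trivial.\<close>
    proof (cases "0 < C * \<gamma> powr (1 - 1 / p) - \<gamma>")
      case True
      have "Us \<le> \<nu> * C powr p / (C * \<gamma> powr (1 - 1 / p) - \<gamma>)"
        unfolding Us_def
      proof (rule cSUP_least)
        fix z :: 'a assume "z \<in> cball 0 1"
        then show "U z \<le> \<nu> * C powr p / (C * \<gamma> powr (1 - 1 / p) - \<gamma>)"
          using key[of z] True by (simp add: pos_le_divide_eq mult.commute)
      qed simp
      then show ?thesis using True by (simp add: pos_le_divide_eq mult.commute)
    next
      case False
      then have "(C * \<gamma> powr (1 - 1 / p) - \<gamma>) * Us \<le> 0" using Us by (simp add: mult_nonpos_nonneg)
      also have "0 \<le> \<nu> * C powr p" using \<nu> by simp
      finally show ?thesis .
    qed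
    moreover have "\<gamma> * Us = \<rho> * \<Lambda>" using Us by (simp add: \<gamma>_def)
    moreover have "\<Lambda> powr (1 - 1 / p) * (C0 * Us powr (1 / p)) \<le> C * \<gamma> powr (1 - 1 / p) * Us"
    proof -
      have "C0 \<le> C * \<rho>" using \<rho> by (simp add: mult.commute)
      also have "\<dots> \<le> C * \<rho> powr (1 - 1 / p)"
        using \<rho> by (intro mult_left_mono le_powr_le_one p) auto
      finally have "C0 \<le> C * \<rho> powr (1 - 1 / p)" .
      then have "\<Lambda> powr (1 - 1 / p) * (C0 * Us powr (1 / p))
          \<le> \<Lambda> powr (1 - 1 / p) * (C * \<rho> powr (1 - 1 / p) * Us powr (1 / p))"
        by (intro mult_left_mono mult_right_mono) auto
      also have "\<dots> = C * (\<rho> * \<Lambda>) powr (1 - 1 / p) * Us powr (1 / p)"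
        using \<Lambda> \<rho> by (simp add: powr_mult)
      also have "\<dots> = C * (\<gamma> * Us) powr (1 - 1 / p) * Us powr (1 / p)"
        using Us by (simp add: \<gamma>_def)
      also have "\<dots> = C * \<gamma> powr (1 - 1 / p) * (Us powr (1 - 1 / p) * Us powr (1 / p))"
        using Us \<gamma> by (simp add: powr_mult)
      also have "Us powr (1 - 1 / p) * Us powr (1 / p) = Us"
        using Us by (simp flip: powr_add)
      finally show ?thesis .
    qed
    ultimately show ?thesis using L by (simp add: \<Lambda>_def left_diff_distrib)
  qed
qed

lemma operator_cone_approx:
  fixes T :: "'b::real_normed_vector \<Rightarrow>\<^sub>L 'a::real_normed_vector"
  assumes p: "1 \<le> p" and C0: "C0 \<in> summing_constants p (dual_op T)"
    and y: "\<And>k. k < m \<Longrightarrow> norm (y k) \<le> 1"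
    and \<rho>: "0 < \<rho>" "\<rho> \<le> 1" "0 < C" "C0 \<le> \<rho> * C"
  shows "infdist (\<Sum>k<m. inj_at k (T (y k), \<rho>), C powr p) (operator_cone p m) = 0"
proof (rule ccontr)
  let ?\<tau> = "(\<Sum>k<m. inj_at k (T (y k), \<rho>), C powr p)"
  let ?K = "operator_cone p m :: ((nat discrete \<Rightarrow>\<^sub>C ('a \<times> real)) \<times> real) set"
  assume "infdist ?\<tau> ?K \<noteq> 0"
  then have "0 < infdist ?\<tau> ?K" using infdist_nonneg[of ?\<tau> ?K] by linarith
  moreover have "\<exists>f :: ((nat discrete \<Rightarrow>\<^sub>C ('a \<times> real)) \<times> real) \<Rightarrow>\<^sub>L real.
      f ?\<tau> = infdist ?\<tau> ?K \<and> (\<forall>x\<in>?K. f x \<le> 0)"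
    by (rule separating_functional[of ?K ?\<tau>])
      (simp add: operator_cone_zero, simp add: operator_cone_add, simp add: operator_cone_scaleR[OF p], blast)
  then obtain f :: "((nat discrete \<Rightarrow>\<^sub>C ('a \<times> real)) \<times> real) \<Rightarrow>\<^sub>L real"
    where "f ?\<tau> = infdist ?\<tau> ?K" "\<And>x. x \<in> ?K \<Longrightarrow> f x \<le> 0" by blast
  ultimately have f: "0 < f ?\<tau>" "\<And>x. x \<in> ?K \<Longrightarrow> f x \<le> 0" by auto
  obtain \<phi> :: "nat \<Rightarrow> 'a \<Rightarrow>\<^sub>L real" and \<mu> \<nu> where "\<forall>u t c. f (\<Sum>k<m. inj_at k (u k, t k), c) = (\<Sum>k<m. blinfun_apply (\<phi> k) (u k) - \<mu> k * t k) - \<nu> * c"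
    by (rule operator_cone_functional[of f m]) (rule that; assumption)
  then have f_eq: "f (\<Sum>k<m. inj_at k (u k, t k), c) = (\<Sum>k<m. \<phi> k (u k) - \<mu> k * t k) - \<nu> * c" for u t c
    by blast
  have cone: "(\<Sum>k<m. \<phi> k (\<Sum>i<n. a k i *\<^sub>R x i) - \<mu> k * t k) \<le> \<nu> * c"
    if "\<And>k i. k < m \<Longrightarrow> i < n \<Longrightarrow> 0 \<le> w k i" "\<And>k i. k < m \<Longrightarrow> i < n \<Longrightarrow> \<bar>a k i\<bar> \<le> w k i powr (1 - 1 / p)"
    "\<And>k. k < m \<Longrightarrow> (\<Sum>i<n. w k i) \<le> t k" "(\<Sum>i<n. norm (x i) powr p) \<le> c" for n :: nat and a x w t c
    using f(2)[OF operator_coneI[of m n w a p t x c]] that by (simp add: f_eq)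
  \<comment> \<open>Spending a budget without producing any vector stays in the cone, which fixes
    the signs of the multipliers.\<close>
  have \<nu>: "0 \<le> \<nu>"
    using cone[of 0 "\<lambda>_ _. 0" "\<lambda>_ _. 0" "\<lambda>_. 0" "\<lambda>_. 0" 1] by simp
  have \<mu>: "0 \<le> \<mu> j" if j: "j < m" for j
  proof -
    have "(\<Sum>k<m. \<mu> k * (if k = j then 1 else 0)) = \<mu> j" using j by (simp add: mult_delta_right)
    then show ?thesis
      using cone[of 0 "\<lambda>_ _. 0" "\<lambda>_ _. 0" "\<lambda>k. if k = j then 1 else 0" "\<lambda>_. 0" 0] by (simp add: sum_negf)
  qed
  \<comment> \<open>Cone points built on a single vector suffice. The signs put into the
    coefficients turn each \<open>\<phi> k x\<close> into its absolute value.\<close>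
  have single: "(\<Sum>k<m. w k powr (1 - 1 / p) * \<bar>\<phi> k x\<bar> - \<mu> k * w k) \<le> \<nu> * norm x powr p"
    if w: "\<And>k. k < m \<Longrightarrow> 0 \<le> w k" for x w
  proof -
    have "(\<Sum>k<m. \<phi> k (\<Sum>i<(1::nat). (sgn (\<phi> k x) * w k powr (1 - 1 / p)) *\<^sub>R x) - \<mu> k * w k) \<le> \<nu> * norm x powr p"
      by (rule cone[where n = 1 and a = "\<lambda>k _. sgn (\<phi> k x) * w k powr (1 - 1 / p)"
          and x = "\<lambda>_. x" and w = "\<lambda>k _. w k" and t = w]) (auto simp: w abs_mult abs_sgn_eq)
    moreover have "\<phi> k (\<Sum>i<(1::nat). (sgn (\<phi> k x) * w k powr (1 - 1 / p)) *\<^sub>R x) = w k powr (1 - 1 / p) * \<bar>\<phi> k x\<bar>"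
      for k by (simp add: blinfun.scaleR_right sgn_if)
    ultimately show ?thesis by simp
  qed
  define L where "L = (\<Sum>k<m. \<phi> k (T (y k)))"
  define gap where "gap = L - \<rho> * (\<Sum>k<m. \<mu> k) - \<nu> * C powr p"
  have gap: "0 < gap"
    using f(1) f_eq[of "\<lambda>k. T (y k)" "\<lambda>_. \<rho>" "C powr p"]
    by (simp add: gap_def L_def sum_subtractf sum_distrib_left mult.commute[of \<rho>])
  \<comment> \<open>The bound asks for strictly positive multipliers. Raising each of them by
    \<epsilon> preserves the cone inequality and costs at most \<open>m * \<epsilon>\<close>, which
    is less than the gap.\<close>
  define \<epsilon> where "\<epsilon> = gap / (2 * (real m + 1))"
  have \<epsilon>: "0 < \<epsilon>" using gap by (simp add: \<epsilon>_def)
  have "L \<le> \<rho> * (\<Sum>k<m. \<mu> k + \<epsilon>) + \<nu> * C powr p"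
    unfolding L_def
  proof (rule operator_cone_functional_bound[OF p C0 y \<rho> _ \<nu>])
    fix x w assume w: "\<And>k. k < m \<Longrightarrow> 0 \<le> (w k :: real)"
    have "(\<Sum>k<m. w k powr (1 - 1 / p) * \<bar>\<phi> k x\<bar> - (\<mu> k + \<epsilon>) * w k)
        \<le> (\<Sum>k<m. w k powr (1 - 1 / p) * \<bar>\<phi> k x\<bar> - \<mu> k * w k)"
      using w \<epsilon> by (intro sum_mono) (simp add: distrib_right)
    then show "(\<Sum>k<m. w k powr (1 - 1 / p) * \<bar>\<phi> k x\<bar> - (\<mu> k + \<epsilon>) * w k) \<le> \<nu> * norm x powr p"
      by (rule order_trans[OF _ single[OF w]])
  qed (use \<mu> \<epsilon> in \<open>auto intro: add_nonneg_pos\<close>)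
  also have "\<rho> * (\<Sum>k<m. \<mu> k + \<epsilon>) = \<rho> * (\<Sum>k<m. \<mu> k) + \<rho> * (m * \<epsilon>)"
    by (simp add: sum.distrib distrib_left)
  also have "\<rho> * (m * \<epsilon>) \<le> 1 * (m * \<epsilon>)"
    using \<rho> \<epsilon> by (intro mult_right_mono) auto
  also have "1 * (m * \<epsilon>) < gap"
  proof -
    have "m * \<epsilon> = gap * (m / (2 * (m + 1)))" by (simp add: \<epsilon>_def algebra_simps)
    also have "\<dots> < gap * 1" using gap by (intro mult_strict_left_mono) auto
    finally show ?thesis by simp
  qed
  finally show False by (simp add: gap_def)
qed

text \<open>Cone points are available only near the target. The target is therefore placed inside
  the budgets, at mass \<rho> < 1 and at \<open>C powr p\<close> below \<open>c powr p\<close>, and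
  the tolerance \<eta> is kept within both margins.\<close>

lemma dual_summing_approx:
  fixes T :: "'b::real_normed_vector \<Rightarrow>\<^sub>L 'a::real_normed_vector" and y :: "nat \<Rightarrow> 'b"
  assumes p: "1 \<le> p" and C0: "C0 \<in> summing_constants p (dual_op T)" and c: "C0 < c"
    and y: "\<And>k. k < m \<Longrightarrow> norm (y k) \<le> 1" and e: "0 < e"
  obtains n :: nat and x where "ell_norm p n (\<lambda>i. norm (x i)) \<le> c"
    "\<forall>k<m. \<exists>z\<in>fin_co p n x. norm (T (y k) - z) \<le> e"
proof -
  have C00: "0 \<le> C0" using C0 by (simp add: summing_constants_iff)
  define C where "C = (C0 + c) / 2"
  have C: "0 < C" "C0 < C" "C < c" using C00 c by (auto simp: C_def)
  \<comment> \<open>The lower bound 1/2 keeps \<rho> positive when \<open>C0 = 0\<close>.\<close>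
  define \<rho> where "\<rho> = max (1 / 2) (C0 / C)"
  have \<rho>: "0 < \<rho>" "\<rho> < 1" "C0 \<le> \<rho> * C" using C by (auto simp: \<rho>_def max_def field_simps)
  have cC: "C powr p < c powr p" using C p by (intro powr_less_mono2) auto
  define \<eta> where "\<eta> = min e (min (1 - \<rho>) (c powr p - C powr p))"
  have \<eta>: "0 < \<eta>" "\<eta> \<le> e" "\<eta> \<le> 1 - \<rho>" "\<eta> \<le> c powr p - C powr p" using e \<rho> cC by (auto simp: \<eta>_def)
  let ?\<tau> = "(\<Sum>k<m. inj_at k (T (y k), \<rho>), C powr p)"
  have "infdist ?\<tau> (operator_cone p m) < \<eta>"
    using operator_cone_approx[OF p C0 y \<rho>(1) _ C(1) \<rho>(3)] \<rho>(2) \<eta>(1) by simp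
  then obtain v where v: "v \<in> operator_cone p m" "dist ?\<tau> v < \<eta>"
    using infdist_less_obtain[of "operator_cone p m" ?\<tau> \<eta>] operator_cone_zero[of p m] by blast
  from v(1) obtain n x a w t d where "cone_point p m v n x a w t d"
    unfolding operator_cone_def by blast
  then have v_eq: "v = (\<Sum>k<m. inj_at k (\<Sum>i<n. a k i *\<^sub>R x i, t k), d)"
    and w: "\<And>k i. k < m \<Longrightarrow> i < n \<Longrightarrow> 0 \<le> w k i" "\<And>k i. k < m \<Longrightarrow> i < n \<Longrightarrow> \<bar>a k i\<bar> \<le> w k i powr (1 - 1 / p)"
    and t: "\<And>k. k < m \<Longrightarrow> (\<Sum>i<n. w k i) \<le> t k" and d: "(\<Sum>i<n. norm (x i) powr p) \<le> d"
    by (simp_all add: cone_point_def)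
  have "dist (C powr p) d < \<eta>"
    using dist_snd_le[of ?\<tau> v] v(2) by (simp add: v_eq)
  then have "d \<le> c powr p" using \<eta>(4) by (simp add: dist_real_def)
  then have x: "ell_norm p n (\<lambda>i. norm (x i)) \<le> c"
    using d C C00 by (subst ell_norm_le_iff[OF p]) auto
  have close: "norm (T (y k) - (\<Sum>i<n. a k i *\<^sub>R x i)) \<le> \<eta> \<and> \<bar>\<rho> - t k\<bar> \<le> \<eta>" if k: "k < m" for k
  proof -
    have "(T (y k), \<rho>) - (\<Sum>i<n. a k i *\<^sub>R x i, t k) = proj_at k (fst ?\<tau> - fst v)"
      using proj_at_sum_inj_at[OF k, of "\<lambda>k. (T (y k), \<rho>)"]
        proj_at_sum_inj_at[OF k, of "\<lambda>k. (\<Sum>i<n. a k i *\<^sub>R x i, t k)"]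
      by (simp only: blinfun.diff_right v_eq fst_conv)
    then have "norm ((T (y k), \<rho>) - (\<Sum>i<n. a k i *\<^sub>R x i, t k)) \<le> dist (fst ?\<tau>) (fst v)"
      by (simp only: dist_norm norm_proj_at_le)
    also have "\<dots> \<le> dist ?\<tau> v" by (rule dist_fst_le)
    finally have *: "norm (T (y k) - (\<Sum>i<n. a k i *\<^sub>R x i), \<rho> - t k) \<le> \<eta>" using v(2) by simp
    show ?thesis
      using order_trans[OF norm_fst_le *] order_trans[OF norm_snd_le *] by simp
  qed
  show ?thesis
  proof (rule that[OF x], intro allI impI)
    fix k assume k: "k < m"
    have "(\<Sum>i<n. w k i) \<le> 1" using t[OF k] close[OF k] \<eta>(3) by linarith
    then have "(\<Sum>i<n. a k i *\<^sub>R x i) \<in> fin_co p n x"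
      using w k by (intro fin_coI) auto
    then show "\<exists>z\<in>fin_co p n x. norm (T (y k) - z) \<le> e"
      using conjunct1[OF close[OF k]] \<eta>(2) by (intro bexI[of _ "\<Sum>i<n. a k i *\<^sub>R x i"]) linarith
  qed
qed

section \<open>From finitely many points to the whole ball\<close>

lemma fin_co_add:
  assumes p: "1 \<le> p" and u: "u \<in> fin_co p n x" and v: "v \<in> fin_co p m z"
    and s: "0 < s" "0 < t" "s + t \<le> 1"
  shows "u + v \<in> fin_co p (n + m) (append_at n (\<lambda>i. x i /\<^sub>R s) (\<lambda>i. z i /\<^sub>R t))"
proof -
  from u obtain a w where u: "u = (\<Sum>i<n. a i *\<^sub>R x i)" "\<And>i. i < n \<Longrightarrow> 0 \<le> w i"
    "\<And>i. i < n \<Longrightarrow> \<bar>a i\<bar> \<le> w i powr (1 - 1 / p)" "(\<Sum>i<n. w i) \<le> 1" by (rule fin_coE) blast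
  from v obtain b w' where v: "v = (\<Sum>i<m. b i *\<^sub>R z i)" "\<And>i. i < m \<Longrightarrow> 0 \<le> w' i"
    "\<And>i. i < m \<Longrightarrow> \<bar>b i\<bar> \<le> w' i powr (1 - 1 / p)" "(\<Sum>i<m. w' i) \<le> 1" by (rule fin_coE) blast
  define X where "X = append_at n (\<lambda>i. x i /\<^sub>R s) (\<lambda>i. z i /\<^sub>R t)"
  define A where "A = append_at n (\<lambda>i. s * a i) (\<lambda>i. t * b i)"
  define W where "W = append_at n (\<lambda>i. s * w i) (\<lambda>i. t * w' i)"
  have mem: "(\<Sum>i<n + m. A i *\<^sub>R X i) \<in> fin_co p (n + m) X"
  proof (rule fin_coI)
    show "0 \<le> W i" if "i < n + m" for i
      using u(2)[of i] v(2)[of "i - n"] s that by (auto simp: W_def append_at_def)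
    show "\<bar>A i\<bar> \<le> W i powr (1 - 1 / p)" if "i < n + m" for i
    proof (cases "i < n")
      case True
      then show ?thesis
        using scaled_coefficient[OF p _ _ u(2)[OF True] u(3)[OF True], of s] s by (simp add: W_def A_def append_at_def)
    next
      case False
      then have i: "i - n < m" using that by simp
      show ?thesis
        using scaled_coefficient[OF p _ _ v(2)[OF i] v(3)[OF i], of t] s False by (simp add: W_def A_def append_at_def)
    qed
    have "(\<Sum>i<n + m. W i) = s * (\<Sum>i<n. w i) + t * (\<Sum>i<m. w' i)"
      unfolding W_def sum_append_at[where h = "\<lambda>_ r. r"] by (simp add: sum_distrib_left)
    also have "\<dots> \<le> s * 1 + t * 1"
      using u(4) v(4) s by (intro add_mono mult_left_mono) auto
    finally show "(\<Sum>i<n + m. W i) \<le> 1" using s by simp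
  qed
  have sa: "s * r * inverse s = r" "t * r * inverse t = r" for r
    using s by simp_all
  have "(\<Sum>i<n + m. A i *\<^sub>R X i) = u + v"
    using sum_append_at[where h = "\<lambda>i r. r *\<^sub>R X i" and n = n and m = m and f = "\<lambda>i. s * a i" and g = "\<lambda>i. t * b i"] sa
    by (simp add: A_def X_def append_at_def u(1) v(1))
  then show ?thesis using mem by (simp add: X_def)
qed

text \<open>Rounding the values divided by \<eta> leaves finitely many patterns on the ball, because
  each functional is bounded there; one ball vector per pattern forms the net.\<close>

lemma finite_net:
  fixes f :: "nat \<Rightarrow> 'a::real_normed_vector \<Rightarrow>\<^sub>L real"
  assumes \<eta>: "0 < \<eta>"
  obtains m :: nat and y where "\<And>k. k < m \<Longrightarrow> norm (y k) \<le> 1"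
    "\<And>z. norm z \<le> 1 \<Longrightarrow> \<exists>k<m. \<forall>i<d. \<bar>f i z - f i (y k)\<bar> \<le> \<eta>"
proof -
  define g where "g z = (\<lambda>i\<in>{..<d}. \<lfloor>f i z / \<eta>\<rfloor>)" for z
  have "g ` cball 0 1 \<subseteq> (\<Pi>\<^sub>E i\<in>{..<d}. {\<lfloor>- norm (f i) / \<eta>\<rfloor>..\<lfloor>norm (f i) / \<eta>\<rfloor>})"
  proof (rule image_subsetI)
    fix z :: 'a assume "z \<in> cball 0 1"
    then have z: "norm z \<le> 1" by simp
    have "\<bar>f i z\<bar> \<le> norm (f i)" for i
      using norm_blinfun[of "f i" z] mult_left_mono[OF z, of "norm (f i)"] by simp
    then have "- norm (f i) \<le> f i z" "f i z \<le> norm (f i)" for i by (auto simp: abs_le_iff minus_le_iff)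
    from divide_right_mono[OF this(1) less_imp_le[OF \<eta>]] divide_right_mono[OF this(2) less_imp_le[OF \<eta>]]
    show "g z \<in> (\<Pi>\<^sub>E i\<in>{..<d}. {\<lfloor>- norm (f i) / \<eta>\<rfloor>..\<lfloor>norm (f i) / \<eta>\<rfloor>})"
      by (auto simp: g_def intro!: floor_mono)
  qed
  then have "finite (g ` cball 0 1)" by (rule finite_subset) (intro finite_PiE, auto)
  then obtain R where R: "R \<subseteq> cball 0 1" "finite R" "g ` cball 0 1 = g ` R"
    using finite_subset_image[OF _ subset_refl, of g "cball 0 1"] by blast
  obtain y where y: "bij_betw y {..<card R} R"
    using ex_bij_betw_nat_finite[OF R(2)] by (auto simp: atLeast0LessThan)
  show ?thesis
  proof
    show "norm (y k) \<le> 1" if "k < card R" for k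
      using bij_betwE[OF y] R(1) that by auto
    fix z :: 'a assume "norm z \<le> 1"
    then have "g z \<in> g ` R" using R(3) by force
    then obtain z' where z': "z' \<in> R" "g z = g z'" by auto
    then obtain k where k: "k < card R" "z' = y k" using y by (auto simp: bij_betw_def)
    have "\<bar>f i z - f i (y k)\<bar> \<le> \<eta>" if i: "i < d" for i
    proof -
      have "\<lfloor>f i z / \<eta>\<rfloor> = \<lfloor>f i (y k) / \<eta>\<rfloor>"
        using fun_cong[OF z'(2), of i] i k(2) by (simp add: g_def)
      then have "\<bar>f i z / \<eta> - f i (y k) / \<eta>\<bar> \<le> 1" by linarith
      then have "\<bar>(f i z - f i (y k)) / \<eta>\<bar> \<le> 1" by (simp add: diff_divide_distrib)
      then show ?thesis using \<eta> by (simp add: abs_divide divide_le_eq)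
    qed
    then show "\<exists>k<card R. \<forall>i<d. \<bar>f i z - f i (y k)\<bar> \<le> \<eta>" using k(1) by blast
  qed
qed

text \<open>Every vector gets weight 1/d, which admits coefficients up to 1/d since 1/d is at most
  its power with exponent 1 - 1/p. The covering sequence shrinks with \<eta>, so small boxes are
  cheap.\<close>

lemma fin_co_box:
  assumes p: "1 \<le> p" and t: "\<And>i. i < d \<Longrightarrow> \<bar>t i\<bar> \<le> \<eta>"
  shows "(\<Sum>i<d. t i *\<^sub>R b i) \<in> fin_co p d (\<lambda>i. (real d * \<eta>) *\<^sub>R b i)"
proof (cases "d = 0 \<or> \<eta> = 0")
  case True
  then have "(\<Sum>i<d. t i *\<^sub>R b i) = (\<Sum>i<d. 0 *\<^sub>R ((real d * \<eta>) *\<^sub>R b i))"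
    using t by (auto intro!: sum.neutral)
  also have "\<dots> \<in> fin_co p d (\<lambda>i. (real d * \<eta>) *\<^sub>R b i)" by (rule fin_coI[of _ "\<lambda>_. 0"]) auto
  finally show ?thesis .
next
  case False
  then have d: "0 < d" by simp
  then have \<eta>: "0 < \<eta>" using t[of 0] False abs_ge_zero[of "t 0"] by linarith
  have "(\<Sum>i<d. (t i / (d * \<eta>)) *\<^sub>R ((real d * \<eta>) *\<^sub>R b i)) \<in> fin_co p d (\<lambda>i. (real d * \<eta>) *\<^sub>R b i)"
  proof (rule fin_coI[of _ "\<lambda>_. 1 / d"])
    fix i assume i: "i < d"
    have "\<bar>t i / (d * \<eta>)\<bar> = \<bar>t i\<bar> / \<eta> / d" using \<eta> by (simp add: abs_mult)
    also have "\<dots> \<le> 1 / d" using t[OF i] \<eta> d by (intro divide_right_mono) auto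
    also have "\<dots> \<le> (1 / d) powr (1 - 1 / p)" using d by (intro le_powr_le_one[OF p]) auto
    finally show "\<bar>t i / (d * \<eta>)\<bar> \<le> (1 / d) powr (1 - 1 / p)" .
  qed (use d in auto)
  then show ?thesis using d \<eta> by simp
qed

text \<open>A finite-rank operator takes values, up to a small box spanned by finitely many vectors,
  in a finite subset of its image of the ball. Errors at finitely many points can be
  adjoined to the covering sequence, so approximating these points suffices; this is what makes
  an approximation property or local reflexivity unnecessary.\<close>

lemma fin_covered_finite_rank:
  fixes T :: "'b::real_normed_vector \<Rightarrow>\<^sub>L 'a::real_normed_vector"
  assumes p: "1 \<le> p" and T: "finite_rank T" and C0: "C0 \<in> summing_constants p (dual_op T)" and c: "C0 < c"
  shows "fin_covered p c T"
proof -
  have C00: "0 \<le> C0" using C0 by (simp add: summing_constants_iff)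
  obtain d :: nat and f :: "nat \<Rightarrow> 'b \<Rightarrow>\<^sub>L real" and b where Tf: "\<And>y. T y = (\<Sum>i<d. f i y *\<^sub>R b i)"
    using finite_rank_expansion[OF T] by metis
  define c1 where "c1 = (C0 + c) / 2"
  \<comment> \<open>Midway between \<open>c1 / c\<close> and 1: coefficient mass \<open>s\<close>
    goes to the sequence for the net points, and the rest is shared equally by the errors at these
    points and the box.\<close>
  define s where "s = (1 + c1 / c) / 2"
  have c1: "C0 < c1" "0 < c1" "c1 < c" using C00 c by (auto simp: c1_def)
  then have s: "0 < s" "s < 1" "c1 / s < c" by (auto simp: s_def field_simps)
  define \<theta> where "\<theta> = (1 - s) / 2"
  have \<theta>: "0 < \<theta>" using s by (simp add: \<theta>_def)
  have s2: "s + 2 * \<theta> \<le> 1" by (simp add: \<theta>_def field_simps)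
  \<comment> \<open>Room for p-th powers that remains after dividing the main sequence by
    \<open>s\<close>; errors and box each receive half of it.\<close>
  define gap where "gap = c powr p - (c1 / s) powr p"
  have gap: "0 < gap" using powr_less_mono2[of p "c1 / s" c] c1 s p by (simp add: gap_def)
  define B where "B = (\<Sum>i<d. norm (b i) powr p)"
  have B: "0 \<le> B" by (simp add: B_def sum_nonneg)
  define \<eta> where "\<eta> = \<theta> * (gap / (2 * (B + 1))) powr (1 / p) / (d + 1)"
  have \<eta>: "0 < \<eta>" using \<theta> gap B by (simp add: \<eta>_def)
  obtain m :: nat and y where y: "\<And>k. k < m \<Longrightarrow> norm (y k) \<le> 1"
    and net: "\<And>z. norm z \<le> 1 \<Longrightarrow> \<exists>k<m. \<forall>i<d. \<bar>f i z - f i (y k)\<bar> \<le> \<eta>"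
    using finite_net[OF \<eta>, of d f] by metis
  \<comment> \<open>There are \<open>m\<close> error vectors, so the tolerance can be fixed only
    after the net.\<close>
  define e where "e = \<theta> * (gap / (2 * (m + 1))) powr (1 / p)"
  have e: "0 < e" using \<theta> gap by (simp add: e_def)
  obtain n :: nat and x where x: "ell_norm p n (\<lambda>i. norm (x i)) \<le> c1"
    and ex: "\<forall>k<m. \<exists>z\<in>fin_co p n x. norm (T (y k) - z) \<le> e"
    by (rule dual_summing_approx[OF p C0 c1(1) _ e, where m = m and y = y])
      (rule y, assumption, rule that, assumption, assumption)
  define z where "z k = (SOME w. w \<in> fin_co p n x \<and> norm (T (y k) - w) \<le> e)" for k
  have z: "z k \<in> fin_co p n x \<and> norm (T (y k) - z k) \<le> e" if "k < m" for k
    unfolding z_def using ex that by (intro someI_ex[of "\<lambda>w. w \<in> fin_co p n x \<and> norm (T (y k) - w) \<le> e"]) blast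
  define r where "r k = T (y k) - z k" for k
  define q where "q = append_at m (\<lambda>k. r k /\<^sub>R \<theta>) (\<lambda>i. ((d * \<eta>) *\<^sub>R b i) /\<^sub>R \<theta>)"
  define v where "v = append_at n (\<lambda>i. x i /\<^sub>R s) q"
  have sum_q: "(\<Sum>i<m + d. norm (q i) powr p) \<le> gap"
  proof -
    have "(\<Sum>k<m. norm (r k /\<^sub>R \<theta>) powr p) \<le> (\<Sum>k<m. gap / (2 * (m + 1)))"
    proof (rule sum_mono)
      fix k assume "k \<in> {..<m}"
      then have "norm (r k) \<le> e" using z[of k] by (simp add: r_def)
      then have "norm (r k) / \<theta> \<le> e / \<theta>" using \<theta> by (intro divide_right_mono) auto
      also have "e / \<theta> = (gap / (2 * (m + 1))) powr (1 / p)" using \<theta> by (simp add: e_def)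
      finally have "norm (r k /\<^sub>R \<theta>) \<le> (gap / (2 * (m + 1))) powr (1 / p)"
        using \<theta> by (simp add: divide_inverse mult.commute)
      then have "norm (r k /\<^sub>R \<theta>) powr p \<le> ((gap / (2 * (m + 1))) powr (1 / p)) powr p"
        using p by (intro powr_mono2) auto
      then show "norm (r k /\<^sub>R \<theta>) powr p \<le> gap / (2 * (m + 1))"
        using gap p by (simp add: powr_powr)
    qed
    also have "\<dots> = gap / 2 * (m / (m + 1))" by (simp add: field_simps)
    also have "\<dots> \<le> gap / 2 * 1" using gap by (intro mult_left_mono) auto
    finally have 1: "(\<Sum>k<m. norm (r k /\<^sub>R \<theta>) powr p) \<le> gap / 2" by simp
    have "(\<Sum>i<d. norm (((d * \<eta>) *\<^sub>R b i) /\<^sub>R \<theta>) powr p) = (d * \<eta> / \<theta>) powr p * B"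
      using \<eta> \<theta> by (simp add: B_def sum_distrib_left powr_mult divide_inverse mult_ac)
    also have "\<dots> \<le> gap / (2 * (B + 1)) * B"
    proof (rule mult_right_mono[OF _ B])
      have "d * \<eta> / \<theta> = (gap / (2 * (B + 1))) powr (1 / p) * (d / (d + 1))"
        using \<theta> by (simp add: \<eta>_def)
      also have "\<dots> \<le> (gap / (2 * (B + 1))) powr (1 / p) * 1" by (intro mult_left_mono) auto
      finally have "(d * \<eta> / \<theta>) powr p \<le> ((gap / (2 * (B + 1))) powr (1 / p)) powr p"
        using p \<eta> \<theta> by (intro powr_mono2) auto
      then show "(d * \<eta> / \<theta>) powr p \<le> gap / (2 * (B + 1))" using gap B p by (simp add: powr_powr)
    qed
    also have "\<dots> = gap / 2 * (B / (B + 1))" by simp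
    also have "\<dots> \<le> gap / 2 * 1" using gap B by (intro mult_left_mono) auto
    finally have 2: "(\<Sum>i<d. norm (((d * \<eta>) *\<^sub>R b i) /\<^sub>R \<theta>) powr p) \<le> gap / 2" by simp
    show ?thesis
      unfolding q_def sum_append_at[where h = "\<lambda>_ r. norm r powr p"] using 1 2 by simp
  qed
  have "(\<Sum>i<n. norm (x i /\<^sub>R s) powr p) \<le> (c1 / s) powr p"
  proof -
    have "ell_norm p n (\<lambda>i. norm (x i /\<^sub>R s)) = ell_norm p n (\<lambda>i. inverse s * norm (x i))"
      using s by simp
    also have "\<dots> = inverse s * ell_norm p n (\<lambda>i. norm (x i))"
      using s p by (intro ell_norm_scale) auto
    also have "\<dots> \<le> inverse s * c1" using x s by (intro mult_left_mono) auto
    finally show ?thesis using s c1 by (subst (asm) ell_norm_le_iff[OF p]) (auto simp: divide_inverse mult.commute)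
  qed
  then have "(\<Sum>i<n + (m + d). norm (v i) powr p) \<le> c powr p"
    unfolding v_def sum_append_at[where h = "\<lambda>_ r. norm r powr p"] using sum_q by (simp add: gap_def)
  then have v: "ell_norm p (n + (m + d)) (\<lambda>i. norm (v i)) \<le> c"
    using c1 by (subst ell_norm_le_iff[OF p]) auto
  have "T u \<in> fin_co p (n + (m + d)) v" if u: "norm u \<le> 1" for u
  proof -
    obtain k where k: "k < m" "\<And>i. i < d \<Longrightarrow> \<bar>f i u - f i (y k)\<bar> \<le> \<eta>"
      using net[OF u] by blast
    have "T u = T (y k) + (T u - T (y k))" by simp
    also have "\<dots> = z k + (r k + (\<Sum>i<d. (f i u - f i (y k)) *\<^sub>R b i))"
      by (simp add: r_def Tf scaleR_diff_left sum_subtractf)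
    finally have Tu: "T u = z k + (r k + (\<Sum>i<d. (f i u - f i (y k)) *\<^sub>R b i))" .
    have "r k = (\<Sum>j<m. (if j = k then 1 else 0) *\<^sub>R r j)"
      using k(1) by (simp add: if_distrib[of "\<lambda>c. c *\<^sub>R r _"] cong: if_cong)
    also have "\<dots> \<in> fin_co p m r"
      using k(1) by (intro fin_coI[of _ "\<lambda>j. if j = k then 1 else 0"]) auto
    finally have rk: "r k \<in> fin_co p m r" .
    have bk: "(\<Sum>i<d. (f i u - f i (y k)) *\<^sub>R b i) \<in> fin_co p d (\<lambda>i. (real d * \<eta>) *\<^sub>R b i)"
      by (rule fin_co_box[OF p]) (rule k(2))
    have "r k + (\<Sum>i<d. (f i u - f i (y k)) *\<^sub>R b i)
        \<in> fin_co p (m + d) (append_at m (\<lambda>k. r k /\<^sub>R (1 / 2)) (\<lambda>i. ((real d * \<eta>) *\<^sub>R b i) /\<^sub>R (1 / 2)))" (is "_ \<in> fin_co p _ ?q2")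
      by (rule fin_co_add[OF p rk bk]) auto
    \<comment> \<open>Adding in two stages divides the inner vectors by 1/2 and then by
      \<open>2 * \<theta>\<close>, that is by \<theta>, in agreement with \<open>q\<close>.\<close>
    then have "T u \<in> fin_co p (n + (m + d)) (append_at n (\<lambda>i. x i /\<^sub>R s) (\<lambda>i. ?q2 i /\<^sub>R (2 * \<theta>)))"
      unfolding Tu using s(1) \<theta> s2 by (intro fin_co_add[OF p conjunct1[OF z[OF k(1)]]]) auto
    moreover have "(\<lambda>i. ?q2 i /\<^sub>R (2 * \<theta>)) = q"
      by (auto simp: q_def append_at_def fun_eq_iff)
    ultimately show ?thesis by (simp add: v_def)
  qed
  then have "T ` cball 0 1 \<subseteq> fin_co p (n + (m + d)) v" by auto
  with v show ?thesis unfolding fin_covered_def by blast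
qed

section \<open>Factorization of finite-rank operators\<close>

text \<open>Qualifies the l_infinity-sums as intermediate spaces for \<open>min_kernelI\<close>, and
  the space containing the quotient for \<open>complemented_copy_range\<close>.\<close>

instance bcontfun :: (metric_space, banach) banach ..

lemma factor_space_summand:
  fixes A :: "linf set"
  assumes A: "subspace A" "closed A"
  obtains i and \<pi> :: "factor_space \<Rightarrow>\<^sub>L linf"
  where "\<forall>x\<in>A. \<forall>y\<in>A. i (x + y) = i x + i y" "\<forall>x\<in>A. \<forall>c. i (c *\<^sub>R x) = c *\<^sub>R i x"
    "\<forall>x\<in>A. norm (i x) = norm x \<and> \<pi> (i x) = x" "\<forall>u. norm (\<pi> u) \<le> norm u \<and> \<pi> u \<in> A"
proof -
  have cA: "closure (span A) = A" using A by (simp add: span_eq_iff[THEN iffD2])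
  define \<pi>' where "\<pi>' u = apply_bcontfun (rep_fs u) (discrete A)" for u
  have \<pi>'_norm: "norm (\<pi>' u) \<le> norm u" for u
    by (simp add: \<pi>'_def norm_factor_space.rep_eq norm_bounded)
  have bl: "bounded_linear \<pi>'"
    by (rule bounded_linear_intro[of _ 1])
      (simp_all add: \<pi>'_norm, simp_all add: \<pi>'_def plus_factor_space.rep_eq scaleR_factor_space.rep_eq)
  define \<pi> where "\<pi> = Blinfun \<pi>'"
  have \<pi>: "\<pi> u = \<pi>' u" for u by (simp add: \<pi>_def bounded_linear_Blinfun_apply[OF bl])
  have \<pi>_A: "\<pi>' u \<in> A" for u
    using rep_fs[of u] cA by (simp add: \<pi>'_def) metis
  let ?g = "\<lambda>(x :: linf) B. if of_discrete B = A then x else 0"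
  \<comment> \<open>For x outside \<open>A\<close> the function leaves the carrier of
    \<open>factor_space\<close>, where \<open>Abs_fs\<close> is unspecified; all properties of
    \<open>i\<close> are therefore stated on \<open>A\<close>.\<close>
  define i where "i x = Abs_fs (Bcontfun (?g x))" for x
  have bc: "?g x \<in> bcontfun" for x
    by (rule bcontfun_discreteI[of _ "norm x"]) auto
  have i: "rep_fs (i x) = Bcontfun (?g x)" if "x \<in> A" for x
  proof -
    have "Bcontfun (?g x) \<in> {f. \<forall>A. apply_bcontfun f (discrete A) \<in> closure (span A)}"
      using that cA by (auto simp: Bcontfun_inverse[OF bc] discrete_inverse intro: subsetD[OF closure_subset] span_zero)
    then show ?thesis by (simp add: i_def Abs_fs_inverse)
  qed
  have ia: "apply_bcontfun (rep_fs (i x)) B = ?g x B" if "x \<in> A" for x B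
    by (simp add: i[OF that] Bcontfun_inverse[OF bc])
  have eqI: "u = v" if "\<And>B. apply_bcontfun (rep_fs u) B = apply_bcontfun (rep_fs v) B" for u v
    using that by (simp add: bcontfun_eqI rep_fs_inject[symmetric])
  show ?thesis
  proof (rule that; intro ballI allI conjI)
    show "i (x + y) = i x + i y" if "x \<in> A" "y \<in> A" for x y
      by (rule eqI) (simp add: plus_factor_space.rep_eq ia that subspace_add[OF A(1)])
    show "i (c *\<^sub>R x) = c *\<^sub>R i x" if "x \<in> A" for x c
      by (rule eqI) (simp add: scaleR_factor_space.rep_eq ia that subspace_scale[OF A(1)])
    show pi: "\<pi> (i x) = x" if "x \<in> A" for x
      by (simp add: \<pi> \<pi>'_def ia[OF that] discrete_inverse)
    show "norm (i x) = norm x" if "x \<in> A" for x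
    proof (rule antisym)
      show "norm (i x) \<le> norm x"
        unfolding norm_factor_space.rep_eq by (rule norm_bound) (simp add: ia[OF that])
      show "norm x \<le> norm (i x)"
        using \<pi>'_norm[of "i x"] pi[OF that] by (simp add: \<pi>)
    qed
    show "norm (\<pi> u) \<le> norm u" "\<pi> u \<in> A" for u by (simp_all add: \<pi> \<pi>'_norm \<pi>_A)
  qed
qed

text \<open>As \<open>complemented_copy\<close>, with the additional information that the projection takes
  values in the subspace; operators defined only on the subspace can then be composed with it.\<close>

lemma complemented_copy_range:
  fixes D :: "'a::banach set"
  assumes "countable D"
  obtains i :: "'a \<Rightarrow> factor_space" and P :: "factor_space \<Rightarrow>\<^sub>L 'a"
  where "\<forall>x\<in>closure (span D). \<forall>y\<in>closure (span D). i (x + y) = i x + i y"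
    "\<forall>x\<in>closure (span D). \<forall>c. i (c *\<^sub>R x) = c *\<^sub>R i x"
    "\<forall>x\<in>closure (span D). norm (i x) = norm x \<and> P (i x) = x"
    "\<forall>u. norm (P u) \<le> norm u \<and> P u \<in> closure (span D)"
proof -
  define G where "G = closure (span D)"
  have G: "subspace G" "closed G" unfolding G_def by (simp_all add: subspace_closure)
  obtain J :: "'a \<Rightarrow>\<^sub>L linf" where J: "\<And>x. x \<in> G \<Longrightarrow> norm (J x) = norm x"
    using isometry_into_linf[OF assms] unfolding G_def by blast
  have inj: "x = y" if "x \<in> G" "y \<in> G" "J x = J y" for x y
    using J[of "x - y"] subspace_diff[OF G(1)] that by (simp add: blinfun.bilinear_simps)
  define A where "A = J ` G"
  have "subspace A"
    unfolding A_def
    by (rule linear_subspace_image[OF _ G(1)]) (simp add: bounded_linear.linear blinfun.bounded_linear_right)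
  moreover have "complete A"
    unfolding A_def using J G
    by (intro complete_isometric_image[of 1]) (auto simp: blinfun.bounded_linear_right complete_eq_closed)
  then have "closed A" by (rule complete_imp_closed)
  ultimately obtain i and \<pi> :: "factor_space \<Rightarrow>\<^sub>L linf" where
    i: "\<forall>x\<in>A. \<forall>y\<in>A. i (x + y) = i x + i y" "\<forall>x\<in>A. \<forall>c. i (c *\<^sub>R x) = c *\<^sub>R i x"
    "\<forall>x\<in>A. norm (i x) = norm x \<and> \<pi> (i x) = x" and \<pi>: "\<forall>u. norm (\<pi> u) \<le> norm u \<and> \<pi> u \<in> A"
    by (rule factor_space_summand)
  define P' where "P' u = inv_into G J (\<pi> u)" for u
  have P'G: "P' u \<in> G" and JP': "J (P' u) = \<pi> u" for u
    using \<pi> unfolding P'_def A_def by (auto intro: inv_into_into f_inv_into_f)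
  have P'_norm: "norm (P' u) \<le> norm u" for u
    using J[OF P'G[of u], symmetric] \<pi> by (simp add: JP')
  have bl: "bounded_linear P'"
    by (rule bounded_linear_intro[of _ 1], (rule inj; simp add: P'G JP' blinfun.bilinear_simps subspace_add[OF G(1)] subspace_scale[OF G(1)])+)
      (simp add: P'_norm)
  have JA: "J x \<in> A" if "x \<in> G" for x using that by (simp add: A_def)
  note P = bounded_linear_Blinfun_apply[OF bl]
  show ?thesis
  proof (rule that[of "\<lambda>x. i (J x)" "Blinfun P'", folded G_def]; intro ballI allI conjI)
    show "Blinfun P' (i (J x)) = x" if "x \<in> G" for x
      unfolding P using i(3) JA[OF that] by (intro inj) (simp_all add: P'G that JP')
  qed (use i J JA in \<open>auto simp: blinfun.bilinear_simps P P'_norm P'G\<close>)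
qed

text \<open>Vanishing on the kernel of \<open>V\<close> makes \<open>R y\<close> depend on
  \<open>V y\<close> alone, so the images under \<open>R\<close> of preimages of a basis of the
  range of \<open>V\<close> span the range of \<open>R\<close>.\<close>

lemma finite_rank_kernel:
  fixes V :: "'a::real_normed_vector \<Rightarrow>\<^sub>L 'b::real_normed_vector" and R :: "'a \<Rightarrow>\<^sub>L 'c::real_normed_vector"
  assumes V: "finite_rank V" and ker: "\<And>y. V y = 0 \<Longrightarrow> R y = 0"
  shows "finite_rank R"
proof -
  obtain B0 where B0: "finite B0" "range V \<subseteq> span B0"
    using V unfolding finite_rank_def by blast
  obtain B where B: "B \<subseteq> range V" "independent B" "range V \<subseteq> span B"
    using maximal_independent_subset by blast
  then have "finite B" using independent_span_bound[OF B0(1), of B] B0(2) by blast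
  then obtain Y where Y: "finite Y" "B = V ` Y"
    using finite_subset_image[of B V UNIV] B(1) by blast
  have lin: "linear (blinfun_apply L)" for L :: "'a \<Rightarrow>\<^sub>L 'd::real_normed_vector"
    by (simp add: bounded_linear.linear blinfun.bounded_linear_right)
  have "range R \<subseteq> span (R ` Y)"
  proof
    fix r assume "r \<in> range R"
    then obtain y where y: "r = R y" by blast
    have "V y \<in> span (V ` Y)" using B(3) Y(2) by blast
    then obtain z where z: "z \<in> span Y" "V y = V z"
      by (auto simp: linear_span_image[OF lin])
    then have "V (y - z) = 0" by (simp add: blinfun.diff_right)
    then have "R (y - z) = 0" by (rule ker)
    then have "R y = R z" by (simp add: blinfun.diff_right)
    then show "r \<in> span (R ` Y)" using z(1) y by (simp add: linear_span_image[OF lin])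
  qed
  then show ?thesis unfolding finite_rank_def using Y(1) by blast
qed

text \<open>The quotient by the kernel of \<open>V\<close>, realized isometrically inside a space of bounded
  functions by means of functionals that norm the quotient.\<close>

lemma quotient_embedding:
  fixes V :: "'a::real_normed_vector \<Rightarrow>\<^sub>L 'b::real_normed_vector"
  obtains E :: "'a \<Rightarrow>\<^sub>L ('a discrete \<Rightarrow>\<^sub>C real)"
  where "\<forall>y. norm (E y) \<le> norm y" "\<forall>y. E y = 0 \<longleftrightarrow> V y = 0"
    "\<forall>y. \<exists>z. V z = V y \<and> norm z \<le> 2 * norm (E y)"
proof -
  define K where "K = {y. V y = 0}"
  have K: "subspace K" by (rule subspaceI) (simp_all add: K_def blinfun.bilinear_simps)
  have "closed K" unfolding K_def by (intro closed_Collect_eq continuous_intros)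
  have "\<exists>\<phi> :: 'a \<Rightarrow>\<^sub>L real. (\<forall>y. \<bar>\<phi> y\<bar> \<le> infdist y K) \<and> \<phi> z = infdist z K" for z
    by (rule separating_functional_subspace[OF K, of z]) blast
  then obtain \<Phi> :: "'a \<Rightarrow> 'a \<Rightarrow>\<^sub>L real"
    where \<Phi>: "\<And>z y. \<bar>\<Phi> z y\<bar> \<le> infdist y K" "\<And>z. \<Phi> z z = infdist z K"
    by metis
  define e :: "'a \<Rightarrow> ('a discrete \<Rightarrow>\<^sub>C real)" where "e y = Bcontfun (\<lambda>z. \<Phi> (of_discrete z) y)" for y
  have e: "apply_bcontfun (e y) z = \<Phi> (of_discrete z) y" for y z
    unfolding e_def
    by (subst Bcontfun_inverse) (auto intro!: bcontfun_discreteI[of _ "infdist y K"] simp: \<Phi>)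
  have e_norm: "norm (e y) = infdist y K" for y
  proof (rule antisym)
    show "norm (e y) \<le> infdist y K" by (rule norm_bound) (simp add: e \<Phi>)
    show "infdist y K \<le> norm (e y)"
      using norm_bounded[of "e y" "discrete y"] by (simp add: e discrete_inverse \<Phi>(2))
  qed
  have e_le: "norm (e y) \<le> norm y" for y
    unfolding e_norm using infdist_le[OF subspace_0[OF K], of y] by simp
  have bl: "bounded_linear e"
  proof (rule bounded_linear_intro[of _ 1])
    show "e (x + y) = e x + e y" "e (c *\<^sub>R x) = c *\<^sub>R e x" for x y c
      by (rule bcontfun_eqI; simp add: e blinfun.bilinear_simps)+
  qed (simp add: e_le)
  note ap = bounded_linear_Blinfun_apply[OF bl]
  have K0: "infdist y K = 0 \<longleftrightarrow> V y = 0" for y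
  proof -
    have "K \<noteq> {}" using subspace_0[OF K] by blast
    then have "y \<in> K \<longleftrightarrow> infdist y K = 0" by (rule in_closed_iff_infdist_zero[OF \<open>closed K\<close>])
    then show ?thesis by (simp add: K_def)
  qed
  show ?thesis
  proof (rule that[of "Blinfun e"]; intro allI)
    fix y
    show "norm (Blinfun e y) \<le> norm y" by (simp add: ap e_le)
    show "Blinfun e y = 0 \<longleftrightarrow> V y = 0" using e_norm[of y] K0[of y] by (simp add: ap) (metis norm_eq_zero)
    show "\<exists>z. V z = V y \<and> norm z \<le> 2 * norm (Blinfun e y)"
    proof (cases "V y = 0")
      case True
      then show ?thesis by (intro exI[of _ 0]) simp
    next
      case False
      \<comment> \<open>The distance to the kernel need not be attained; the room for a nearly
        optimal representative is the factor 2 that reappears in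
        \<open>finite_rank_factorization\<close>.\<close>
      then have "infdist y K < 2 * infdist y K" using K0[of y] infdist_nonneg[of y K] by linarith
      then obtain k where k: "k \<in> K" "dist y k < 2 * infdist y K"
        using infdist_less_obtain[of K y "2 * infdist y K"] subspace_0[OF K] by blast
      then show ?thesis
        by (intro exI[of _ "y - k"]) (simp add: ap e_norm dist_norm K_def blinfun.diff_right)
    qed
  qed
qed

lemma fin_co_subset_span: "fin_co p n x \<subseteq> span (x ` {..<n})"
  unfolding fin_co_def by (auto intro!: span_sum span_scale intro: span_base)

lemma in_subspace_of_ball:
  fixes T :: "'a::real_normed_vector \<Rightarrow>\<^sub>L 'b::real_normed_vector"
  assumes "subspace H" and "T ` cball 0 1 \<subseteq> H"
  shows "T y \<in> H"
proof (cases "y = 0")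
  case False
  have "T (y /\<^sub>R norm y) \<in> H" using assms(2) False by (auto simp: image_subset_iff)
  then have "norm y *\<^sub>R T (y /\<^sub>R norm y) \<in> H" by (rule subspace_scale[OF assms(1)])
  then show ?thesis using False by (simp add: blinfun.scaleR_right)
qed (simp add: subspace_0[OF assms(1)])

text \<open>The outer factors are contractive and of finite rank, so the size of \<open>V\<close>
  sits in the covering of the middle factor alone. This leaves the three factors free to be rescaled
  when a series is assembled.\<close>

lemma finite_rank_factorization:
  fixes V :: "'b::banach \<Rightarrow>\<^sub>L 'a::banach"
  assumes p: "1 \<le> p" and V: "finite_rank V" and cov: "fin_covered p c V"
  obtains R :: "'b \<Rightarrow>\<^sub>L factor_space" and U :: "factor_space \<Rightarrow>\<^sub>L factor_space" and S :: "factor_space \<Rightarrow>\<^sub>L 'a"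
  where "finite_rank R" "finite_rank S" "norm R \<le> 1" "norm S \<le> 1" "fin_covered p (2 * c) U"
    "\<And>y. S (U (R y)) = V y"
proof -
  obtain n x where x: "ell_norm p n (\<lambda>i. norm (x i)) \<le> c" "V ` cball 0 1 \<subseteq> fin_co p n x"
    using cov unfolding fin_covered_def by blast
  define H where "H = span (x ` {..<n})"
  have H: "subspace H" "closure H = H" unfolding H_def by (simp_all add: closed_span_finite)
  have VH: "V y \<in> H" for y
    using in_subspace_of_ball[OF H(1), of V] x(2) fin_co_subset_span[of p n x] unfolding H_def by blast
  have xH: "x i \<in> H" if "i < n" for i using that by (auto simp: H_def intro: span_base)
  have "countable (x ` {..<n})" by (simp add: countable_finite)
  then obtain j :: "'a \<Rightarrow> factor_space" and S :: "factor_space \<Rightarrow>\<^sub>L 'a" where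
    j_add: "\<forall>x\<in>H. \<forall>y\<in>H. j (x + y) = j x + j y" and j_scale: "\<forall>x\<in>H. \<forall>c. j (c *\<^sub>R x) = c *\<^sub>R j x"
    and Sj: "\<forall>x\<in>H. norm (j x) = norm x \<and> S (j x) = x" and S: "\<forall>u. norm (S u) \<le> norm u \<and> S u \<in> H"
    by (rule complemented_copy_range[of "x ` {..<n}", folded H_def, unfolded H(2)])
  have j_sum: "j (\<Sum>i<k. a i *\<^sub>R x i) = (\<Sum>i<k. a i *\<^sub>R j (x i))" if "k \<le> n" for a k
    using that
  proof (induction k)
    case 0
    have "norm (j 0) = norm (0 :: 'a)" using Sj subspace_0[OF H(1)] by blast
    then show ?case by simp
  next
    case (Suc k)
    have "(\<Sum>i<k. a i *\<^sub>R x i) \<in> H" "a k *\<^sub>R x k \<in> H"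
      using Suc.prems by (auto intro!: subspace_sum[OF H(1)] subspace_scale[OF H(1)] xH)
    then show ?case using Suc j_add j_scale xH[of k] by simp
  qed
  obtain E :: "'b \<Rightarrow>\<^sub>L ('b discrete \<Rightarrow>\<^sub>C real)"
    where E: "\<forall>y. norm (E y) \<le> norm y" "\<forall>y. E y = 0 \<longleftrightarrow> V y = 0"
    "\<forall>y. \<exists>z. V z = V y \<and> norm z \<le> 2 * norm (E y)"
    by (rule quotient_embedding)
  have EV: "V y = V z" if "E y = E z" for y z
    using E(2)[rule_format, of "y - z"] that by (simp add: blinfun.diff_right)
  have "finite_rank E" by (rule finite_rank_kernel[OF V]) (use E(2) in blast)
  then obtain D where D: "finite D" "range E \<subseteq> span D" unfolding finite_rank_def by blast
  obtain D' where D': "D' \<subseteq> range E" "independent D'" "range E \<subseteq> span D'"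
    using maximal_independent_subset by blast
  then have "finite D'" using independent_span_bound[OF D(1), of D'] D(2) by blast
  have "subspace (range E)"
    by (rule linear_subspace_image) (simp_all add: bounded_linear.linear blinfun.bounded_linear_right)
  then have "span D' = range E" using D' span_minimal by blast
  moreover have "closure (span D') = span D'" by (simp add: closed_span_finite[OF \<open>finite D'\<close>])
  \<comment> \<open>The range of \<open>E\<close> is finite-dimensional, hence closed, so it is
    exactly the subspace onto which \<open>P\<close> will project and every \<open>P u\<close> has a
    preimage under \<open>E\<close>.\<close>
  ultimately have GE: "closure (span D') = range E" by simp
  have "countable D'" using \<open>finite D'\<close> by (rule countable_finite)
  then obtain i :: "('b discrete \<Rightarrow>\<^sub>C real) \<Rightarrow> factor_space" and P :: "factor_space \<Rightarrow>\<^sub>L ('b discrete \<Rightarrow>\<^sub>C real)" where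
    i_add: "\<forall>x\<in>range E. \<forall>y\<in>range E. i (x + y) = i x + i y" and i_scale: "\<forall>x\<in>range E. \<forall>c. i (c *\<^sub>R x) = c *\<^sub>R i x"
    and Pi: "\<forall>x\<in>range E. norm (i x) = norm x \<and> P (i x) = x" and P: "\<forall>u. norm (P u) \<le> norm u \<and> P u \<in> range E"
    by (rule complemented_copy_range[of D', unfolded GE])
  have bl_R: "bounded_linear (\<lambda>y. i (E y))"
    by (rule bounded_linear_intro[of _ 1])
      (use i_add i_scale Pi E(1) in \<open>auto simp: blinfun.add_right blinfun.scaleR_right\<close>)
  define R where "R = Blinfun (\<lambda>y. i (E y))"
  have R: "R y = i (E y)" for y by (simp add: R_def bounded_linear_Blinfun_apply[OF bl_R])
  have "norm R \<le> 1" by (rule norm_blinfun_bound) (use Pi E(1) in \<open>auto simp: R\<close>)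
  have "norm S \<le> 1" by (rule norm_blinfun_bound) (use S in auto)
  have "finite_rank R"
  proof (rule finite_rank_kernel[OF V])
    fix y assume "V y = 0"
    then have "norm (R y) = norm (0 :: 'b discrete \<Rightarrow>\<^sub>C real)" using E(2) Pi by (metis R rangeI)
    then show "R y = 0" by simp
  qed
  have "finite_rank S"
    unfolding finite_rank_def using S by (intro exI[of _ "x ` {..<n}"]) (auto simp: H_def)
  \<comment> \<open>The selection need not be linear, but its composition with \<open>V\<close> is,
    since by \<open>EV\<close> the value of \<open>V\<close> depends only on that of
    \<open>E\<close>.\<close>
  define sel where "sel g = (SOME y. E y = g)" for g
  have sel: "E (sel (P u)) = P u" for u
  proof -
    have "\<exists>y. E y = P u" using P by (metis imageE)
    then show ?thesis unfolding sel_def by (rule someI_ex)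
  qed
  define W where "W u = V (sel (P u))" for u
  have W_eq: "W u = V y" if "E y = P u" for u y
    unfolding W_def by (rule EV) (simp add: sel that)
  have W_small: "\<exists>z. W u = V z \<and> norm z \<le> 2 * norm u" for u
  proof -
    obtain z where "V z = V (sel (P u))" "norm z \<le> 2 * norm (P u)"
      using E(3)[rule_format, of "sel (P u)"] unfolding sel by blast
    moreover have "norm (P u) \<le> norm u" using P by blast
    ultimately have "W u = V z" "norm z \<le> 2 * norm u" by (simp_all add: W_def)
    then show ?thesis by blast
  qed
  have bl_U: "bounded_linear (\<lambda>u. j (W u))"
  proof (rule bounded_linear_intro[of _ "2 * norm V"])
    fix u v c
    have "W (u + v) = V (sel (P u) + sel (P v))"
      by (rule W_eq) (simp add: blinfun.add_right sel)
    then show "j (W (u + v)) = j (W u) + j (W v)"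
      using j_add VH by (simp add: blinfun.add_right W_def)
    have "W (c *\<^sub>R u) = V (c *\<^sub>R sel (P u))"
      by (rule W_eq) (simp add: blinfun.scaleR_right sel)
    then show "j (W (c *\<^sub>R u)) = c *\<^sub>R j (W u)"
      using j_scale VH by (simp add: blinfun.scaleR_right W_def)
    obtain z where z: "W u = V z" "norm z \<le> 2 * norm u" using W_small by blast
    have "norm (j (W u)) = norm (V z)" using Sj VH z(1) by simp
    also have "\<dots> \<le> norm V * norm z" by (rule norm_blinfun)
    also have "\<dots> \<le> norm V * (2 * norm u)" by (intro mult_left_mono z) simp
    finally show "norm (j (W u)) \<le> norm u * (2 * norm V)" by (simp add: mult_ac)
  qed
  define U where "U = Blinfun (\<lambda>u. j (W u))"
  have U: "U u = j (W u)" for u by (simp add: U_def bounded_linear_Blinfun_apply[OF bl_U])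
  have "fin_covered p (2 * c) U"
    unfolding fin_covered_def
  proof (intro exI conjI)
    have "ell_norm p n (\<lambda>i. norm (2 *\<^sub>R j (x i))) \<le> ell_norm p n (\<lambda>i. 2 * norm (x i))"
      using Sj xH by (intro ell_norm_mono[OF p]) auto
    also have "\<dots> = 2 * ell_norm p n (\<lambda>i. norm (x i))"
      using p by (intro ell_norm_scale) auto
    finally show "ell_norm p n (\<lambda>i. norm (2 *\<^sub>R j (x i))) \<le> 2 * c" using x(1) by linarith
    show "U ` cball 0 1 \<subseteq> fin_co p n (\<lambda>i. 2 *\<^sub>R j (x i))"
    proof (rule image_subsetI)
      fix u :: factor_space assume u: "u \<in> cball 0 1"
      obtain z where z: "W u = V z" "norm z \<le> 2 * norm u" using W_small by blast
      \<comment> \<open>Here \<open>z\<close> has norm at most 2; halving it returns to the ball,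
        and the lost factor moves into the covering vectors.\<close>
      then have "V (z /\<^sub>R 2) \<in> fin_co p n x" using x(2) u by (auto simp: image_subset_iff)
      then obtain a w where a: "V (z /\<^sub>R 2) = (\<Sum>i<n. a i *\<^sub>R x i)" "\<And>i. i < n \<Longrightarrow> 0 \<le> w i"
        "\<And>i. i < n \<Longrightarrow> \<bar>a i\<bar> \<le> w i powr (1 - 1 / p)" "(\<Sum>i<n. w i) \<le> 1"
        by (rule fin_coE) blast
      have "W u = 2 *\<^sub>R V (z /\<^sub>R 2)" by (simp add: z(1) blinfun.scaleR_right)
      then have "U u = 2 *\<^sub>R j (V (z /\<^sub>R 2))" using j_scale VH by (simp add: U)
      also have "\<dots> = (\<Sum>i<n. a i *\<^sub>R (2 *\<^sub>R j (x i)))"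
        unfolding a(1) j_sum[OF order_refl] by (simp add: scaleR_sum_right mult.commute)
      also have "\<dots> \<in> fin_co p n (\<lambda>i. 2 *\<^sub>R j (x i))" using a by (intro fin_coI) auto
      finally show "U u \<in> fin_co p n (\<lambda>i. 2 *\<^sub>R j (x i))" .
    qed
  qed
  moreover have "S (U (R y)) = V y" for y
  proof -
    have "W (R y) = V y" by (rule W_eq) (use Pi in \<open>simp add: R\<close>)
    then show ?thesis using Sj VH by (simp add: U)
  qed
  ultimately show ?thesis
    using that \<open>finite_rank R\<close> \<open>finite_rank S\<close> \<open>norm R \<le> 1\<close> \<open>norm S \<le> 1\<close> by blast
qed

section \<open>Series of finite-rank operators in the minimal kernel\<close>

lemma finite_rank_sum:
  assumes "\<And>i :: nat. finite_rank (F i)"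
  shows "finite_rank (\<Sum>i<n. F i)"
proof -
  obtain B where B: "\<And>i. finite (B i)" "\<And>i. range (F i) \<subseteq> span (B i)"
    using assms unfolding finite_rank_def by metis
  have "(\<Sum>i<n. F i) y \<in> span (\<Union>i<n. B i)" for y
    unfolding blinfun.sum_left
  proof (rule span_sum)
    fix i assume "i \<in> {..<n}"
    then have "span (B i) \<subseteq> span (\<Union>i<n. B i)" by (intro span_mono) auto
    then show "F i y \<in> span (\<Union>i<n. B i)" using B(2)[of i] by blast
  qed
  then show ?thesis
    unfolding finite_rank_def using B(1) by (intro exI[of _ "\<Union>i<n. B i"]) auto
qed

lemma finite_rank_diff:
  assumes "finite_rank F" "finite_rank G"
  shows "finite_rank (F - G)"
proof -
  obtain A B where AB: "finite A" "range F \<subseteq> span A" "finite B" "range G \<subseteq> span B"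
    using assms unfolding finite_rank_def by blast
  have "(F - G) y \<in> span (A \<union> B)" for y
    using AB span_mono[of A "A \<union> B"] span_mono[of B "A \<union> B"]
    unfolding blinfun.diff_left by (intro span_diff) blast+
  then show ?thesis
    unfolding finite_rank_def using AB by (intro exI[of _ "A \<union> B"]) auto
qed

lemma approximable_sums:
  assumes "\<And>i :: nat. finite_rank (F i)" and "F sums R"
  shows "R \<in> approximable_ops"
  unfolding approximable_ops_def closure_sequential
  by (intro exI[of _ "\<lambda>n. \<Sum>i<n. F i"] conjI allI)
    (simp_all add: finite_rank_sum assms(1) assms(2)[unfolded sums_def])

lemma fin_covered_nonneg: "fin_covered p c T \<Longrightarrow> 0 \<le> c"
  unfolding fin_covered_def by (auto intro: order_trans[OF ell_norm_nonneg])

lemma norm_le_fin_covered: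
  fixes T :: "'a::real_normed_vector \<Rightarrow>\<^sub>L 'b::real_normed_vector"
  assumes p: "1 \<le> p" and "fin_covered p c T"
  shows "norm T \<le> c"
proof -
  obtain n x where x: "ell_norm p n (\<lambda>i. norm (x i)) \<le> c" "T ` cball 0 1 \<subseteq> fin_co p n x"
    using assms unfolding fin_covered_def by blast
  have ball: "norm (T y) \<le> c" if "norm y \<le> 1" for y
  proof -
    have "T y \<in> fin_co p n x" using x(2) that by (auto simp: image_subset_iff)
    then obtain a w where a: "T y = (\<Sum>i<n. a i *\<^sub>R x i)" "\<And>i. i < n \<Longrightarrow> 0 \<le> w i"
      "\<And>i. i < n \<Longrightarrow> \<bar>a i\<bar> \<le> w i powr (1 - 1 / p)" "(\<Sum>i<n. w i) \<le> 1"
      by (rule fin_coE) blast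
    have "norm (T y) \<le> (\<Sum>i<n. norm (a i *\<^sub>R x i))" unfolding a(1) by (rule norm_sum)
    also have "\<dots> \<le> (\<Sum>i<n. w i powr (1 - 1 / p) * norm (x i))"
      using a(3) by (intro sum_mono) (auto intro: mult_right_mono)
    also have "\<dots> \<le> (\<Sum>i<n. w i) powr (1 - 1 / p) * ell_norm p n (\<lambda>i. norm (x i))"
      unfolding ell_norm_def using a(2) by (intro weighted_Hoelder p) auto
    also have "\<dots> \<le> 1 * ell_norm p n (\<lambda>i. norm (x i))"
      using a(4) p sum_nonneg[of "{..<n}" w] a(2) by (intro mult_right_mono powr_le1) auto
    finally show ?thesis using x(1) by simp
  qed
  show ?thesis
  proof (rule norm_blinfun_bound)
    show "0 \<le> c" by (rule fin_covered_nonneg[OF assms(2)])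
    fix y
    show "norm (T y) \<le> c * norm y"
    proof (cases "y = 0")
      case False
      then have "norm (T (y /\<^sub>R norm y)) \<le> c" by (intro ball) simp
      then show ?thesis using False by (simp add: blinfun.scaleR_right field_simps)
    qed simp
  qed
qed

lemma fin_covered_compose:
  fixes T :: "'b::real_normed_vector \<Rightarrow>\<^sub>L 'c::real_normed_vector"
    and L :: "'c \<Rightarrow>\<^sub>L 'd::real_normed_vector" and R :: "'a::real_normed_vector \<Rightarrow>\<^sub>L 'b"
  assumes p: "1 \<le> p" and T: "fin_covered p c T" and R: "norm R \<le> 1" and L: "norm L \<le> b"
  shows "fin_covered p (b * c) (L o\<^sub>L T o\<^sub>L R)"
proof -
  have b: "0 \<le> b" using norm_ge_zero[of L] L by linarith
  obtain n x where x: "ell_norm p n (\<lambda>i. norm (x i)) \<le> c" "T ` cball 0 1 \<subseteq> fin_co p n x"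
    using T unfolding fin_covered_def by blast
  have "norm (L (x i)) \<le> b * norm (x i)" for i
    using norm_blinfun[of L "x i"] mult_right_mono[OF L norm_ge_zero[of "x i"]] by linarith
  then have "ell_norm p n (\<lambda>i. norm (L (x i))) \<le> ell_norm p n (\<lambda>i. b * norm (x i))"
    by (intro ell_norm_mono[OF p]) auto
  also have "\<dots> = b * ell_norm p n (\<lambda>i. norm (x i))" using p b by (intro ell_norm_scale) auto
  also have "\<dots> \<le> b * c" using x(1) b by (rule mult_left_mono)
  finally have 1: "ell_norm p n (\<lambda>i. norm (L (x i))) \<le> b * c" .
  have "(L o\<^sub>L T o\<^sub>L R) y \<in> fin_co p n (\<lambda>i. L (x i))" if "norm y \<le> 1" for y
  proof -
    have "norm R * norm y \<le> 1 * 1" using R that by (intro mult_mono) auto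
    then have "norm (R y) \<le> 1" using norm_blinfun[of R y] by linarith
    then have "T (R y) \<in> fin_co p n x" using x(2) by (auto simp: image_subset_iff)
    then obtain a w where a: "T (R y) = (\<Sum>i<n. a i *\<^sub>R x i)" "\<And>i. i < n \<Longrightarrow> 0 \<le> w i"
      "\<And>i. i < n \<Longrightarrow> \<bar>a i\<bar> \<le> w i powr (1 - 1 / p)" "(\<Sum>i<n. w i) \<le> 1"
      by (rule fin_coE) blast
    have "(L o\<^sub>L T o\<^sub>L R) y = (\<Sum>i<n. a i *\<^sub>R L (x i))"
      by (simp add: a(1) blinfun.sum_right blinfun.scaleR_right)
    also have "\<dots> \<in> fin_co p n (\<lambda>i. L (x i))" using a by (intro fin_coI) auto
    finally show ?thesis .
  qed
  then have "(L o\<^sub>L T o\<^sub>L R) ` cball 0 1 \<subseteq> fin_co p n (\<lambda>i. L (x i))" by auto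
  with 1 show ?thesis
    unfolding fin_covered_def by (intro exI[of _ n] exI[of _ "\<lambda>i. L (x i)"] conjI)
qed

lemma norm_blinfun_compose_le:
  assumes "norm L \<le> a" "norm R \<le> b"
  shows "norm (L o\<^sub>L R) \<le> a * b"
  by (rule order_trans[OF norm_blinfun_compose mult_mono[OF assms]])
    (use order_trans[OF norm_ge_zero assms(1)] in auto)

text \<open>The rate 1/16 pays for four factors 1/2: one for the convergence of each outer series,
  and, once the middle operators are multiplied by 4^n in compensation, one for the coefficients and
  one for the vectors in \<open>covered_suminf\<close>.\<close>

lemma min_kernel_series:
  fixes V :: "nat \<Rightarrow> 'b::banach \<Rightarrow>\<^sub>L 'a::banach"
  assumes p: "1 \<le> p" and V: "\<And>n. finite_rank (V n)"
    and cov: "\<And>n. fin_covered p (C * (1 / 16) ^ n) (V n)" and T: "V sums T"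
  shows "T \<in> min_kernel (ereal p)"
proof -
  have C: "0 \<le> C" using fin_covered_nonneg[OF cov[of 0]] by simp
  define Q where "Q n R U S \<longleftrightarrow> finite_rank R \<and> finite_rank S \<and> norm R \<le> 1 \<and> norm S \<le> 1 \<and>
      fin_covered p (2 * (C * (1 / 16) ^ n)) U \<and> (\<forall>y. S (U (R y)) = V n y)"
    for n and R :: "'b \<Rightarrow>\<^sub>L factor_space" and U :: "factor_space \<Rightarrow>\<^sub>L factor_space" and S :: "factor_space \<Rightarrow>\<^sub>L 'a"
  have "\<exists>R U S. Q n R U S" for n
    unfolding Q_def by (rule finite_rank_factorization[OF p V cov, of n]) blast
  then obtain R U S where "\<And>n. Q n (R n) (U n) (S n)" by metis
  then have R: "\<And>n. finite_rank (R n)" "\<And>n. norm (R n) \<le> 1" and S: "\<And>n. finite_rank (S n)" "\<And>n. norm (S n) \<le> 1"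
    and U: "\<And>n. fin_covered p (2 * (C * (1 / 16) ^ n)) (U n)" and SUR: "\<And>n y. S n (U n (R n y)) = V n y"
    unfolding Q_def by blast+
  define Rs :: "nat \<Rightarrow> 'b \<Rightarrow>\<^sub>L (nat discrete \<Rightarrow>\<^sub>C factor_space)"
    where "Rs n = (1 / 2) ^ n *\<^sub>R (inj_at n o\<^sub>L R n)" for n
  define Ts :: "nat \<Rightarrow> (nat discrete \<Rightarrow>\<^sub>C factor_space) \<Rightarrow>\<^sub>L (nat discrete \<Rightarrow>\<^sub>C factor_space)"
    where "Ts n = (4 ^ n *\<^sub>R inj_at n) o\<^sub>L U n o\<^sub>L proj_at n" for n
  define Ss where "Ss n = (1 / 2) ^ n *\<^sub>R (S n o\<^sub>L proj_at n)" for n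
  have geo: "summable (\<lambda>n. (1 / 2 :: real) ^ n)" by (rule summable_geometric) simp
  have "norm (Rs n) \<le> (1 / 2) ^ n" for n
    using norm_blinfun_compose_le[OF norm_inj_at R(2), of n n] by (simp add: Rs_def mult_left_le)
  then have "summable Rs" by (intro summable_comparison_test'[OF geo, of 0]) auto
  then obtain R\<^sub>0 where R\<^sub>0: "Rs sums R\<^sub>0" by (auto simp: summable_def)
  have "norm (Ss n) \<le> (1 / 2) ^ n" for n
    using norm_blinfun_compose_le[OF S(2) norm_proj_at, of n n] by (simp add: Ss_def mult_left_le)
  then have "summable Ss" by (intro summable_comparison_test'[OF geo, of 0]) auto
  then obtain S\<^sub>0 where S\<^sub>0: "Ss sums S\<^sub>0" by (auto simp: summable_def)
  have "norm (4 ^ n *\<^sub>R inj_at n :: factor_space \<Rightarrow>\<^sub>L _) \<le> 4 ^ n" for n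
    using norm_inj_at[of n] by (simp add: mult_left_le)
  then have "fin_covered p (4 ^ n * (2 * (C * (1 / 16) ^ n))) (Ts n)" for n
    unfolding Ts_def by (intro fin_covered_compose[OF p U norm_proj_at])
  \<comment> \<open>The shifted exponent \<open>Suc n\<close> makes the coefficient masses add up to
    at most one.\<close>
  also have "4 ^ n * (2 * (C * (1 / 16) ^ n)) = (1 / 2) ^ Suc n * (4 * C * (1 / 2) ^ n)" for n
  proof -
    have "(4 :: real) ^ n * (1 / 16) ^ n = (1 / 2) ^ n * (1 / 2) ^ n"
      unfolding power_mult_distrib[symmetric] by simp
    then show ?thesis by (simp add: mult_ac)
  qed
  finally have Ts: "fin_covered p ((1 / 2) ^ Suc n * (4 * C * (1 / 2) ^ n)) (Ts n)" for n .
  have half: "(\<Sum>n<M. (1 / 2 :: real) ^ n) \<le> 2" for M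
    using sum_le_suminf[OF geo, of "{..<M}"] suminf_geometric[of "1 / 2 :: real"] by simp
  have "norm (Ts n) \<le> 2 * C * (1 / 2) ^ n" for n
  proof -
    have "norm (Ts n) \<le> (1 / 2) ^ Suc n * (4 * C * (1 / 2) ^ n)" by (rule norm_le_fin_covered[OF p Ts])
    also have "\<dots> \<le> (1 / 2) * (4 * C * (1 / 2) ^ n)"
      using C by (intro mult_right_mono) (auto simp: power_le_one)
    finally show ?thesis by simp
  qed
  then have "summable Ts" by (intro summable_comparison_test'[OF summable_mult[OF geo, of "2 * C"], of 0]) auto
  then obtain T\<^sub>0 where T\<^sub>0: "Ts sums T\<^sub>0" by (auto simp: summable_def)
  have "covered p (8 * C) T\<^sub>0"
  proof (rule covered_suminf[OF p _ _ Ts _ _ T\<^sub>0])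
    show "(\<Sum>n<M. (1 / 2 :: real) ^ Suc n) \<le> 1" for M
      using half[of M] by (simp flip: sum_divide_distrib)
    show "(\<Sum>n<M. 4 * C * (1 / 2) ^ n) \<le> 8 * C" for M
      using mult_left_mono[OF half[of M], of "4 * C"] C by (simp flip: sum_distrib_left)
  qed (use C in auto)
  then have "T\<^sub>0 \<in> compact_ops p" by (rule covered_imp_compact)
  moreover have "R\<^sub>0 \<in> approximable_ops"
  proof (rule approximable_sums[OF _ R\<^sub>0])
    fix n
    have "Rs n = ((1 / 2) ^ n *\<^sub>R inj_at n) o\<^sub>L R n o\<^sub>L id_blinfun"
      by (rule blinfun_eqI) (simp add: Rs_def blinfun.scaleR_left)
    then show "finite_rank (Rs n)" using finite_rank_compose[OF R(1)] by metis
  qed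
  moreover have "S\<^sub>0 \<in> approximable_ops"
  proof (rule approximable_sums[OF _ S\<^sub>0])
    fix n
    have "Ss n = ((1 / 2) ^ n *\<^sub>R id_blinfun) o\<^sub>L S n o\<^sub>L proj_at n"
      by (rule blinfun_eqI) (simp add: Ss_def blinfun.scaleR_left)
    then show "finite_rank (Ss n)" using finite_rank_compose[OF S(1)] by metis
  qed
  ultimately have "S\<^sub>0 o\<^sub>L T\<^sub>0 o\<^sub>L R\<^sub>0 \<in> min_kernel (ereal p)"
    by (intro min_kernelI) auto
  moreover have "S\<^sub>0 o\<^sub>L T\<^sub>0 o\<^sub>L R\<^sub>0 = T"
  proof (rule blinfun_eqI)
    fix y
    have apply_sums: "(\<lambda>n. F n z) sums \<Phi> z" if "F sums \<Phi>"
      for F and \<Phi> :: "'c::real_normed_vector \<Rightarrow>\<^sub>L 'd::real_normed_vector" and z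
      using bounded_linear.sums[OF blinfun.bounded_linear_left that] .
    \<comment> \<open>Only the m-th summand reaches coordinate m, so the three series compose
      diagonally, without cross terms.\<close>
    have coordinate: "proj_at m v = g m" if "(\<lambda>n. inj_at n (g n)) sums v" for m v and g :: "nat \<Rightarrow> factor_space"
    proof -
      have "(\<lambda>n. proj_at m (inj_at n (g n))) sums proj_at m v"
        using bounded_linear.sums[OF blinfun.bounded_linear_right that] .
      moreover have "(\<lambda>n. proj_at m (inj_at n (g n))) = (\<lambda>n. if n = m then g n else 0)"
        by (auto simp: proj_inj_at simp del: proj_at_apply)
      ultimately have "(\<lambda>n. if n = m then g n else 0) sums proj_at m v" by simp
      then show ?thesis using sums_single[of m g] sums_unique2 by blast
    qed
    have "(\<lambda>n. inj_at n ((1 / 2) ^ n *\<^sub>R R n y)) sums R\<^sub>0 y"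
      using apply_sums[OF R\<^sub>0, of y] by (simp add: Rs_def blinfun.scaleR_left blinfun.scaleR_right)
    then have Ry: "proj_at m (R\<^sub>0 y) = (1 / 2) ^ m *\<^sub>R R m y" for m by (rule coordinate)
    have "(\<lambda>n. inj_at n (4 ^ n *\<^sub>R U n (proj_at n z))) sums T\<^sub>0 z" for z
      using apply_sums[OF T\<^sub>0, of z] by (simp add: Ts_def blinfun.scaleR_left blinfun.scaleR_right)
    then have Ty: "proj_at m (T\<^sub>0 z) = 4 ^ m *\<^sub>R U m (proj_at m z)" for m z by (rule coordinate)
    have "Ss n (T\<^sub>0 (R\<^sub>0 y)) = V n y" for n
    proof -
      have "Ss n (T\<^sub>0 (R\<^sub>0 y)) = (1 / 2) ^ n *\<^sub>R S n (4 ^ n *\<^sub>R U n ((1 / 2) ^ n *\<^sub>R R n y))"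
        by (simp add: Ss_def blinfun.scaleR_left Ty Ry del: proj_at_apply)
      also have "\<dots> = ((1 / 2) ^ n * 4 ^ n * (1 / 2) ^ n) *\<^sub>R V n y"
        by (simp add: blinfun.scaleR_right SUR)
      also have "(1 / 2) ^ n * 4 ^ n * (1 / 2 :: real) ^ n = 1"
        unfolding power_mult_distrib[symmetric] by simp
      finally show ?thesis by simp
    qed
    then have "(\<lambda>n. V n y) sums S\<^sub>0 (T\<^sub>0 (R\<^sub>0 y))"
      using apply_sums[OF S\<^sub>0, of "T\<^sub>0 (R\<^sub>0 y)"] by (simp only:)
    then show "(S\<^sub>0 o\<^sub>L T\<^sub>0 o\<^sub>L R\<^sub>0) y = T y"
      using sums_unique2[OF _ apply_sums[OF T, of y]] by simp
  qed
  ultimately show ?thesis by simp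
qed

section \<open>Comparison of summing norms\<close>

lemma summing_ops_ereal: "T \<in> summing_ops (ereal p) \<longleftrightarrow> summing_constants p T \<noteq> {}"
  by (simp add: summing_ops_def)

lemma pi_norm_le:
  assumes "C \<in> summing_constants p T"
  shows "pi_norm (ereal p) T \<le> C" "T \<in> summing_ops (ereal p)"
proof -
  show "pi_norm (ereal p) T \<le> C"
    unfolding pi_norm_def using assms
    by (auto intro!: cInf_lower bdd_belowI[of _ 0] simp: summing_constants_iff)
qed (use assms in \<open>auto simp: summing_ops_ereal\<close>)

lemma pi_norm_summing_constant:
  assumes "1 \<le> p" "T \<in> summing_ops (ereal p)"
  shows "pi_norm (ereal p) T \<in> summing_constants p T"
  using pi_norm_mem_summing_constants[OF assms(1)] assms(2) by (simp add: summing_ops_ereal pi_norm_def)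

lemma ereal_ge_one_cases:
  assumes "1 \<le> (p :: ereal)"
  obtains "p = \<infinity>" | p' where "p = ereal p'" "1 \<le> p'"
  using assms by (cases p) auto

lemma summing_ops_infinity [simp]: "T \<in> summing_ops \<infinity>" "pi_norm \<infinity> T = norm T"
  by (simp_all add: summing_ops_def pi_norm_def)

lemma norm_le_pi_norm:
  assumes p: "1 \<le> p" and T: "T \<in> summing_ops p"
  shows "norm T \<le> pi_norm p T"
  using p
proof (cases rule: ereal_ge_one_cases)
  case (2 p')
  then show ?thesis using norm_le_summing_constant[of p'] pi_norm_summing_constant[of p'] T by blast
qed simp

lemma pi_norm_add:
  assumes p: "1 \<le> p" and "T \<in> summing_ops p" "U \<in> summing_ops p"
  shows "T + U \<in> summing_ops p" "pi_norm p (T + U) \<le> pi_norm p T + pi_norm p U"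
proof -
  have "T + U \<in> summing_ops p \<and> pi_norm p (T + U) \<le> pi_norm p T + pi_norm p U"
    using p
  proof (cases rule: ereal_ge_one_cases)
    case (2 p')
    then show ?thesis
      using pi_norm_le[OF summing_constants_add] pi_norm_summing_constant[of p'] assms by blast
  qed (simp add: norm_triangle_ineq)
  then show "T + U \<in> summing_ops p" "pi_norm p (T + U) \<le> pi_norm p T + pi_norm p U" by auto
qed

lemma pi_norm_scaleR:
  assumes p: "1 \<le> p" and "T \<in> summing_ops p"
  shows "c *\<^sub>R T \<in> summing_ops p" "pi_norm p (c *\<^sub>R T) \<le> \<bar>c\<bar> * pi_norm p T"
proof -
  have "c *\<^sub>R T \<in> summing_ops p \<and> pi_norm p (c *\<^sub>R T) \<le> \<bar>c\<bar> * pi_norm p T"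
    using p
  proof (cases rule: ereal_ge_one_cases)
    case (2 p')
    then show ?thesis
      using pi_norm_le[OF summing_constants_scaleR] pi_norm_summing_constant[of p'] assms by blast
  qed simp
  then show "c *\<^sub>R T \<in> summing_ops p" "pi_norm p (c *\<^sub>R T) \<le> \<bar>c\<bar> * pi_norm p T" by auto
qed

lemma pi_norm_diff:
  assumes p: "1 \<le> p" and "T \<in> summing_ops p" "U \<in> summing_ops p"
  shows "T - U \<in> summing_ops p" "pi_norm p (T - U) \<le> pi_norm p T + pi_norm p U"
  using pi_norm_add[OF p assms(2) pi_norm_scaleR(1)[OF p assms(3), of "- 1"]]
    pi_norm_scaleR(2)[OF p assms(3), of "- 1"] by auto

lemma pi_norm_limit:
  assumes p: "1 \<le> p" and F: "\<And>k. F k \<in> summing_ops p" "\<And>k. pi_norm p (F k) \<le> C" and lim: "F \<longlonglongrightarrow> T"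
  shows "T \<in> summing_ops p" "pi_norm p T \<le> C"
proof -
  have "T \<in> summing_ops p \<and> pi_norm p T \<le> C"
    using p
  proof (cases rule: ereal_ge_one_cases)
    case 1
    have "norm T \<le> C"
      using tendsto_norm[OF lim] by (rule LIMSEQ_le_const2) (use F(2) 1 in auto)
    then show ?thesis using 1 by simp
  next
    case (2 p')
    have "C \<in> summing_constants p' (F k)" for k
      using F 2 pi_norm_summing_constant[OF 2(2)] summing_constants_mono[OF 2(2)] by blast
    then have "C \<in> summing_constants p' T" using summing_constants_limit[OF 2(2) _ lim] by blast
    then show ?thesis using pi_norm_le 2(1) by blast
  qed
  then show "T \<in> summing_ops p" "pi_norm p T \<le> C" by auto
qed

lemma zero_summing_ops:
  assumes "1 \<le> p"
  shows "(0 :: 'a::real_normed_vector \<Rightarrow>\<^sub>L 'b::real_normed_vector) \<in> summing_ops p"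
    and "pi_norm p (0 :: 'a \<Rightarrow>\<^sub>L 'b) = 0"
proof -
  let ?z = "0 :: 'a \<Rightarrow>\<^sub>L 'b"
  have z: "?z \<in> summing_ops p \<and> pi_norm p ?z \<le> 0"
    using assms
  proof (cases rule: ereal_ge_one_cases)
    case (2 p')
    have "0 \<in> summing_constants p' ?z"
      using 2 by (simp add: summing_constants_iff ell_norm_def)
    then show ?thesis using pi_norm_le 2(1) by blast
  qed simp
  then show "?z \<in> summing_ops p" by blast
  then have "0 \<le> pi_norm p ?z" using norm_le_pi_norm[OF assms, of ?z] by simp
  then show "pi_norm p ?z = 0" using z by linarith
qed

text \<open>The gliding argument of A. Sokal's elementary proof of the uniform boundedness theorem,
  for a family of seminorms that are dominated by the complete norm \<open>pi_norm p\<close> on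
  \<open>summing_ops p\<close>.\<close>

lemma summing_ops_uniform_bound:
  fixes g :: "'i \<Rightarrow> ('a::real_normed_vector \<Rightarrow>\<^sub>L 'b::banach) \<Rightarrow> real"
  assumes p: "1 \<le> p"
    and g0: "\<And>i T. 0 \<le> g i T" and g_add: "\<And>i T U. g i (T + U) \<le> g i T + g i U"
    and g_scale: "\<And>i c T. g i (c *\<^sub>R T) = \<bar>c\<bar> * g i T"
    and g_bound: "\<And>i T. g i T \<le> K i * norm T"
    and pointwise: "\<And>T. T \<in> summing_ops p \<Longrightarrow> \<exists>C. \<forall>i. g i T \<le> C"
  shows "\<exists>A>0. \<forall>T\<in>summing_ops p. \<forall>i. g i T \<le> A * pi_norm p T"
proof (rule ccontr)
  assume contra: "\<not> ?thesis"
  define B where "B = {T :: 'a \<Rightarrow>\<^sub>L 'b. T \<in> summing_ops p \<and> pi_norm p T \<le> 1}"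
  define G where "G i = (SUP T\<in>B. g i T)" for i
  have B0: "0 \<in> B" by (simp add: B_def zero_summing_ops[OF p])
  have "g i T \<le> \<bar>K i\<bar>" if "T \<in> B" for i T
  proof -
    have "norm T \<le> 1" using that norm_le_pi_norm[OF p, of T] by (auto simp: B_def)
    then have "\<bar>K i\<bar> * norm T \<le> \<bar>K i\<bar> * 1" by (intro mult_left_mono) auto
    moreover have "K i * norm T \<le> \<bar>K i\<bar> * norm T" by (intro mult_right_mono) auto
    ultimately show ?thesis using g_bound[of i T] by linarith
  qed
  then have "bdd_above (g i ` B)" for i by (intro bdd_aboveI2) auto
  then have gG: "g i T \<le> G i" if "T \<in> B" for i T
    unfolding G_def using that by (intro cSUP_upper) auto
  have G0: "0 \<le> G i" for i using g0[of i 0] gG[OF B0, of i] by linarith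
  have gG': "g i T \<le> G i * c" if T: "T \<in> summing_ops p" "pi_norm p T \<le> c" "0 < c" for i T c
  proof -
    have "pi_norm p (inverse c *\<^sub>R T) \<le> \<bar>inverse c\<bar> * pi_norm p T" by (rule pi_norm_scaleR[OF p T(1)])
    also have "\<dots> \<le> \<bar>inverse c\<bar> * c" using T by (intro mult_left_mono) auto
    finally have "inverse c *\<^sub>R T \<in> B" using pi_norm_scaleR(1)[OF p T(1)] T(3) by (simp add: B_def)
    from gG[OF this, of i] show ?thesis using T(3) by (simp add: g_scale field_simps)
  qed
  \<comment> \<open>Without a common bound the suprema \<open>G\<close> are unbounded; indices are
    picked along which they outgrow the step lengths 3^(-n) used below.\<close>
  have "\<exists>i. 4 ^ n < G i" for n :: nat
  proof -
    obtain T i where T: "T \<in> summing_ops p" "4 ^ n * pi_norm p T < g i T"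
      using contra by (metis not_le zero_less_numeral zero_less_power)
    have "0 < pi_norm p T"
    proof (rule ccontr)
      assume "\<not> 0 < pi_norm p T"
      then have "norm T \<le> 0" using norm_le_pi_norm[OF p T(1)] by linarith
      then have "T = 0" by simp
      then show False using g_scale[of i 0 T] T(2) by (simp add: zero_summing_ops[OF p])
    qed
    then have "g i T \<le> G i * pi_norm p T" using gG'[OF T(1) order_refl] by blast
    then have "4 ^ n * pi_norm p T < G i * pi_norm p T" using T(2) by linarith
    then show ?thesis using \<open>0 < pi_norm p T\<close> by auto
  qed
  then obtain i where i: "\<And>n. 4 ^ n < G (i n)" by metis
  have Gpos: "0 < G (i n)" for n
    using i[of n] zero_less_power[of "4 :: real" n] by linarith
  have "\<exists>T\<in>B. 3 / 4 * G (i n) < g (i n) T" for n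
  proof (rule ccontr)
    assume "\<not> ?thesis"
    then have "G (i n) \<le> 3 / 4 * G (i n)"
      using B0 unfolding G_def by (intro cSUP_least) (auto simp: not_less)
    then show False using Gpos[of n] by simp
  qed
  then obtain U where UB: "\<And>n. U n \<in> B" and gU: "\<And>n. 3 / 4 * G (i n) < g (i n) (U n)" by metis
  \<comment> \<open>Moving by u or by -u, one of the two makes the seminorm at least that of u,
    since twice u is the difference of the two candidates. With steps (1/3)^n, all later steps
    together have at most half the length of the current one.\<close>
  define S where "S = rec_nat 0 (\<lambda>n t. if g (i n) (t - (1 / 3) ^ n *\<^sub>R U n) \<le> g (i n) (t + (1 / 3) ^ n *\<^sub>R U n)
      then t + (1 / 3) ^ n *\<^sub>R U n else t - (1 / 3) ^ n *\<^sub>R U n)"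
  have S_Suc: "S (Suc n) = (if g (i n) (S n - (1 / 3) ^ n *\<^sub>R U n) \<le> g (i n) (S n + (1 / 3) ^ n *\<^sub>R U n)
      then S n + (1 / 3) ^ n *\<^sub>R U n else S n - (1 / 3) ^ n *\<^sub>R U n)" for n
    by (simp add: S_def)
  have gS: "(1 / 3) ^ n * (3 / 4 * G (i n)) \<le> g (i n) (S (Suc n))" for n
  proof -
    let ?u = "(1 / 3 :: real) ^ n *\<^sub>R U n"
    have "2 * g (i n) ?u = g (i n) (2 *\<^sub>R ?u)" by (simp only: g_scale)
    also have "2 *\<^sub>R ?u = (S n + ?u) + (- 1) *\<^sub>R (S n - ?u)" by (subst scaleR_2) simp
    also have "g (i n) \<dots> \<le> g (i n) (S n + ?u) + \<bar>- 1\<bar> * g (i n) (S n - ?u)"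
      using g_add g_scale by metis
    finally have "g (i n) ?u \<le> g (i n) (S (Suc n))" unfolding S_Suc by auto
    moreover have "g (i n) ?u = (1 / 3) ^ n * g (i n) (U n)" by (simp add: g_scale)
    moreover have "(1 / 3) ^ n * (3 / 4 * G (i n)) \<le> (1 / 3) ^ n * g (i n) (U n)"
      using gU[of n] by (intro mult_left_mono) auto
    ultimately show ?thesis by linarith
  qed
  define W where "W n = S (Suc n) - S n" for n
  have W: "W n \<in> summing_ops p" "pi_norm p (W n) \<le> (1 / 3) ^ n" for n
  proof -
    have U: "U n \<in> summing_ops p" "pi_norm p (U n) \<le> 1" using UB[of n] by (auto simp: B_def)
    have "W n = (1 / 3) ^ n *\<^sub>R U n \<or> W n = (- ((1 / 3) ^ n)) *\<^sub>R U n"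
      by (simp add: W_def S_Suc)
    moreover have "\<bar>(1 / 3 :: real) ^ n\<bar> = (1 / 3) ^ n" "\<bar>- ((1 / 3 :: real) ^ n)\<bar> = (1 / 3) ^ n"
      by simp_all
    ultimately obtain c where c: "W n = c *\<^sub>R U n" "\<bar>c\<bar> = (1 / 3) ^ n" by metis
    show "W n \<in> summing_ops p" unfolding c(1) by (rule pi_norm_scaleR(1)[OF p U(1)])
    have "pi_norm p (W n) \<le> \<bar>c\<bar> * pi_norm p (U n)" unfolding c(1) by (rule pi_norm_scaleR(2)[OF p U(1)])
    also have "\<dots> \<le> \<bar>c\<bar> * 1" using U(2) by (intro mult_left_mono) auto
    finally show "pi_norm p (W n) \<le> (1 / 3) ^ n" using c(2) by simp
  qed
  have tail: "S (n + k) - S n \<in> summing_ops p \<and> pi_norm p (S (n + k) - S n) \<le> 3 / 2 * (1 / 3) ^ n * (1 - (1 / 3) ^ k)" for n k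
  proof (induction k)
    case 0
    then show ?case by (simp add: zero_summing_ops[OF p])
  next
    case (Suc k)
    have e: "S (n + Suc k) - S n = (S (n + k) - S n) + W (n + k)" by (simp add: W_def)
    have "pi_norm p (S (n + Suc k) - S n) \<le> 3 / 2 * (1 / 3) ^ n * (1 - (1 / 3) ^ k) + (1 / 3) ^ (n + k)"
      unfolding e
      by (rule order_trans[OF pi_norm_add(2)[OF p conjunct1[OF Suc.IH] W(1)]])
        (intro add_mono conjunct2[OF Suc.IH] W(2))
    also have "\<dots> = 3 / 2 * (1 / 3) ^ n * (1 - (1 / 3) ^ Suc k)"
    proof -
      have "3 / 2 * a * (1 - b) + a * b = 3 / 2 * a * (1 - 1 / 3 * b)" for a b :: real
        by (simp add: field_simps)
      then show ?thesis by (simp only: power_add power_Suc)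
    qed
    finally show ?case unfolding e using pi_norm_add(1)[OF p _ W(1)] Suc.IH by blast
  qed
  have tail': "pi_norm p (S (n + k) - S n) \<le> 3 / 2 * (1 / 3) ^ n" for n k
  proof -
    have "3 / 2 * (1 / 3) ^ n * (1 - (1 / 3) ^ k) \<le> 3 / 2 * (1 / 3 :: real) ^ n * 1" by (intro mult_left_mono) auto
    then show ?thesis using tail[of n k] by linarith
  qed
  have "summable W"
  proof (rule summable_comparison_test'[of "\<lambda>n. (1 / 3) ^ n" 0])
    show "norm (W n) \<le> (1 / 3) ^ n" for n using norm_le_pi_norm[OF p W(1)] W(2) order_trans by blast
  qed (simp add: summable_geometric)
  then obtain T where "W sums T" by (auto simp: summable_def)
  moreover have "(\<Sum>k<n. W k) = S n" for n
    using sum_lessThan_telescope[of S n] by (simp add: W_def S_def)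
  ultimately have S_lim: "S \<longlonglongrightarrow> T" by (simp add: sums_def)
  \<comment> \<open>Convergence is known in operator norm only; \<open>pi_norm_limit\<close> carries
    the bounds in the summing norm to the limit, which is where completeness enters.\<close>
  have T_tail: "T - S n \<in> summing_ops p \<and> pi_norm p (T - S n) \<le> 3 / 2 * (1 / 3) ^ n" for n
  proof -
    have "(\<lambda>k. S (k + n)) \<longlonglongrightarrow> T" using S_lim by (rule LIMSEQ_ignore_initial_segment)
    then have "(\<lambda>k. S (n + k) - S n) \<longlonglongrightarrow> T - S n" by (intro tendsto_diff) (simp_all add: add.commute)
    then show ?thesis
      using pi_norm_limit[OF p conjunct1[OF tail] tail', of n "\<lambda>k. k" "T - S n"] by simp
  qed
  have "T \<in> summing_ops p" using T_tail[of 0] by (simp add: S_def)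
  then obtain C where C: "\<And>i. g i T \<le> C" using pointwise by blast
  \<comment> \<open>The gain 3/4 exceeds the tail loss 1/2, so a quarter of
    \<open>(1 / 3) ^ n * G (i n)\<close> survives, and \<open>G (i n) > 4 ^ n\<close> lets it grow
    without bound.\<close>
  have lower: "(4 / 3) ^ n / 4 \<le> C" for n
  proof -
    have "g (i n) (S (Suc n)) \<le> g (i n) T + g (i n) (T - S (Suc n))"
      using g_add[of "i n" T "(- 1) *\<^sub>R (T - S (Suc n))"] g_scale[of "i n" "- 1" "T - S (Suc n)"] by simp
    moreover have "g (i n) (T - S (Suc n)) \<le> G (i n) * (3 / 2 * (1 / 3) ^ Suc n)"
      using T_tail[of "Suc n"] by (intro gG') auto
    moreover have "(1 / 3) ^ n * (3 / 4 * G (i n)) = 3 / 4 * ((1 / 3) ^ n * G (i n))"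
      "G (i n) * (3 / 2 * (1 / 3) ^ Suc n) = 1 / 2 * ((1 / 3) ^ n * G (i n))" by simp_all
    ultimately have "(1 / 3) ^ n * G (i n) / 4 \<le> C" using gS[of n] C[of "i n"] by linarith
    moreover have "(1 / 3) ^ n * (4 :: real) ^ n \<le> (1 / 3) ^ n * G (i n)"
      using i[of n] by (intro mult_left_mono) auto
    moreover have "(1 / 3) ^ n * (4 :: real) ^ n = (4 / 3) ^ n" unfolding power_mult_distrib[symmetric] by simp
    ultimately show ?thesis by linarith
  qed
  obtain n where "4 * C < (4 / 3 :: real) ^ n" using real_arch_pow[of "4 / 3" "4 * C"] by auto
  then show False using lower[of n] by simp
qed

section \<open>From an inclusion of operator classes to a norm inequality\<close>

lemma weak_lp_norm_scaleR:
  fixes z :: "nat \<Rightarrow> 'a::real_normed_vector"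
  assumes q: "1 \<le> q" and s: "0 \<le> s"
  shows "weak_lp_norm q n (\<lambda>k. s *\<^sub>R z k) \<le> s * weak_lp_norm q n z"
proof (rule weak_lp_norm_le)
  fix \<phi> :: "'a \<Rightarrow>\<^sub>L real" assume \<phi>: "norm \<phi> \<le> 1"
  have "ell_norm q n (\<lambda>i. \<bar>\<phi> (s *\<^sub>R z i)\<bar>) = s * ell_norm q n (\<lambda>i. \<bar>\<phi> (z i)\<bar>)"
    using q s by (simp add: blinfun.scaleR_right abs_mult ell_norm_scale)
  also have "\<dots> \<le> s * weak_lp_norm q n z"
    by (intro mult_left_mono ell_norm_le_weak_lp_norm q \<phi> s)
  finally show "ell_norm q n (\<lambda>i. \<bar>\<phi> (s *\<^sub>R z i)\<bar>) \<le> s * weak_lp_norm q n z" .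
qed

text \<open>The seminorms are the strong norms of the images of finite tuples in the weak unit ball.
  The inclusion makes every operator of the smaller class q-summing, so they are pointwise bounded
  there, and a uniform bound is a bound on the q-summing norm.\<close>

lemma summing_ops_norm_comparison:
  fixes p :: ereal and q :: real
  assumes p: "1 \<le> p" and q: "1 \<le> q"
    and sub: "(summing_ops p :: ('a::real_normed_vector \<Rightarrow>\<^sub>L 'b::banach) set) \<subseteq> summing_ops (ereal q)"
  obtains A where "0 < A" "\<And>T :: 'a \<Rightarrow>\<^sub>L 'b. T \<in> summing_ops p \<Longrightarrow> pi_norm (ereal q) T \<le> A * pi_norm p T"
proof -
  \<comment> \<open>Tuples outside the weak unit ball are replaced by zero, so that all pairs may
    serve as indices.\<close>
  define x where "x i k = (if weak_lp_norm q (fst i) (snd i) \<le> 1 then snd i k else 0)"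
    for i :: "nat \<times> (nat \<Rightarrow> 'a)" and k
  define g where "g i T = ell_norm q (fst i) (\<lambda>k. norm (blinfun_apply T (x i k)))"
    for i and T :: "'a \<Rightarrow>\<^sub>L 'b"
  have "\<exists>A>0. \<forall>T\<in>summing_ops p. \<forall>i. g i T \<le> A * pi_norm p T"
  proof (rule summing_ops_uniform_bound[OF p])
    fix i and T U :: "'a \<Rightarrow>\<^sub>L 'b" and c
    show "0 \<le> g i T" by (simp add: g_def)
    have "g i (T + U) \<le> ell_norm q (fst i) (\<lambda>k. norm (T (x i k)) + norm (U (x i k)))"
      unfolding g_def by (intro ell_norm_mono[OF q]) (auto simp: blinfun.add_left norm_triangle_ineq)
    also have "\<dots> \<le> g i T + g i U" unfolding g_def by (intro ell_norm_triangle[OF q]) auto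
    finally show "g i (T + U) \<le> g i T + g i U" .
    show "g i (c *\<^sub>R T) = \<bar>c\<bar> * g i T"
      unfolding g_def blinfun.scaleR_left norm_scaleR by (intro ell_norm_scale[OF q]) auto
    have "g i T \<le> ell_norm q (fst i) (\<lambda>k. norm T * norm (x i k))"
      unfolding g_def by (intro ell_norm_mono[OF q] norm_blinfun) auto
    also have "\<dots> = norm T * ell_norm q (fst i) (\<lambda>k. norm (x i k))" by (intro ell_norm_scale[OF q]) auto
    finally show "g i T \<le> ell_norm q (fst i) (\<lambda>k. norm (x i k)) * norm T" by (simp add: mult.commute)
  next
    fix T :: "'a \<Rightarrow>\<^sub>L 'b" assume "T \<in> summing_ops p"
    then have "T \<in> summing_ops (ereal q)" using sub by blast
    then obtain C where C: "C \<in> summing_constants q T" by (auto simp: summing_ops_ereal)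
    have "g i T \<le> C" for i
    proof (cases "weak_lp_norm q (fst i) (snd i) \<le> 1")
      case True
      have "g i T \<le> C * weak_lp_norm q (fst i) (snd i)"
        using C True by (simp add: g_def x_def summing_constants_iff)
      also have "\<dots> \<le> C * 1" using True C by (intro mult_left_mono) (auto simp: summing_constants_iff)
      finally show ?thesis by simp
    next
      case False
      then show ?thesis using C by (simp add: g_def x_def ell_norm_def summing_constants_iff)
    qed
    then show "\<exists>C. \<forall>i. g i T \<le> C" by blast
  qed
  then obtain A where A: "0 < A" "\<And>T i. T \<in> summing_ops p \<Longrightarrow> g i T \<le> A * pi_norm p T" by blast
  have "A * pi_norm p T \<in> summing_constants q T" if T: "T \<in> summing_ops p" for T :: "'a \<Rightarrow>\<^sub>L 'b"
    unfolding summing_constants_iff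
  proof (intro conjI allI)
    have pi0: "0 \<le> pi_norm p T" using norm_le_pi_norm[OF p T] norm_ge_zero[of T] by linarith
    then show "0 \<le> A * pi_norm p T" using A(1) by simp
    fix n and z :: "nat \<Rightarrow> 'a"
    let ?W = "weak_lp_norm q n z"
    have W0: "0 \<le> ?W" by (rule weak_lp_norm_nonneg[OF q])
    show "ell_norm q n (\<lambda>i. norm (T (z i))) \<le> A * pi_norm p T * ?W"
    proof (rule field_le_epsilon)
      fix e :: real assume e: "0 < e"
      \<comment> \<open>The weak norm may vanish, so tuples are normalized by
        \<open>?W + \<epsilon>\<close>, with \<epsilon> small enough to cost at most
        \<open>e\<close>.\<close>
      define \<epsilon> where "\<epsilon> = e / (A * pi_norm p T + 1)"
      have D: "0 \<le> A * pi_norm p T" using A(1) pi0 by simp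
      have "A * pi_norm p T * \<epsilon> = e * (A * pi_norm p T / (A * pi_norm p T + 1))" by (simp add: \<epsilon>_def)
      also have "\<dots> \<le> e * 1" using e D by (intro mult_left_mono) auto
      finally have \<epsilon>: "0 < \<epsilon>" "A * pi_norm p T * \<epsilon> \<le> e"
        using e D by (auto simp: \<epsilon>_def)
      define s where "s = inverse (?W + \<epsilon>)"
      have s: "0 < s" "s * ?W \<le> 1" "s * (?W + \<epsilon>) = 1" using W0 \<epsilon>(1) by (auto simp: s_def field_simps)
      have "weak_lp_norm q n (\<lambda>k. s *\<^sub>R z k) \<le> s * ?W"
        using weak_lp_norm_scaleR[OF q less_imp_le[OF s(1)]] .
      then have "weak_lp_norm q n (\<lambda>k. s *\<^sub>R z k) \<le> 1" using s(2) by linarith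
      then have "g (n, \<lambda>k. s *\<^sub>R z k) T = s * ell_norm q n (\<lambda>k. norm (T (z k)))"
        using q s(1) by (simp add: g_def x_def blinfun.scaleR_right ell_norm_scale)
      then have "s * ell_norm q n (\<lambda>k. norm (T (z k))) \<le> A * pi_norm p T"
        using A(2)[OF T, of "(n, \<lambda>k. s *\<^sub>R z k)"] by simp
      then have "s * ell_norm q n (\<lambda>k. norm (T (z k))) * (?W + \<epsilon>) \<le> A * pi_norm p T * (?W + \<epsilon>)"
        using W0 \<epsilon>(1) by (intro mult_right_mono) auto
      moreover have "s * ell_norm q n (\<lambda>k. norm (T (z k))) * (?W + \<epsilon>) = ell_norm q n (\<lambda>k. norm (T (z k)))"
        using s(3) by (metis mult.assoc mult.commute mult_1)
      ultimately show "ell_norm q n (\<lambda>i. norm (T (z i))) \<le> A * pi_norm p T * ?W + e"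
        using \<epsilon>(2) by (simp add: distrib_left)
    qed
  qed
  then show ?thesis using that[OF A(1)] pi_norm_le(1) by blast
qed

section \<open>Comparison of minimal kernels\<close>

lemma approximable_ops_iff:
  "T \<in> approximable_ops \<longleftrightarrow> (\<exists>F. (\<forall>n :: nat. finite_rank (F n)) \<and> F \<longlonglongrightarrow> T)"
  by (simp add: approximable_ops_def closure_sequential)

lemma weak_lp_norm_image:
  fixes B :: "'a::real_normed_vector \<Rightarrow>\<^sub>L 'b::real_normed_vector"
  assumes q: "1 \<le> q"
  shows "weak_lp_norm q n (\<lambda>k. B (x k)) \<le> norm B * weak_lp_norm q n x"
proof (rule weak_lp_norm_le)
  fix \<phi> :: "'b \<Rightarrow>\<^sub>L real" assume \<phi>: "norm \<phi> \<le> 1"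
  show "ell_norm q n (\<lambda>i. \<bar>\<phi> (B (x i))\<bar>) \<le> norm B * weak_lp_norm q n x"
  proof (cases "B = 0")
    case False
    define \<psi> where "\<psi> = inverse (norm B) *\<^sub>R (\<phi> o\<^sub>L B)"
    have "norm (\<phi> o\<^sub>L B) \<le> 1 * norm B"
      using norm_blinfun_compose[of \<phi> B] mult_right_mono[OF \<phi>, of "norm B"] by simp
    then have \<psi>: "norm \<psi> \<le> 1" using False by (simp add: \<psi>_def field_simps)
    have "\<bar>\<phi> (B z)\<bar> = norm B * \<bar>\<psi> z\<bar>" for z
      using False by (simp add: \<psi>_def blinfun.scaleR_left abs_mult)
    then have "ell_norm q n (\<lambda>i. \<bar>\<phi> (B (x i))\<bar>) = norm B * ell_norm q n (\<lambda>i. \<bar>\<psi> (x i)\<bar>)"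
      using q by (simp add: ell_norm_scale)
    also have "\<dots> \<le> norm B * weak_lp_norm q n x"
      by (intro mult_left_mono ell_norm_le_weak_lp_norm q \<psi>) simp
    finally show ?thesis .
  qed (simp add: ell_norm_def)
qed

lemma summing_constants_compose:
  fixes B :: "'a::real_normed_vector \<Rightarrow>\<^sub>L 'b::real_normed_vector" and T :: "'b \<Rightarrow>\<^sub>L 'c::real_normed_vector"
    and A :: "'c \<Rightarrow>\<^sub>L 'd::real_normed_vector"
  assumes q: "1 \<le> q" and T: "C \<in> summing_constants q T"
  shows "norm A * C * norm B \<in> summing_constants q (A o\<^sub>L T o\<^sub>L B)"
  unfolding summing_constants_iff
proof (intro conjI allI)
  have C: "0 \<le> C" using T by (simp add: summing_constants_iff)
  then show "0 \<le> norm A * C * norm B" by simp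
  fix n x
  have "ell_norm q n (\<lambda>i. norm ((A o\<^sub>L T o\<^sub>L B) (x i))) \<le> ell_norm q n (\<lambda>i. norm A * norm (T (B (x i))))"
    by (intro ell_norm_mono[OF q]) (auto simp: norm_blinfun)
  also have "\<dots> = norm A * ell_norm q n (\<lambda>i. norm (T (B (x i))))" by (intro ell_norm_scale[OF q]) auto
  also have "\<dots> \<le> norm A * (C * weak_lp_norm q n (\<lambda>i. B (x i)))"
    using T by (intro mult_left_mono) (auto simp: summing_constants_iff)
  also have "\<dots> \<le> norm A * (C * (norm B * weak_lp_norm q n x))"
    by (intro mult_left_mono weak_lp_norm_image q C) simp
  finally show "ell_norm q n (\<lambda>i. norm ((A o\<^sub>L T o\<^sub>L B) (x i))) \<le> norm A * C * norm B * weak_lp_norm q n x"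
    by (simp add: mult_ac)
qed

lemma summing_constants_dual_compose:
  fixes T :: "'b::real_normed_vector \<Rightarrow>\<^sub>L 'c::real_normed_vector"
    and L :: "'c \<Rightarrow>\<^sub>L 'd::real_normed_vector" and R :: "'a::real_normed_vector \<Rightarrow>\<^sub>L 'b"
  assumes q: "1 \<le> q" and T: "C \<in> summing_constants q (dual_op T)"
  shows "norm R * C * norm L \<in> summing_constants q (dual_op (L o\<^sub>L T o\<^sub>L R))"
proof -
  have "dual_op (L o\<^sub>L T o\<^sub>L R) = dual_op R o\<^sub>L dual_op T o\<^sub>L dual_op L"
    by (rule blinfun_eqI, rule blinfun_eqI) simp
  then have "norm (dual_op R) * C * norm (dual_op L) \<in> summing_constants q (dual_op (L o\<^sub>L T o\<^sub>L R))"
    using summing_constants_compose[OF q T] by metis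
  moreover have "norm (dual_op R) * C * norm (dual_op L) \<le> norm R * C * norm L"
    using T by (intro mult_mono norm_dual_op_le) (auto simp: summing_constants_iff)
  ultimately show ?thesis by (rule summing_constants_mono[OF q])
qed

lemma compact_ops_compose:
  fixes T :: "'b::real_normed_vector \<Rightarrow>\<^sub>L 'c::real_normed_vector"
    and L :: "'c \<Rightarrow>\<^sub>L 'd::real_normed_vector" and R :: "'a::real_normed_vector \<Rightarrow>\<^sub>L 'b"
  assumes p: "1 \<le> p" and T: "T \<in> compact_ops p"
  shows "L o\<^sub>L T o\<^sub>L R \<in> compact_ops p"
proof -
  obtain x where x: "x \<in> lp p" "T ` cball 0 1 \<subseteq> p_co p x" using T unfolding compact_ops_def by blast
  \<comment> \<open>\<open>norm R\<close> is absorbed into the vectors because the coefficients must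
    stay in the ball.\<close>
  define z where "z n = norm R *\<^sub>R L (x n)" for n
  have "z \<in> lp p"
    unfolding lp_def mem_Collect_eq
  proof (rule summable_comparison_test'[of _ 0])
    show "summable (\<lambda>n. (norm R * norm L) powr p * norm (x n) powr p)"
      using x(1) by (intro summable_mult) (simp add: lp_def)
    fix n
    have "norm (z n) \<le> (norm R * norm L) * norm (x n)"
      using mult_left_mono[OF norm_blinfun[of L "x n"] norm_ge_zero[of R]] by (simp add: z_def mult.assoc)
    then have "norm (z n) powr p \<le> ((norm R * norm L) * norm (x n)) powr p"
      using p by (intro powr_mono2) auto
    then show "norm (norm (z n) powr p) \<le> (norm R * norm L) powr p * norm (x n) powr p"
      by (simp add: powr_mult)
  qed
  moreover have "(L o\<^sub>L T o\<^sub>L R) y \<in> p_co p z" if y: "norm y \<le> 1" for y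
  proof -
    have "norm R * norm y \<le> norm R * 1" using y by (intro mult_left_mono) auto
    then have Ry: "norm (R y) \<le> norm R" using norm_blinfun[of R y] by linarith
    define v where "v = R y /\<^sub>R norm R"
    have v: "R y = norm R *\<^sub>R v" "norm v \<le> 1"
    proof -
      show "R y = norm R *\<^sub>R v" by (cases "R = 0") (simp_all add: v_def)
      show "norm v \<le> 1" using Ry by (cases "R = 0") (simp_all add: v_def field_simps)
    qed
    then obtain a where a: "a \<in> coeff_ball p" "(\<lambda>n. a n *\<^sub>R x n) sums T v"
      using x(2) unfolding p_co_def image_subset_iff by force
    have "(\<lambda>n. norm R *\<^sub>R L (a n *\<^sub>R x n)) sums (norm R *\<^sub>R L (T v))"
      by (intro sums_scaleR_right bounded_linear.sums[OF blinfun.bounded_linear_right] a(2))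
    then have "(\<lambda>n. a n *\<^sub>R z n) sums ((L o\<^sub>L T o\<^sub>L R) y)"
      by (simp add: z_def v(1) blinfun.scaleR_right mult.commute)
    then show ?thesis unfolding p_co_def using a(1) by blast
  qed
  then have "(L o\<^sub>L T o\<^sub>L R) ` cball 0 1 \<subseteq> p_co p z" by auto
  ultimately show ?thesis unfolding compact_ops_def by blast
qed

text \<open>Replacing both outer factors by finite-rank approximants leaves two error terms, each
  with one small outer factor around the same compact operator. The ideal inequality makes their
  duals tend to zero in the summing norm, the quantity that the hypothesis of the theorem can
  compare.\<close>

lemma min_kernel_approximation:
  fixes T :: "'b::banach \<Rightarrow>\<^sub>L 'a::banach"
  assumes p: "1 \<le> p" and T: "T \<in> min_kernel p"
  obtains F where "\<And>n :: nat. finite_rank (F n)" "F \<longlonglongrightarrow> T"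
    "\<And>n. dual_op (T - F n) \<in> summing_ops p" "(\<lambda>n. pi_norm p (dual_op (T - F n))) \<longlonglongrightarrow> 0"
    "dual_op T \<in> summing_ops p" "pi_norm p (dual_op T) \<le> kappa p T"
  using p
proof (cases rule: ereal_ge_one_cases)
  case 1
  then have "T \<in> approximable_ops" using T by (simp add: min_kernel_def)
  then obtain F where F: "\<And>n. finite_rank (F n)" "F \<longlonglongrightarrow> T"
    unfolding approximable_ops_iff by blast
  have "(\<lambda>n. dual_op T - dual_op (F n)) \<longlonglongrightarrow> dual_op T - dual_op T"
    by (intro tendsto_diff tendsto_const tendsto_dual_op F(2))
  then have "(\<lambda>n. norm (dual_op (T - F n))) \<longlonglongrightarrow> 0"
    using tendsto_norm_zero by (simp add: dual_op_diff)
  then show ?thesis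
    using that[OF F] 1 by (simp add: norm_dual_op_le kappa_def)
next
  case (2 p')
  then obtain R :: "'b \<Rightarrow>\<^sub>L factor_space" and T\<^sub>0 and S :: "factor_space \<Rightarrow>\<^sub>L 'a"
    where T_eq: "T = S o\<^sub>L T\<^sub>0 o\<^sub>L R" and R: "R \<in> approximable_ops" and T\<^sub>0: "T\<^sub>0 \<in> compact_ops p'"
      and S: "S \<in> approximable_ops"
    using T unfolding min_kernel_def by auto
  obtain G where G: "\<And>n. finite_rank (G n)" "G \<longlonglongrightarrow> R"
    using R unfolding approximable_ops_iff by blast
  obtain H where H: "\<And>n. finite_rank (H n)" "H \<longlonglongrightarrow> S"
    using S unfolding approximable_ops_iff by blast
  define F where "F n = H n o\<^sub>L T\<^sub>0 o\<^sub>L G n" for n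
  have "F \<longlonglongrightarrow> T"
    unfolding F_def T_eq
    by (intro bounded_bilinear.tendsto[OF bounded_bilinear_blinfun_compose] G H tendsto_const)
  have "finite_rank (F n)" for n
  proof -
    have "F n = id_blinfun o\<^sub>L H n o\<^sub>L (T\<^sub>0 o\<^sub>L G n)" by (rule blinfun_eqI) (simp add: F_def)
    then show ?thesis using finite_rank_compose[OF H(1)] by metis
  qed
  define \<kappa> where "\<kappa> = kappa (ereal p') T\<^sub>0"
  have \<kappa>: "\<kappa> \<in> summing_constants p' (dual_op T\<^sub>0)"
    unfolding \<kappa>_def by (rule kappa_summing_constant[OF 2(2) T\<^sub>0])
  define c where "c n = norm R * \<kappa> * norm (S - H n) + norm (R - G n) * \<kappa> * norm (H n)" for n
  have c: "c n \<in> summing_constants p' (dual_op (T - F n))" for n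
  proof -
    have "T - F n = ((S - H n) o\<^sub>L T\<^sub>0 o\<^sub>L R) + (H n o\<^sub>L T\<^sub>0 o\<^sub>L (R - G n))"
      by (rule blinfun_eqI) (simp add: T_eq F_def blinfun.bilinear_simps)
    then have "dual_op (T - F n) = dual_op ((S - H n) o\<^sub>L T\<^sub>0 o\<^sub>L R) + dual_op (H n o\<^sub>L T\<^sub>0 o\<^sub>L (R - G n))"
      by (simp only: dual_op_add)
    then show ?thesis
      unfolding c_def using summing_constants_add[OF 2(2) summing_constants_dual_compose[OF 2(2) \<kappa>]
        summing_constants_dual_compose[OF 2(2) \<kappa>]] by metis
  qed
  have null: "(\<lambda>n. norm (S - H n)) \<longlonglongrightarrow> norm (S - S)" "(\<lambda>n. norm (R - G n)) \<longlonglongrightarrow> norm (R - R)"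
    by (intro tendsto_norm tendsto_diff tendsto_const G H)+
  then have "c \<longlonglongrightarrow> norm R * \<kappa> * norm (S - S) + norm (R - R) * \<kappa> * norm S"
    unfolding c_def by (intro tendsto_add tendsto_mult tendsto_const null tendsto_norm[OF H(2)])
  then have c0: "c \<longlonglongrightarrow> 0" by simp
  have ops: "dual_op (T - F n) \<in> summing_ops p" and le: "pi_norm p (dual_op (T - F n)) \<le> c n" for n
    using pi_norm_le[OF c[of n]] 2(1) by simp_all
  have "0 \<le> pi_norm p (dual_op (T - F n))" for n
    using norm_le_pi_norm[OF p ops[of n]] norm_ge_zero order_trans by blast
  then have "(\<lambda>n. pi_norm p (dual_op (T - F n))) \<longlonglongrightarrow> 0"
    by (intro real_tendsto_sandwich[OF _ _ tendsto_const c0]) (auto simp: le)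
  moreover have "kappa p T \<in> summing_constants p' (dual_op T)"
    unfolding 2(1) by (rule kappa_summing_constant[OF 2(2)]) (simp add: T_eq compact_ops_compose 2(2) T\<^sub>0)
  then have "dual_op T \<in> summing_ops p" "pi_norm p (dual_op T) \<le> kappa p T"
    using pi_norm_le 2(1) by blast+
  ultimately show ?thesis
    using that[OF \<open>\<And>n. finite_rank (F n)\<close> \<open>F \<longlonglongrightarrow> T\<close> ops] by blast
qed

text \<open>The comparison of summing norms yields coverings for finite-rank operators only, so
  \<open>T\<close> is rebuilt from telescoping differences of its approximants. Letting the source
  index be infinite makes the same argument serve both inclusions and the norm estimate.\<close>

lemma min_kernel_comparison:
  fixes p :: ereal and q :: real and T :: "'b::banach \<Rightarrow>\<^sub>L 'a::banach"
  assumes p: "1 \<le> p" and q: "1 \<le> q" and A: "0 < A"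
    and sub: "(summing_ops p :: (('a \<Rightarrow>\<^sub>L real) \<Rightarrow>\<^sub>L ('b \<Rightarrow>\<^sub>L real)) set) \<subseteq> summing_ops (ereal q)"
    and le: "\<And>T :: ('a \<Rightarrow>\<^sub>L real) \<Rightarrow>\<^sub>L ('b \<Rightarrow>\<^sub>L real). T \<in> summing_ops p \<Longrightarrow> pi_norm (ereal q) T \<le> A * pi_norm p T"
    and T: "T \<in> min_kernel p"
  shows "T \<in> min_kernel (ereal q)" "kappa (ereal q) T \<le> A * kappa p T"
proof -
  obtain F where F: "\<And>n :: nat. finite_rank (F n)" "F \<longlonglongrightarrow> T"
    and ops: "\<And>n. dual_op (T - F n) \<in> summing_ops p" and lim: "(\<lambda>n. pi_norm p (dual_op (T - F n))) \<longlonglongrightarrow> 0"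
    and opsT: "dual_op T \<in> summing_ops p" and \<kappa>: "pi_norm p (dual_op T) \<le> kappa p T"
    by (rule min_kernel_approximation[OF p T]) blast
  define \<kappa> where "\<kappa> = kappa p T"
  have \<kappa>0: "0 \<le> \<kappa>" using order_trans[OF norm_ge_zero norm_le_pi_norm[OF p opsT]] \<kappa> by (simp add: \<kappa>_def)
  have fin_cov: "fin_covered q c W"
    if "finite_rank W" "dual_op W \<in> summing_ops p" "A * pi_norm p (dual_op W) < c" for W :: "'b \<Rightarrow>\<^sub>L 'a" and c
  proof -
    have "pi_norm (ereal q) (dual_op W) \<in> summing_constants q (dual_op W)"
      using sub that(2) by (intro pi_norm_summing_constant[OF q]) blast
    moreover have "pi_norm (ereal q) (dual_op W) < c" using le[OF that(2)] that(3) by linarith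
    ultimately show ?thesis using fin_covered_finite_rank[OF q that(1)] by blast
  qed
  have decomposition: "\<exists>W. (\<forall>k. finite_rank (W k)) \<and> W sums T \<and> fin_covered q (A * (\<kappa> + 2 * e)) (W 0) \<and>
      (\<forall>k. fin_covered q (3 * A * e * (1 / 16) ^ k) (W (Suc k)))" if e: "0 < e" for e
  proof -
    \<comment> \<open>The condition \<open>N \<ge> k\<close> sends the selected indices to infinity,
      so the selected approximants still converge to \<open>T\<close>.\<close>
    have ex: "\<exists>N\<ge>k. pi_norm p (dual_op (T - F N)) < e * (1 / 16) ^ k" for k
    proof -
      have "0 < e * (1 / 16) ^ k" using e by simp
      then have "\<forall>\<^sub>F n in sequentially. pi_norm p (dual_op (T - F n)) < e * (1 / 16) ^ k"
        by (rule order_tendstoD(2)[OF lim])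
      then have "\<forall>\<^sub>F n in sequentially. k \<le> n \<and> pi_norm p (dual_op (T - F n)) < e * (1 / 16) ^ k"
        using eventually_ge_at_top[of k] by eventually_elim simp
      then show ?thesis by (auto simp: eventually_sequentially)
    qed
    obtain N where N: "\<And>k. k \<le> N k" "\<And>k. pi_norm p (dual_op (T - F (N k))) < e * (1 / 16) ^ k"
      using choice[of "\<lambda>k N. k \<le> N \<and> pi_norm p (dual_op (T - F N)) < e * (1 / 16) ^ k"] ex by blast
    define W where "W k = (if k = 0 then F (N 0) else F (N k) - F (N (k - 1)))" for k
    have "(\<Sum>k<Suc n. W k) = F (N n)" for n
      by (induction n) (simp_all add: W_def)
    moreover have "(\<lambda>n. F (N n)) \<longlonglongrightarrow> T"
      by (rule filterlim_compose[OF F(2)]) (rule filterlim_at_top_mono[OF filterlim_ident], simp add: N(1))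
    ultimately have "(\<lambda>n. \<Sum>k<Suc n. W k) \<longlonglongrightarrow> T" by simp
    then have "W sums T" unfolding sums_def by (rule LIMSEQ_imp_Suc)
    moreover have "finite_rank (W k)" for k by (simp add: W_def F(1) finite_rank_diff)
    moreover have "fin_covered q (A * (\<kappa> + 2 * e)) (W 0)"
    proof (rule fin_cov)
      have d: "dual_op (W 0) = dual_op T - dual_op (T - F (N 0))"
        by (simp add: W_def flip: dual_op_diff)
      show "finite_rank (W 0)" by (simp add: W_def F(1))
      show "dual_op (W 0) \<in> summing_ops p" unfolding d by (rule pi_norm_diff(1)[OF p opsT ops])
      have "pi_norm p (dual_op (W 0)) \<le> pi_norm p (dual_op T) + pi_norm p (dual_op (T - F (N 0)))"
        unfolding d by (rule pi_norm_diff(2)[OF p opsT ops])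
      then have "pi_norm p (dual_op (W 0)) < \<kappa> + 2 * e"
        using \<kappa> N(2)[of 0] e by (simp add: \<kappa>_def)
      then show "A * pi_norm p (dual_op (W 0)) < A * (\<kappa> + 2 * e)" using A by simp
    qed
    moreover have "fin_covered q (3 * A * e * (1 / 16) ^ k) (W (Suc k))" for k
    proof (rule fin_cov)
      have d: "dual_op (W (Suc k)) = dual_op (T - F (N k)) - dual_op (T - F (N (Suc k)))"
        by (simp add: W_def flip: dual_op_diff)
      show "finite_rank (W (Suc k))" by (simp add: W_def F(1) finite_rank_diff)
      show "dual_op (W (Suc k)) \<in> summing_ops p" unfolding d by (rule pi_norm_diff(1)[OF p ops ops])
      have "pi_norm p (dual_op (W (Suc k))) \<le> pi_norm p (dual_op (T - F (N k))) + pi_norm p (dual_op (T - F (N (Suc k))))"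
        unfolding d by (rule pi_norm_diff(2)[OF p ops ops])
      moreover have "e * (1 / 16) ^ Suc k \<le> e * (1 / 16) ^ k" using e by simp
      moreover have "0 < e * (1 / 16) ^ k" using e by simp
      ultimately have "pi_norm p (dual_op (W (Suc k))) < 3 * (e * (1 / 16) ^ k)"
        using N(2)[of k] N(2)[of "Suc k"] by linarith
      then have "A * pi_norm p (dual_op (W (Suc k))) < A * (3 * (e * (1 / 16) ^ k))"
        using A by (rule mult_strict_left_mono)
      then show "A * pi_norm p (dual_op (W (Suc k))) < 3 * A * e * (1 / 16) ^ k"
        by (simp add: mult_ac)
    qed
    ultimately show ?thesis by blast
  qed
  show "T \<in> min_kernel (ereal q)"
  proof -
    obtain W where W: "\<And>k. finite_rank (W k)" "W sums T" "fin_covered q (A * (\<kappa> + 2 * 1)) (W 0)"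
      "\<And>k. fin_covered q (3 * A * 1 * (1 / 16) ^ k) (W (Suc k))"
      using decomposition[of 1] by auto
    \<comment> \<open>48 = 3 * 16 absorbs the shift between the index of \<open>W (Suc k)\<close>
      and the exponent k of its bound.\<close>
    define C where "C = max (A * (\<kappa> + 2)) (48 * A)"
    have "fin_covered q (C * (1 / 16) ^ n) (W n)" for n
    proof (cases n)
      case 0
      then show ?thesis using fin_covered_mono[OF W(3)] by (simp add: C_def)
    next
      case (Suc k)
      have "48 * A * (1 / 16) ^ n \<le> C * (1 / 16) ^ n" by (intro mult_right_mono) (auto simp: C_def)
      then show ?thesis using fin_covered_mono[OF W(4)[of k]] Suc by simp
    qed
    then show ?thesis by (rule min_kernel_series[OF q W(1) _ W(2)])
  qed
  have bound: "kappa (ereal q) T \<le> A * (\<kappa> + 2 * (t * t)) / (1 - t) + 12 * A * t" if t: "0 < t" "t < 1" for t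
  proof -
    obtain W where W: "\<And>k. finite_rank (W k)" "W sums T" "fin_covered q (A * (\<kappa> + 2 * (t * t))) (W 0)"
      "\<And>k. fin_covered q (3 * A * (t * t) * (1 / 16) ^ k) (W (Suc k))"
      using decomposition[of "t * t"] t by auto
    \<comment> \<open>The main term receives mass 1 - t and the corrections mass at most t. Since
      \<open>e = t * t\<close>, dividing the corrections by their masses leaves vectors of order t,
      and only \<open>A * \<kappa>\<close> remains as t tends to 0.\<close>
    define s where "s n = (case n of 0 \<Rightarrow> 1 - t | Suc k \<Rightarrow> t / 2 * (1 / 2) ^ k)" for n
    define d where "d n = (case n of 0 \<Rightarrow> A * (\<kappa> + 2 * (t * t)) / (1 - t) | Suc k \<Rightarrow> 6 * A * t * (1 / 8) ^ k)" for n
    have geo2: "(\<Sum>k<M. (1 / 2 :: real) ^ k) \<le> 2" for M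
      using sum_le_suminf[OF summable_geometric[of "1 / 2 :: real"], of "{..<M}"] suminf_geometric[of "1 / 2 :: real"] by simp
    have geo8: "(\<Sum>k<M. (1 / 8 :: real) ^ k) \<le> 2" for M
      using sum_le_suminf[OF summable_geometric[of "1 / 8 :: real"], of "{..<M}"] suminf_geometric[of "1 / 8 :: real"] by simp
    have "covered q (A * (\<kappa> + 2 * (t * t)) / (1 - t) + 12 * A * t) T"
    proof (rule covered_suminf[OF q _ _ _ _ _ W(2)])
      show "0 < s n" for n using t by (simp add: s_def split: nat.split)
      show "(\<Sum>n<M. s n) \<le> 1" for M
      proof (cases M)
        case (Suc m)
        have "(\<Sum>k<m. t / 2 * (1 / 2) ^ k) = t / 2 * (\<Sum>k<m. (1 / 2) ^ k)" by (simp only: sum_distrib_left)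
        also have "\<dots> \<le> t / 2 * 2" using t geo2[of m] by (intro mult_left_mono) auto
        finally show ?thesis unfolding Suc sum.lessThan_Suc_shift by (simp add: s_def)
      qed simp
      show "0 \<le> d n" for n using t A \<kappa>0 by (simp add: d_def split: nat.split)
      show "(\<Sum>n<M. d n) \<le> A * (\<kappa> + 2 * (t * t)) / (1 - t) + 12 * A * t" for M
      proof (cases M)
        case 0
        then show ?thesis using t A \<kappa>0 by simp
      next
        case (Suc m)
        have "(\<Sum>k<m. 6 * A * t * (1 / 8) ^ k) = 6 * A * t * (\<Sum>k<m. (1 / 8) ^ k)" by (simp only: sum_distrib_left)
        also have "\<dots> \<le> 6 * A * t * 2" using t A geo8[of m] by (intro mult_left_mono) auto
        finally show ?thesis unfolding Suc sum.lessThan_Suc_shift by (simp add: d_def)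
      qed
      show "fin_covered q (s n * d n) (W n)" for n
      proof (cases n)
        case 0
        then show ?thesis using W(3) t by (simp add: s_def d_def)
      next
        case (Suc k)
        have "s n * d n = 3 * A * (t * t) * ((1 / 2) ^ k * (1 / 8) ^ k)" by (simp add: Suc s_def d_def)
        also have "(1 / 2 :: real) ^ k * (1 / 8) ^ k = (1 / 16) ^ k"
          unfolding power_mult_distrib[symmetric] by simp
        finally show ?thesis using W(4)[of k] by (simp only: Suc)
      qed
    qed
    then show ?thesis by (rule kappa_le)
  qed
  have "((\<lambda>t. A * (\<kappa> + 2 * (t * t)) / (1 - t) + 12 * A * t) \<longlongrightarrow> A * (\<kappa> + 2 * (0 * 0)) / (1 - 0) + 12 * A * 0) (at_right 0)"
    by (intro tendsto_intros) auto
  moreover have "\<forall>\<^sub>F t in at_right (0 :: real). kappa (ereal q) T \<le> A * (\<kappa> + 2 * (t * t)) / (1 - t) + 12 * A * t"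
    unfolding eventually_at_right_field by (intro exI[of _ 1]) (auto intro: bound)
  ultimately have "kappa (ereal q) T \<le> A * (\<kappa> + 2 * (0 * 0)) / (1 - 0) + 12 * A * 0"
    by (rule tendsto_lowerbound) simp
  then show "kappa (ereal q) T \<le> A * kappa p T" by (simp add: \<kappa>_def)
qed

lemma min_kernel_subset:
  fixes p q :: ereal
  assumes p: "1 \<le> p" and q: "1 \<le> q"
    and sub: "(summing_ops p :: (('a::banach \<Rightarrow>\<^sub>L real) \<Rightarrow>\<^sub>L ('b::banach \<Rightarrow>\<^sub>L real)) set) \<subseteq> summing_ops q"
  shows "(min_kernel p :: ('b \<Rightarrow>\<^sub>L 'a) set) \<subseteq> min_kernel q"
proof
  fix T :: "'b \<Rightarrow>\<^sub>L 'a" assume T: "T \<in> min_kernel p"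
  show "T \<in> min_kernel q"
    using q
  proof (cases rule: ereal_ge_one_cases)
    case 1
    obtain F where "\<And>n :: nat. finite_rank (F n)" "F \<longlonglongrightarrow> T"
      by (rule min_kernel_approximation[OF p T]) blast
    then have "T \<in> approximable_ops" unfolding approximable_ops_iff by blast
    then show ?thesis using 1 by (simp add: min_kernel_def)
  next
    case (2 q')
    obtain A where "0 < A" "\<And>T :: ('a \<Rightarrow>\<^sub>L real) \<Rightarrow>\<^sub>L ('b \<Rightarrow>\<^sub>L real). T \<in> summing_ops p \<Longrightarrow> pi_norm (ereal q') T \<le> A * pi_norm p T"
      by (rule summing_ops_norm_comparison[OF p 2(2) sub[unfolded 2(1)]]) blast
    then show ?thesis
      unfolding 2(1) using min_kernel_comparison(1)[OF p 2(2) _ sub[unfolded 2(1)] _ T] by blast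
  qed
qed

theorem theorem3p13:
  fixes r s :: ereal
  assumes "1 \<le> r" and "r < s"
    and "(summing_ops r :: (('x::banach \<Rightarrow>\<^sub>L real) \<Rightarrow>\<^sub>L ('y::banach \<Rightarrow>\<^sub>L real)) set) = summing_ops s"
  shows "(min_kernel s :: ('y \<Rightarrow>\<^sub>L 'x) set) = min_kernel r \<and>
    (\<forall>A>0.
      (\<forall>T \<in> (summing_ops s :: (('x \<Rightarrow>\<^sub>L real) \<Rightarrow>\<^sub>L ('y \<Rightarrow>\<^sub>L real)) set).
        pi_norm r T \<le> A * pi_norm s T) \<longrightarrow>
      (\<forall>T \<in> (min_kernel s :: ('y \<Rightarrow>\<^sub>L 'x) set). kappa r T \<le> A * kappa s T))"
proof (intro conjI allI impI ballI)
  have s: "1 \<le> s" using assms by simp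
  show "(min_kernel s :: ('y \<Rightarrow>\<^sub>L 'x) set) = min_kernel r"
    using min_kernel_subset[OF s assms(1)] min_kernel_subset[OF assms(1) s] assms(3) by blast
  \<comment> \<open>The strict inequality makes \<open>r\<close> finite, as the target index of
    \<open>min_kernel_comparison\<close> has to be.\<close>
  obtain r' where r': "r = ereal r'" "1 \<le> r'" using assms(1,2) by (cases r) auto
  fix A :: real and T :: "'y \<Rightarrow>\<^sub>L 'x"
  assume "0 < A" and le: "\<forall>T\<in>(summing_ops s :: (('x \<Rightarrow>\<^sub>L real) \<Rightarrow>\<^sub>L ('y \<Rightarrow>\<^sub>L real)) set). pi_norm r T \<le> A * pi_norm s T"
    and T: "T \<in> min_kernel s"
  then show "kappa r T \<le> A * kappa s T"
    unfolding r'(1) using assms(3) by (intro min_kernel_comparison(2)[OF s r'(2)]) (auto simp: r'(1))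
qed

end
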